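(* Let $S$ be a $\mathbb{C}$-algebra upon which a finite group $G$ acts by automorphisms, and let $A=S\#G$. Let $P_\bullet$ be any $G$-compatible projective $S^e$-resolution of $S$, and let $\Psi$ and $\Phi$ be chain maps from the bar resolution of $S$ to $P_\bullet$ and from $P_\bullet$ to the bar resolution of $S$, respectively. The isomorphism $\mathrm{HH}^\bullet(A)\cong\mathrm{HH}^\bullet(S,A)^G$ induces the following bracket on $\mathrm{HH}^\bullet(S,A)^G$ (expressed via $P_\bullet$): for $\alpha,\beta$ in $\mathrm{Hom}_{S^e}(P_\bullet,A)$ representing $G$-invariant cohomology classes, the cohomology class of $[\alpha,\beta]$ is represented at the cochain level by $$\frac1{|G|^2}\sum_{a,b\in G}\Phi^*\big[\Theta^*\,{}^a(\Psi^*\alpha),\ \Theta^*\,{}^b(\Psi^*\beta)\big],$$ where the bracket on the right side is the Gerstenhaber bracket for $\mathrm{HH}^\bullet(A)$ at the cochain level.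
   Context: $S\#G$ is $S\otimes\mathbb{C}G$ (write $s\overline g$ for $s\otimes g$) with $(r\overline g)(s\overline h)=r({}^gs)\overline{gh}$. $G$ acts on $A$ by conjugation by $\overline g$, and on maps by $({}^g\theta)(x)={}^g(\theta({}^{g^{-1}}x))$. $S^e=S\otimes S^{op}$. $\mathrm{HH}^\bullet(A,M)=\mathrm{Ext}^\bullet_{A\otimes A^{op}}(A,M)$, $\mathrm{HH}^\bullet(A)=\mathrm{HH}^\bullet(A,A)$. Bar cochains: $\mathrm{Hom}_{S^e}(S^{\otimes(p+2)},A)\cong\mathrm{Hom}_{\mathbb C}(S^{\otimes p},A)$ and $\mathrm{Hom}_{A^e}(A^{\otimes(p+2)},A)\cong\mathrm{Hom}_{\mathbb C}(A^{\otimes p},A)$. A projective resolution $P_\bullet$ of the $S^e$-module $S$ is $G$-compatible if $G$ acts on each term (compatibly with the $S^e$-module structure, ${}^g(x\cdot y)={}^gx\cdot{}^gy$ for $x\in S^e,y\in P_p$) and the action commutes with the differentials. The chain maps $\Psi_p:S^{\otimes(p+2)}\to P_p$, $\Phi_p:P_p\to S^{\otimes(p+2)}$ are $S^e$-linear chain maps lifting the identity of $S$, and $\Psi^*,\Phi^*$ are the maps obtained by applying $\mathrm{Hom}_{S^e}(-,A)$. On the right side, $\Phi^*$ is applied to the restriction of the cochain from $A^{\otimes m}$ to $S^{\otimes m}$. $\Theta^*$: for $\kappa\in\mathrm{Hom}_{\mathbb C}(S^{\otimes p},A)$, $\Theta^*(\kappa)(f_1\overline g_1\otimes\cdots\otimes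 f_p\overline g_p)=\kappa(f_1\otimes{}^{g_1}f_2\otimes\cdots\otimes{}^{g_1\cdots g_{p-1}}f_p)\,\overline{g_1\cdots g_p}$. The isomorphism $\mathrm{HH}^\bullet(A)\cong\mathrm{HH}^\bullet(S,A)^G$ is the one induced by restricting cochains from $A$ to $S$. Gerstenhaber bracket: for $f\in\mathrm{Hom}_{\mathbb C}(A^{\otimes p},A)$, $f'\in\mathrm{Hom}_{\mathbb C}(A^{\otimes q},A)$, $[f,f']=f\,\overline\circ\, f'-(-1)^{(p-1)(q-1)}f'\,\overline\circ\, f$, where $(f\,\overline\circ\, f')(a_1\otimes\cdots\otimes a_{p+q-1})=\sum_{k=1}^p(-1)^{(q-1)(k-1)}f(a_1\otimes\cdots\otimes a_{k-1}\otimes f'(a_k\otimes\cdots\otimes a_{k+q-1})\otimes a_{k+q}\otimes\cdots\otimes a_{p+q-1})$. *)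

theory Defs
  imports "HOL-Analysis.Finite_Cartesian_Product" "HOL-Library.Poly_Mapping"
begin

section \<open>Algebras over the complex numbers\<close>

class complex_vector = ab_group_add +
  fixes scaleC :: "complex \<Rightarrow> 'a \<Rightarrow> 'a"  (infixr \<open>*\<^sub>C\<close> 75)
  assumes scaleC_add_right: "a *\<^sub>C (x + y) = a *\<^sub>C x + a *\<^sub>C y"
    and scaleC_add_left: "(a + b) *\<^sub>C x = a *\<^sub>C x + b *\<^sub>C x"
    and scaleC_scaleC: "a *\<^sub>C (b *\<^sub>C x) = (a * b) *\<^sub>C x"
    and scaleC_one: "1 *\<^sub>C x = x"

text \<open>\<^class>\<open>monoid_mult\<close> rather than \<^class>\<open>ring_1\<close>, so that the zero algebra is not excluded.\<close>

class complex_algebra = complex_vector + ring + monoid_mult +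
  assumes mult_scaleC_left: "(a *\<^sub>C x) * y = a *\<^sub>C (x * y)"
    and mult_scaleC_right: "x * (a *\<^sub>C y) = a *\<^sub>C (x * y)"

lemma scaleC_zero_right [simp]: "a *\<^sub>C (0 :: 'a::complex_vector) = 0"
  using scaleC_add_right [of a 0 0] by simp

lemma scaleC_zero_left [simp]: "0 *\<^sub>C (x :: 'a::complex_vector) = 0"
  using scaleC_add_left [of 0 0 x] by simp

lemma scaleC_diff_right: "a *\<^sub>C ((x :: 'a::complex_vector) - y) = a *\<^sub>C x - a *\<^sub>C y"
  using scaleC_add_right [of a "x - y" y] by (simp add: algebra_simps)

lemma scaleC_diff_left: "(a - b) *\<^sub>C (x :: 'a::complex_vector) = a *\<^sub>C x - b *\<^sub>C x"
  using scaleC_add_left [of "a - b" b x] by (simp add: algebra_simps)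

instantiation vec :: (complex_vector, finite) complex_vector
begin

definition scaleC_vec_def: "a *\<^sub>C v = (\<chi> i. a *\<^sub>C (v $ i))"

instance
  by standard
    (simp_all add: scaleC_vec_def vec_eq_iff scaleC_add_right scaleC_add_left scaleC_scaleC scaleC_one)

end

text \<open>A \<open>\<complex>\<close>-linear map out of \<open>V\<^bsup>\<otimes>n\<^esup>\<close> is represented by the \<open>n\<close>-linear map
  \<open>[v\<^sub>1, \<dots>, v\<^sub>n] \<mapsto> f [v\<^sub>1, \<dots>, v\<^sub>n]\<close> on lists of length \<open>n\<close>.\<close>

definition multilinear :: "nat \<Rightarrow> ('a::complex_vector list \<Rightarrow> 'b::complex_vector) \<Rightarrow> bool" where
  "multilinear n f \<longleftrightarrow>
    (\<forall>xs ys x y. length xs + length ys + 1 = n \<longrightarrow>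
       f (xs @ (x + y) # ys) = f (xs @ x # ys) + f (xs @ y # ys)) \<and>
    (\<forall>xs ys c x. length xs + length ys + 1 = n \<longrightarrow>
       f (xs @ (c *\<^sub>C x) # ys) = c *\<^sub>C f (xs @ x # ys))"

text \<open>Cochains vanish on lists of any other length, so that equality of cochains is equality of
  functions.\<close>

definition cochains :: "nat \<Rightarrow> ('a::complex_vector list \<Rightarrow> 'b::complex_vector) set" where
  "cochains n = {f. multilinear n f \<and> (\<forall>xs. length xs \<noteq> n \<longrightarrow> f xs = 0)}"


section \<open>Tensor powers\<close>

text \<open>The type \<open>'a tens\<close> is the tensor algebra \<open>\<Oplus>\<^sub>n V\<^bsup>\<otimes>n\<^esup>\<close> of the space \<open>V = 'a\<close>: the free complex
  vector space on the words over \<open>'a\<close> modulo the relations of multilinearity. Since \<open>c\<close> is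
  arbitrary below, the additive subgroup \<open>tens_null\<close> is a subspace.\<close>

inductive_set tens_null :: "('a::complex_vector list \<Rightarrow>\<^sub>0 complex) set" where
  tens_null_zero: "0 \<in> tens_null"
| tens_null_diff: "u \<in> tens_null \<Longrightarrow> v \<in> tens_null \<Longrightarrow> u - v \<in> tens_null"
| tens_null_add: "Poly_Mapping.single (xs @ (x + y) # ys) c
     - Poly_Mapping.single (xs @ x # ys) c - Poly_Mapping.single (xs @ y # ys) c \<in> tens_null"
| tens_null_scale: "Poly_Mapping.single (xs @ (b *\<^sub>C x) # ys) c
     - Poly_Mapping.single (xs @ x # ys) (b * c) \<in> tens_null"

definition tens_rel ::
    "('a::complex_vector list \<Rightarrow>\<^sub>0 complex) \<Rightarrow> ('a list \<Rightarrow>\<^sub>0 complex) \<Rightarrow> bool" where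
  "tens_rel u v \<longleftrightarrow> u - v \<in> tens_null"

lemma tens_null_uminus: "u \<in> tens_null \<Longrightarrow> - u \<in> tens_null"
  using tens_null_diff [OF tens_null_zero] by fastforce

lemma tens_null_plus: "u \<in> tens_null \<Longrightarrow> v \<in> tens_null \<Longrightarrow> u + v \<in> tens_null"
  using tens_null_diff [OF _ tens_null_uminus] by fastforce

lemma map_cmul_diff:
  "Poly_Mapping.map ((*) (c::complex)) (u - v) =
     Poly_Mapping.map ((*) c) u - Poly_Mapping.map ((*) c) v"
  by (rule poly_mapping_eqI) (simp add: map.rep_eq lookup_minus when_def algebra_simps)

lemma map_cmul_single:
  "Poly_Mapping.map ((*) (c::complex)) (Poly_Mapping.single k d) = Poly_Mapping.single k (c * d)"
  by simp

lemma tens_null_cmul: "u \<in> tens_null \<Longrightarrow> Poly_Mapping.map ((*) c) u \<in> tens_null"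
proof (induction rule: tens_null.induct)
  case tens_null_zero
  have "Poly_Mapping.map ((*) c) 0 = (0 :: 'a list \<Rightarrow>\<^sub>0 complex)"
    by (rule poly_mapping_eqI) (simp add: map.rep_eq)
  then show ?case by (simp add: tens_null.tens_null_zero)
next
  case (tens_null_scale xs b x ys d)
  then show ?case
    using tens_null.tens_null_scale [of xs b x ys "c * d"]
    by (simp add: map_cmul_diff mult.left_commute)
qed (auto simp: map_cmul_diff intro: tens_null.intros)

quotient_type (overloaded) 'a tens = "'a::complex_vector list \<Rightarrow>\<^sub>0 complex" / tens_rel
proof (rule equivpI)
  show "reflp tens_rel" by (auto simp: reflp_def tens_rel_def tens_null_zero)
  show "symp tens_rel"
    unfolding symp_def tens_rel_def using tens_null_uminus by fastforce
  show "transp tens_rel"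
    unfolding transp_def tens_rel_def using tens_null_plus by fastforce
qed

instantiation tens :: (complex_vector) complex_vector
begin

lift_definition zero_tens :: "'a tens" is 0 .

lift_definition plus_tens :: "'a tens \<Rightarrow> 'a tens \<Rightarrow> 'a tens" is "(+)"
  unfolding tens_rel_def by (simp add: add_diff_add tens_null_plus)

lift_definition minus_tens :: "'a tens \<Rightarrow> 'a tens \<Rightarrow> 'a tens" is "(-)"
proof -
  fix u v u' v' :: "'a list \<Rightarrow>\<^sub>0 complex"
  assume "tens_rel u v" "tens_rel u' v'"
  moreover have "(u - u') - (v - v') = (u - v) - (u' - v')" by simp
  ultimately show "tens_rel (u - u') (v - v')"
    unfolding tens_rel_def by (simp only: tens_null_diff)
qed

lift_definition uminus_tens :: "'a tens \<Rightarrow> 'a tens" is uminus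
  unfolding tens_rel_def by (simp only: minus_diff_minus tens_null_uminus)

lift_definition scaleC_tens :: "complex \<Rightarrow> 'a tens \<Rightarrow> 'a tens" is "\<lambda>c. Poly_Mapping.map ((*) c)"
  unfolding tens_rel_def by (simp only: tens_null_cmul flip: map_cmul_diff)

instance
proof
  fix t u v :: "'a tens" and a b :: complex
  have eq: "tens_rel x y" if "x = y" for x y :: "'a list \<Rightarrow>\<^sub>0 complex"
    using that by (simp add: tens_rel_def tens_null_zero)
  show "t + u + v = t + (u + v)" by transfer (rule eq, simp add: add.assoc)
  show "t + u = u + t" by transfer (rule eq, simp add: add.commute)
  show "0 + t = t" by transfer (rule eq, simp)
  show "- t + t = 0" by transfer (rule eq, simp)
  show "t - u = t + - u" by transfer (rule eq, simp)
  show "a *\<^sub>C (t + u) = a *\<^sub>C t + a *\<^sub>C u"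
    by transfer (rule eq, rule poly_mapping_eqI,
        auto simp: map.rep_eq lookup_add when_def algebra_simps simp flip: distrib_left)
  show "(a + b) *\<^sub>C t = a *\<^sub>C t + b *\<^sub>C t"
    by transfer (rule eq, rule poly_mapping_eqI,
        simp add: map.rep_eq lookup_add when_def algebra_simps)
  show "a *\<^sub>C b *\<^sub>C t = (a * b) *\<^sub>C t"
    by transfer (rule eq, rule poly_mapping_eqI, simp add: map.rep_eq when_def)
  show "1 *\<^sub>C t = t"
    by transfer (rule eq, rule poly_mapping_eqI, simp add: map.rep_eq when_def)
qed

end

definition tensor :: "'a::complex_vector list \<Rightarrow> 'a tens" where
  "tensor xs = abs_tens (Poly_Mapping.single xs 1)"

definition tens_power :: "nat \<Rightarrow> 'a::complex_vector tens set" where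
  "tens_power n = {abs_tens u | u. Poly_Mapping.keys u \<subseteq> {xs. length xs = n}}"

text \<open>The linear map with \<open>tensor xs \<mapsto> F xs\<close>, for \<open>F\<close> multilinear in each degree; it is computed
  from a representative, whose choice is irrelevant by \<open>tens_lift_abs\<close> below.\<close>

definition free_lift :: "('a list \<Rightarrow> 'b::complex_vector) \<Rightarrow> ('a list \<Rightarrow>\<^sub>0 complex) \<Rightarrow> 'b" where
  "free_lift F u = (\<Sum>xs\<in>Poly_Mapping.keys u. Poly_Mapping.lookup u xs *\<^sub>C F xs)"

definition tens_lift :: "('a::complex_vector list \<Rightarrow> 'b::complex_vector) \<Rightarrow> 'a tens \<Rightarrow> 'b" where
  "tens_lift F t = free_lift F (rep_tens t)"

lemma free_lift_superset:
  assumes "finite K" "Poly_Mapping.keys u \<subseteq> K"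
  shows "free_lift F u = (\<Sum>xs\<in>K. Poly_Mapping.lookup u xs *\<^sub>C F xs)"
  unfolding free_lift_def
  by (rule sum.mono_neutral_left) (use assms in \<open>auto simp: in_keys_iff\<close>)

lemma free_lift_diff: "free_lift F (u - v) = free_lift F u - free_lift F v"
proof -
  let ?K = "Poly_Mapping.keys u \<union> Poly_Mapping.keys v"
  show ?thesis
    using keys_diff [of u v]
    by (simp add: free_lift_superset [of ?K] lookup_minus scaleC_diff_left sum_subtractf)
qed

lemma free_lift_single [simp]: "free_lift F (Poly_Mapping.single xs c) = c *\<^sub>C F xs"
  by (simp add: free_lift_def)

lemma free_lift_null:
  assumes F: "\<And>n. multilinear n F" and u: "u \<in> tens_null"
  shows "free_lift F u = 0"
  using u
proof (induction rule: tens_null.induct)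
  case (tens_null_add xs x y ys c)
  then show ?case
    using F [of "length xs + length ys + 1"]
    by (simp add: free_lift_diff multilinear_def scaleC_add_right)
next
  case (tens_null_scale xs b x ys c)
  then show ?case
    using F [of "length xs + length ys + 1"]
    by (simp add: free_lift_diff multilinear_def scaleC_scaleC mult.commute)
qed (simp_all add: free_lift_diff, simp add: free_lift_def)

lemma tens_lift_abs:
  assumes "\<And>n. multilinear n F"
  shows "tens_lift F (abs_tens u) = free_lift F u"
proof -
  have "tens_rel (rep_tens (abs_tens u)) u"
    by (simp add: tens.abs_eq_iff [symmetric] Quotient3_abs_rep [OF Quotient3_tens])
  then show ?thesis
    using free_lift_null [OF assms] unfolding tens_lift_def tens_rel_def
    by (metis eq_iff_diff_eq_0 free_lift_diff)
qed

lemma tens_lift_tensor: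
  assumes "\<And>n. multilinear n F"
  shows "tens_lift F (tensor xs) = F xs"
  by (simp add: tensor_def tens_lift_abs [OF assms] scaleC_one)


section \<open>Bimodules, complexes and resolutions\<close>

text \<open>\<open>S\<^sup>e\<close>-modules are represented as \<open>S\<close>-bimodules on which \<open>\<complex>\<close> acts in the same way from both
  sides, \<open>(s \<otimes> t) \<cdot> x\<close> being \<open>s x t\<close>. The carrier is an additive subgroup of an ambient group.\<close>

record ('s, 'm) bimod =
  bcarrier :: "'m set"
  lmul :: "'s \<Rightarrow> 'm \<Rightarrow> 'm"
  rmul :: "'m \<Rightarrow> 's \<Rightarrow> 'm"

definition bimodule :: "('s::complex_algebra, 'm::ab_group_add) bimod \<Rightarrow> bool" where
  "bimodule M \<longleftrightarrow>
    0 \<in> bcarrier M \<and>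
    (\<forall>x\<in>bcarrier M. \<forall>y\<in>bcarrier M. x - y \<in> bcarrier M) \<and>
    (\<forall>s. \<forall>x\<in>bcarrier M. lmul M s x \<in> bcarrier M \<and> rmul M x s \<in> bcarrier M) \<and>
    (\<forall>s. \<forall>x\<in>bcarrier M. \<forall>y\<in>bcarrier M.
       lmul M s (x + y) = lmul M s x + lmul M s y \<and> rmul M (x + y) s = rmul M x s + rmul M y s) \<and>
    (\<forall>s t. \<forall>x\<in>bcarrier M.
       lmul M (s + t) x = lmul M s x + lmul M t x \<and> rmul M x (s + t) = rmul M x s + rmul M x t \<and>
       lmul M (s * t) x = lmul M s (lmul M t x) \<and> rmul M x (s * t) = rmul M (rmul M x s) t \<and>
       lmul M s (rmul M x t) = rmul M (lmul M s x) t) \<and>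
    (\<forall>x\<in>bcarrier M. lmul M 1 x = x \<and> rmul M x 1 = x) \<and>
    (\<forall>c. \<forall>x\<in>bcarrier M. lmul M (c *\<^sub>C 1) x = rmul M x (c *\<^sub>C 1))"

definition bimod_hom ::
    "('s::complex_algebra, 'm::ab_group_add) bimod \<Rightarrow> ('s, 'n::ab_group_add) bimod
      \<Rightarrow> ('m \<Rightarrow> 'n) \<Rightarrow> bool" where
  "bimod_hom M N f \<longleftrightarrow>
    (\<forall>x\<in>bcarrier M. f x \<in> bcarrier N) \<and>
    (\<forall>x\<in>bcarrier M. \<forall>y\<in>bcarrier M. f (x + y) = f x + f y) \<and>
    (\<forall>s. \<forall>x\<in>bcarrier M. f (lmul M s x) = lmul N s (f x) \<and> f (rmul M x s) = rmul N (f x) s)"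

definition regular_bimod :: "('s::complex_algebra, 's) bimod" where
  "regular_bimod = \<lparr>bcarrier = UNIV, lmul = (*), rmul = (*)\<rparr>"

definition tens_lmul :: "'s::complex_algebra \<Rightarrow> 's tens \<Rightarrow> 's tens" where
  "tens_lmul s = tens_lift (\<lambda>xs. if xs = [] then 0 else tensor ((s * hd xs) # tl xs))"

definition tens_rmul :: "'s::complex_algebra tens \<Rightarrow> 's \<Rightarrow> 's tens" where
  "tens_rmul t s = tens_lift (\<lambda>xs. if xs = [] then 0 else tensor (butlast xs @ [last xs * s])) t"

text \<open>\<open>S\<^bsup>\<otimes>n\<^esup>\<close> with outer multiplications (a bimodule for \<open>n > 0\<close>).\<close>

definition tens_bimod :: "nat \<Rightarrow> ('s::complex_algebra, 's tens) bimod" where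
  "tens_bimod n = \<lparr>bcarrier = tens_power n, lmul = tens_lmul, rmul = tens_rmul\<rparr>"

text \<open>The direct sum of copies of \<open>S \<otimes> S\<close> indexed by \<open>'i\<close>, i.e. the free \<open>S\<^sup>e\<close>-module on \<open>'i\<close>.\<close>

definition free_bimod :: "('s::complex_algebra, 'i \<Rightarrow>\<^sub>0 's tens) bimod" where
  "free_bimod =
    \<lparr>bcarrier = {u. \<forall>i. Poly_Mapping.lookup u i \<in> tens_power 2},
     lmul = (\<lambda>s. Poly_Mapping.map (tens_lmul s)),
     rmul = (\<lambda>u s. Poly_Mapping.map (\<lambda>t. tens_rmul t s) u)\<rparr>"

text \<open>Projective: a direct summand of a free module. Every module with carrier in \<open>'m\<close> is a
  quotient of the free module on \<open>'m\<close>, so this index set suffices.\<close>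

definition projective_bimod :: "('s::complex_algebra, 'm::ab_group_add) bimod \<Rightarrow> bool" where
  "projective_bimod M \<longleftrightarrow> bimodule M \<and>
    (\<exists>(i :: 'm \<Rightarrow> 'm \<Rightarrow>\<^sub>0 's tens) r.
       bimod_hom M free_bimod i \<and> bimod_hom free_bimod M r \<and> (\<forall>x\<in>bcarrier M. r (i x) = x))"

text \<open>Complexes \<open>\<dots> \<rightarrow> X\<^sub>1 \<rightarrow> X\<^sub>0 \<rightarrow> S\<close>, with \<open>cdiff X n\<close> the differential from degree \<open>n + 1\<close> to \<open>n\<close>.\<close>

record ('s, 'm) aug_complex =
  cterm :: "nat \<Rightarrow> ('s, 'm) bimod"
  cdiff :: "nat \<Rightarrow> 'm \<Rightarrow> 'm"
  caug :: "'m \<Rightarrow> 's"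

definition projective_resolution ::
    "('s::complex_algebra, 'm::ab_group_add) aug_complex \<Rightarrow> bool" where
  "projective_resolution X \<longleftrightarrow>
    (\<forall>n. projective_bimod (cterm X n)) \<and>
    (\<forall>n. bimod_hom (cterm X (Suc n)) (cterm X n) (cdiff X n)) \<and>
    bimod_hom (cterm X 0) regular_bimod (caug X) \<and>
    caug X ` bcarrier (cterm X 0) = UNIV \<and>
    {x \<in> bcarrier (cterm X 0). caug X x = 0} = cdiff X 0 ` bcarrier (cterm X 1) \<and>
    (\<forall>n. {x \<in> bcarrier (cterm X (Suc n)). cdiff X n x = 0} =
       cdiff X (Suc n) ` bcarrier (cterm X (Suc (Suc n))))"

definition bar_resolution :: "('s::complex_algebra, 's tens) aug_complex" where
  "bar_resolution =
    \<lparr>cterm = (\<lambda>n. tens_bimod (n + 2)),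
     cdiff = (\<lambda>n. tens_lift (\<lambda>xs. \<Sum>i<length xs - 1.
       (-1) ^ i *\<^sub>C tensor (take i xs @ (xs ! i * xs ! (i + 1)) # drop (i + 2) xs))),
     caug = tens_lift (\<lambda>xs. if length xs = 2 then xs ! 0 * xs ! 1 else 0)\<rparr>"

definition chain_map_over_id ::
    "('s::complex_algebra, 'm::ab_group_add) aug_complex \<Rightarrow> ('s, 'n::ab_group_add) aug_complex
      \<Rightarrow> (nat \<Rightarrow> 'm \<Rightarrow> 'n) \<Rightarrow> bool" where
  "chain_map_over_id X Y F \<longleftrightarrow>
    (\<forall>n. bimod_hom (cterm X n) (cterm Y n) (F n)) \<and>
    (\<forall>n. \<forall>x\<in>bcarrier (cterm X (Suc n)). F n (cdiff X n x) = cdiff Y n (F (Suc n) x)) \<and>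
    (\<forall>x\<in>bcarrier (cterm X 0). caug Y (F 0 x) = caug X x)"


section \<open>Group actions and the skew group algebra\<close>

text \<open>The finite group \<open>G\<close> is a type of class \<^class>\<open>group_add\<close>, which does not assume
  commutativity: \<open>g + h\<close>, \<open>0\<close> and \<open>- g\<close> are the product \<open>gh\<close>, the unit and the inverse.\<close>

definition algebra_action :: "('g::{group_add,finite} \<Rightarrow> 's::complex_algebra \<Rightarrow> 's) \<Rightarrow> bool" where
  "algebra_action act \<longleftrightarrow>
    (\<forall>s. act 0 s = s) \<and> (\<forall>g h s. act (g + h) s = act g (act h s)) \<and>
    (\<forall>g s t. act g (s + t) = act g s + act g t \<and> act g (s * t) = act g s * act g t) \<and>
    (\<forall>g. act g 1 = 1) \<and> (\<forall>g c s. act g (c *\<^sub>C s) = c *\<^sub>C act g s)"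

text \<open>The action commutes with all maps of the resolution, including the augmentation to \<open>S\<close>.\<close>

definition G_compatible ::
    "('g::{group_add,finite} \<Rightarrow> 's::complex_algebra \<Rightarrow> 's) \<Rightarrow> ('s, 'm::ab_group_add) aug_complex
      \<Rightarrow> (nat \<Rightarrow> 'g \<Rightarrow> 'm \<Rightarrow> 'm) \<Rightarrow> bool" where
  "G_compatible act X r \<longleftrightarrow>
    (\<forall>n. \<forall>x\<in>bcarrier (cterm X n). r n 0 x = x) \<and>
    (\<forall>n g. \<forall>x\<in>bcarrier (cterm X n). r n g x \<in> bcarrier (cterm X n)) \<and>
    (\<forall>n g h. \<forall>x\<in>bcarrier (cterm X n). r n (g + h) x = r n g (r n h x)) \<and>
    (\<forall>n g. \<forall>x\<in>bcarrier (cterm X n). \<forall>y\<in>bcarrier (cterm X n).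
       r n g (x + y) = r n g x + r n g y) \<and>
    (\<forall>n g s. \<forall>x\<in>bcarrier (cterm X n).
       r n g (lmul (cterm X n) s x) = lmul (cterm X n) (act g s) (r n g x) \<and>
       r n g (rmul (cterm X n) x s) = rmul (cterm X n) (r n g x) (act g s)) \<and>
    (\<forall>n g. \<forall>x\<in>bcarrier (cterm X (Suc n)). r n g (cdiff X n x) = cdiff X n (r (Suc n) g x)) \<and>
    (\<forall>g. \<forall>x\<in>bcarrier (cterm X 0). caug X (r 0 g x) = act g (caug X x))"

text \<open>\<open>S#G = S \<otimes> \<complex>G\<close> is the space of vectors indexed by \<open>G\<close> with entries in \<open>S\<close>; the element
  \<open>s \<otimes> g\<close> is \<open>axis g s\<close>. The pointwise product of vectors plays no role.\<close>

type_synonym ('s, 'g) smash = "('s, 'g) vec"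

definition smash_mult ::
    "('g::{group_add,finite} \<Rightarrow> 's::complex_algebra \<Rightarrow> 's)
      \<Rightarrow> ('s, 'g) smash \<Rightarrow> ('s, 'g) smash \<Rightarrow> ('s, 'g) smash" where
  "smash_mult act a b = (\<Sum>g\<in>UNIV. \<Sum>h\<in>UNIV. axis (g + h) (a $ g * act g (b $ h)))"

definition smash_conj ::
    "('g::{group_add,finite} \<Rightarrow> 's::complex_algebra \<Rightarrow> 's)
      \<Rightarrow> 'g \<Rightarrow> ('s, 'g) smash \<Rightarrow> ('s, 'g) smash" where
  "smash_conj act g a = smash_mult act (smash_mult act (axis g 1) a) (axis (- g) 1)"

definition smash_bimod ::
    "('g::{group_add,finite} \<Rightarrow> 's::complex_algebra \<Rightarrow> 's) \<Rightarrow> ('s, ('s, 'g) smash) bimod" where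
  "smash_bimod act =
    \<lparr>bcarrier = UNIV,
     lmul = (\<lambda>s a. smash_mult act (axis 0 s) a),
     rmul = (\<lambda>a s. smash_mult act a (axis 0 s))\<rparr>"


section \<open>Cohomology\<close>

definition coh_class :: "('x \<Rightarrow> 'b::ab_group_add) set \<Rightarrow> ('x \<Rightarrow> 'b) \<Rightarrow> ('x \<Rightarrow> 'b) set" where
  "coh_class B f = {f'. f' - f \<in> B}"

subsection \<open>Hochschild cohomology of an algebra with product \<open>m\<close>\<close>

definition hoch_diff ::
    "('a \<Rightarrow> 'a \<Rightarrow> 'a::complex_vector) \<Rightarrow> nat \<Rightarrow> ('a list \<Rightarrow> 'a) \<Rightarrow> 'a list \<Rightarrow> 'a" where
  "hoch_diff m n f as = (if length as = n + 1 then
     m (hd as) (f (tl as))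
     + (\<Sum>i=1..n. (-1) ^ i *\<^sub>C f (take (i - 1) as @ m (as ! (i - 1)) (as ! i) # drop (i + 1) as))
     + (-1) ^ (n + 1) *\<^sub>C m (f (butlast as)) (last as)
   else 0)"

definition hoch_cocycles ::
    "('a \<Rightarrow> 'a \<Rightarrow> 'a::complex_vector) \<Rightarrow> nat \<Rightarrow> ('a list \<Rightarrow> 'a) set" where
  "hoch_cocycles m n = {f \<in> cochains n. hoch_diff m n f = (\<lambda>_. 0)}"

definition hoch_coboundaries ::
    "('a \<Rightarrow> 'a \<Rightarrow> 'a::complex_vector) \<Rightarrow> nat \<Rightarrow> ('a list \<Rightarrow> 'a) set" where
  "hoch_coboundaries m n = (case n of 0 \<Rightarrow> {\<lambda>_. 0} | Suc k \<Rightarrow> hoch_diff m k ` cochains k)"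

definition HH ::
    "('a \<Rightarrow> 'a \<Rightarrow> 'a::complex_vector) \<Rightarrow> nat \<Rightarrow> ('a list \<Rightarrow> 'a) set set" where
  "HH m n = coh_class (hoch_coboundaries m n) ` hoch_cocycles m n"

text \<open>The exponents of the signs are taken in \<^typ>\<open>int\<close>, since \<open>q - 1\<close> is negative for \<open>q = 0\<close>.
  The degree \<open>p + q - 1\<close> is truncated only for \<open>p = q = 0\<close>, where the bracket is \<open>0\<close>.\<close>

definition circ ::
    "nat \<Rightarrow> nat \<Rightarrow> ('a list \<Rightarrow> 'a::complex_vector) \<Rightarrow> ('a list \<Rightarrow> 'a) \<Rightarrow> 'a list \<Rightarrow> 'a" where
  "circ p q f f' as = (if length as = p + q - 1 then
     (\<Sum>k=1..p. ((-1) powi ((int q - 1) * (int k - 1))) *\<^sub>C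
        f (take (k - 1) as @ f' (take q (drop (k - 1) as)) # drop (k - 1 + q) as))
   else 0)"

definition gerst_bracket ::
    "nat \<Rightarrow> nat \<Rightarrow> ('a list \<Rightarrow> 'a::complex_vector) \<Rightarrow> ('a list \<Rightarrow> 'a) \<Rightarrow> 'a list \<Rightarrow> 'a" where
  "gerst_bracket p q f f' as =
     circ p q f f' as - ((-1) powi ((int p - 1) * (int q - 1))) *\<^sub>C circ q p f' f as"

definition HH_bracket ::
    "('a \<Rightarrow> 'a \<Rightarrow> 'a::complex_vector) \<Rightarrow> nat \<Rightarrow> nat
      \<Rightarrow> ('a list \<Rightarrow> 'a) set \<Rightarrow> ('a list \<Rightarrow> 'a) set \<Rightarrow> ('a list \<Rightarrow> 'a) set" where
  "HH_bracket m p q X Y =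
     (\<Union>f\<in>X. \<Union>f'\<in>Y. coh_class (hoch_coboundaries m (p + q - 1)) (gerst_bracket p q f f'))"

subsection \<open>\<open>HH(S, A)\<close> computed from a resolution\<close>

text \<open>Homomorphisms from \<open>X\<^sub>n\<close> to \<open>A\<close> are extended by \<open>0\<close> outside the carrier of \<open>X\<^sub>n\<close>.\<close>

definition res_cochains ::
    "('g::{group_add,finite} \<Rightarrow> 's::complex_algebra \<Rightarrow> 's) \<Rightarrow> ('s, 'm::ab_group_add) aug_complex
      \<Rightarrow> nat \<Rightarrow> ('m \<Rightarrow> ('s, 'g) smash) set" where
  "res_cochains act X n = {\<alpha>. bimod_hom (cterm X n) (smash_bimod act) \<alpha> \<and>
     (\<forall>x. x \<notin> bcarrier (cterm X n) \<longrightarrow> \<alpha> x = 0)}"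

definition res_diff ::
    "('s, 'm) aug_complex \<Rightarrow> nat \<Rightarrow> ('m \<Rightarrow> 'a::zero) \<Rightarrow> 'm \<Rightarrow> 'a" where
  "res_diff X n \<alpha> x = (if x \<in> bcarrier (cterm X (Suc n)) then \<alpha> (cdiff X n x) else 0)"

definition res_cocycles ::
    "('g::{group_add,finite} \<Rightarrow> 's::complex_algebra \<Rightarrow> 's) \<Rightarrow> ('s, 'm::ab_group_add) aug_complex
      \<Rightarrow> nat \<Rightarrow> ('m \<Rightarrow> ('s, 'g) smash) set" where
  "res_cocycles act X n = {\<alpha> \<in> res_cochains act X n. res_diff X n \<alpha> = (\<lambda>_. 0)}"

definition res_coboundaries ::
    "('g::{group_add,finite} \<Rightarrow> 's::complex_algebra \<Rightarrow> 's) \<Rightarrow> ('s, 'm::ab_group_add) aug_complex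
      \<Rightarrow> nat \<Rightarrow> ('m \<Rightarrow> ('s, 'g) smash) set" where
  "res_coboundaries act X n =
     (case n of 0 \<Rightarrow> {\<lambda>_. 0} | Suc k \<Rightarrow> res_diff X k ` res_cochains act X k)"

definition res_class ::
    "('g::{group_add,finite} \<Rightarrow> 's::complex_algebra \<Rightarrow> 's) \<Rightarrow> ('s, 'm::ab_group_add) aug_complex
      \<Rightarrow> nat \<Rightarrow> ('m \<Rightarrow> ('s, 'g) smash) \<Rightarrow> ('m \<Rightarrow> ('s, 'g) smash) set" where
  "res_class act X n = coh_class (res_coboundaries act X n)"

definition res_act ::
    "('g::{group_add,finite} \<Rightarrow> 's::complex_algebra \<Rightarrow> 's) \<Rightarrow> ('s, 'm::ab_group_add) aug_complex
      \<Rightarrow> (nat \<Rightarrow> 'g \<Rightarrow> 'm \<Rightarrow> 'm) \<Rightarrow> nat \<Rightarrow> 'g \<Rightarrow> ('m \<Rightarrow> ('s, 'g) smash) \<Rightarrow> 'm \<Rightarrow> ('s, 'g) smash" where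
  "res_act act X r n g \<alpha> x =
     (if x \<in> bcarrier (cterm X n) then smash_conj act g (\<alpha> (r n (- g) x)) else 0)"

definition HH_inv ::
    "('g::{group_add,finite} \<Rightarrow> 's::complex_algebra \<Rightarrow> 's) \<Rightarrow> ('s, 'm::ab_group_add) aug_complex
      \<Rightarrow> (nat \<Rightarrow> 'g \<Rightarrow> 'm \<Rightarrow> 'm) \<Rightarrow> nat \<Rightarrow> ('m \<Rightarrow> ('s, 'g) smash) set set" where
  "HH_inv act X r n =
     {c \<in> res_class act X n ` res_cocycles act X n. \<forall>g. res_act act X r n g ` c = c}"


section \<open>The cochain maps and the induced bracket\<close>

definition Psi_star ::
    "(nat \<Rightarrow> 's::complex_algebra tens \<Rightarrow> 'm) \<Rightarrow> nat \<Rightarrow> ('m \<Rightarrow> 'a::zero) \<Rightarrow> 's list \<Rightarrow> 'a" where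
  "Psi_star Psi p \<alpha> xs = (if length xs = p then \<alpha> (Psi p (tensor (1 # xs @ [1]))) else 0)"

text \<open>The \<open>S\<^sup>e\<close>-homomorphism on \<open>S\<^bsup>\<otimes>(p+2)\<^esup>\<close> corresponding to \<open>\<kappa>\<close> on \<open>S\<^bsup>\<otimes>p\<^esup>\<close>.\<close>

definition bar_extend ::
    "('g::{group_add,finite} \<Rightarrow> 's::complex_algebra \<Rightarrow> 's) \<Rightarrow> nat
      \<Rightarrow> ('s list \<Rightarrow> ('s, 'g) smash) \<Rightarrow> 's tens \<Rightarrow> ('s, 'g) smash" where
  "bar_extend act p \<kappa> = tens_lift (\<lambda>xs. if length xs = p + 2
     then smash_mult act (axis 0 (hd xs)) (smash_mult act (\<kappa> (butlast (tl xs))) (axis 0 (last xs)))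
     else 0)"

definition Phi_star ::
    "('g::{group_add,finite} \<Rightarrow> 's::complex_algebra \<Rightarrow> 's) \<Rightarrow> ('s, 'm::ab_group_add) aug_complex
      \<Rightarrow> (nat \<Rightarrow> 'm \<Rightarrow> 's tens) \<Rightarrow> nat
      \<Rightarrow> ('s list \<Rightarrow> ('s, 'g) smash) \<Rightarrow> 'm \<Rightarrow> ('s, 'g) smash" where
  "Phi_star act X Phi p \<kappa> x =
     (if x \<in> bcarrier (cterm X p) then bar_extend act p \<kappa> (Phi p x) else 0)"

definition restrict_S ::
    "(('s::complex_algebra, 'g::{group_add,finite}) smash list \<Rightarrow> 'b) \<Rightarrow> 's list \<Rightarrow> 'b" where
  "restrict_S f xs = f (map (axis 0) xs)"

definition cochain_act ::
    "('g::{group_add,finite} \<Rightarrow> 's::complex_algebra \<Rightarrow> 's) \<Rightarrow> 'g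
      \<Rightarrow> ('s list \<Rightarrow> ('s, 'g) smash) \<Rightarrow> 's list \<Rightarrow> ('s, 'g) smash" where
  "cochain_act act g \<kappa> xs = smash_conj act g (\<kappa> (map (act (- g)) xs))"

text \<open>\<open>\<Theta>\<^sup>*\<close>, extended multilinearly from the elements \<open>f\<^sub>i \<otimes> g\<^sub>i\<close>: write each argument as
  \<open>a\<^sub>i = \<Sum>\<^bsub>g\<^esub> (a\<^sub>i $ g) \<otimes> g\<close> and sum over all \<open>(g\<^sub>1, \<dots>, g\<^sub>p)\<close>.\<close>

definition Theta_star ::
    "('g::{group_add,finite} \<Rightarrow> 's::complex_algebra \<Rightarrow> 's) \<Rightarrow> nat
      \<Rightarrow> ('s list \<Rightarrow> ('s, 'g) smash) \<Rightarrow> ('s, 'g) smash list \<Rightarrow> ('s, 'g) smash" where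
  "Theta_star act p \<kappa> as = (if length as = p then
     (\<Sum>gs | length gs = p.
        smash_mult act
          (\<kappa> (map (\<lambda>i. act (sum_list (take i gs)) ((as ! i) $ (gs ! i))) [0..<p]))
          (axis (sum_list gs) 1))
   else 0)"

text \<open>The isomorphism \<open>HH\<^sup>n(A) \<cong> HH\<^sup>n(S, A)\<^sup>G\<close>, induced by \<open>f \<mapsto> \<Phi>\<^sup>* (f|\<^sub>S)\<close> on cochains.\<close>

definition HH_iso ::
    "('g::{group_add,finite} \<Rightarrow> 's::complex_algebra \<Rightarrow> 's) \<Rightarrow> ('s, 'm::ab_group_add) aug_complex
      \<Rightarrow> (nat \<Rightarrow> 'm \<Rightarrow> 's tens) \<Rightarrow> nat
      \<Rightarrow> (('s, 'g) smash list \<Rightarrow> ('s, 'g) smash) set \<Rightarrow> ('m \<Rightarrow> ('s, 'g) smash) set" where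
  "HH_iso act X Phi n c = (\<Union>f\<in>c. res_class act X n (Phi_star act X Phi n (restrict_S f)))"

definition induced_bracket ::
    "('g::{group_add,finite} \<Rightarrow> 's::complex_algebra \<Rightarrow> 's) \<Rightarrow> ('s, 'm::ab_group_add) aug_complex
      \<Rightarrow> (nat \<Rightarrow> 'm \<Rightarrow> 's tens) \<Rightarrow> nat \<Rightarrow> nat
      \<Rightarrow> ('m \<Rightarrow> ('s, 'g) smash) set \<Rightarrow> ('m \<Rightarrow> ('s, 'g) smash) set \<Rightarrow> ('m \<Rightarrow> ('s, 'g) smash) set" where
  "induced_bracket act X Phi p q c c' =
     HH_iso act X Phi (p + q - 1)
       (HH_bracket (smash_mult act) p q
          (the_inv_into (HH (smash_mult act) p) (HH_iso act X Phi p) c)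
          (the_inv_into (HH (smash_mult act) q) (HH_iso act X Phi q) c'))"

end

(* The bracket of two classes is computed on Hochschild cochains of A = S#G, so an explicit inverse of
   the isomorphism HH(A) -> HH(S, A)^G is needed. Restriction to S has Theta* as a one-sided inverse
   on G-invariant cochains. That it is an isomorphism follows because averaging
   g_0 f(g_0^-1 a_1 g_1, ..., g_(n-1)^-1 a_n g_n) g_n^-1 over all g_i replaces a cocycle f by a
   cohomologous one of the form Theta* kappa. A G-invariant class of alpha on P is the image of
   Theta* applied to the average of the cochains ^a(Psi* alpha): conjugating Phi by a and composing
   with Psi gives a self-map of P homotopic to the identity. Bilinearity of the bracket turns the two
   averages into the double sum. That the Gerstenhaber bracket descends to cohomology follows from
   the graded pre-Lie identity, since the differential is a circle product with the multiplication. *)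

theory Submission
  imports Defs
begin

text \<open>\<open>Psi\<close> and \<open>Phi\<close> are not assumed equivariant, and a cochain
  representing an invariant class is itself invariant only up to a coboundary.
  \<open>Theta_star\<close> commutes with the differentials on strictly invariant cochains, but not
  in general. Hence the average over G must be taken before \<open>Theta_star\<close> is applied,
  once for each argument of the bracket. Two comparisons by homotopy are needed. On P the lifts come
  from projectivity. On the bar resolution, where the composite of \<open>Psi\<close> and
  \<open>Phi\<close> is compared with the identity, a proof of projectivity would need a basis of S;
  prescribing lifts on the generators 1 \<otimes> m \<otimes> 1 by the contracting homotopy avoids
  the choice. In the averaging formula the factor g_n^-1 stands outside f. Regarding a cochain of n
  arguments as a right A-linear function of n + 1 arguments turns this factor into part of an
  ordinary argument. The averages are then balanced over the group algebra at every gap between two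
  arguments, and the homotopy satisfies a recursion on the list.\<close>

interpretation cvec: vector_space "scaleC :: complex \<Rightarrow> 'a::complex_vector \<Rightarrow> 'a"
  by unfold_locales (simp_all add: scaleC_add_right scaleC_add_left scaleC_scaleC scaleC_one)

section \<open>Linear maps, multilinear maps and cochains\<close>

definition complex_linear :: "('a::complex_vector \<Rightarrow> 'b::complex_vector) \<Rightarrow> bool" where
  "complex_linear L \<longleftrightarrow> (\<forall>x y. L (x + y) = L x + L y) \<and> (\<forall>c x. L (c *\<^sub>C x) = c *\<^sub>C L x)"

lemma complex_linear_0:
  assumes "complex_linear L"
  shows "L 0 = 0"
proof -
  have "L (0 *\<^sub>C 0) = 0 *\<^sub>C L 0" using assms by (simp only: complex_linear_def)
  then show ?thesis by simp
qed

lemma complex_linear_diff: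
  assumes "complex_linear L"
  shows "L (x - y) = L x - L y"
proof -
  have "L ((x - y) + y) = L (x - y) + L y" using assms by (simp only: complex_linear_def)
  then show ?thesis by simp
qed

lemma complex_linear_sum: "complex_linear L \<Longrightarrow> L (\<Sum>i\<in>I. f i) = (\<Sum>i\<in>I. L (f i))"
  by (induction I rule: infinite_finite_induct)
    (simp_all add: complex_linear_0, simp add: complex_linear_def)

lemma multilinear_0: "multilinear 0 f"
  by (simp add: multilinear_def)

text \<open>Peeling off the first argument replaces the splittings \<open>xs @ x # ys\<close> of the
  definition by a recursion, so that multilinearity can be proved by induction on the number of
  arguments.\<close>

lemma multilinear_Suc:
  "multilinear (Suc n) f \<longleftrightarrow>
     (\<forall>l. length l = n \<longrightarrow> complex_linear (\<lambda>x. f (x # l))) \<and> (\<forall>x. multilinear n (\<lambda>l. f (x # l)))"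
  (is "?L \<longleftrightarrow> ?R")
proof
  assume L: ?L
  show ?R
  proof (intro conjI allI impI)
    fix l :: "'a list" assume "length l = n"
    then show "complex_linear (\<lambda>x. f (x # l))"
      using L unfolding multilinear_def complex_linear_def
      by (metis add.commute add_0 append_Nil list.size(3) plus_1_eq_Suc)
  next
    fix z
    show "multilinear n (\<lambda>l. f (z # l))"
      unfolding multilinear_def
    proof (intro conjI allI impI)
      fix xs ys :: "'a list" and x y c
      assume "length xs + length ys + 1 = n"
      then have len: "length (z # xs) + length ys + 1 = Suc n" by simp
      show "f (z # xs @ (x + y) # ys) = f (z # xs @ x # ys) + f (z # xs @ y # ys)"
        using L len unfolding multilinear_def by (metis append_Cons)
      show "f (z # xs @ (c *\<^sub>C x) # ys) = c *\<^sub>C f (z # xs @ x # ys)"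
        using L len unfolding multilinear_def by (metis append_Cons)
    qed
  qed
next
  assume R: ?R
  show ?L
    unfolding multilinear_def
  proof (intro conjI allI impI)
    fix xs ys :: "'a list" and x y c
    assume len: "length xs + length ys + 1 = Suc n"
    show "f (xs @ (x + y) # ys) = f (xs @ x # ys) + f (xs @ y # ys)"
      using R len by (cases xs) (simp_all add: multilinear_def complex_linear_def)
    show "f (xs @ (c *\<^sub>C x) # ys) = c *\<^sub>C f (xs @ x # ys)"
      using R len by (cases xs) (simp_all add: multilinear_def complex_linear_def)
  qed
qed

lemma multilinear_Cons: "multilinear (Suc n) f \<Longrightarrow> multilinear n (\<lambda>l. f (x # l))"
  by (simp add: multilinear_Suc)

lemma multilinear_head:
  assumes "multilinear (Suc n) f" "length l = n"
  shows "complex_linear (\<lambda>x. f (x # l))"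
  using assms by (simp add: multilinear_Suc)

text \<open>The last argument lies outside \<open>f\<close>, so it is treated apart from the others;
  splitting \<open>ys\<close> from its right end decides which of the two kinds of linearity of
  \<open>B\<close> applies. With a product for \<open>B\<close> this is multiplication on the
  right.\<close>

lemma multilinear_butlast:
  assumes f: "multilinear n f"
    and B1: "\<And>y. complex_linear (\<lambda>x. B x y)" and B2: "\<And>x. complex_linear (B x)"
  shows "multilinear (Suc n) (\<lambda>l. B (f (butlast l)) (last l))"
  unfolding multilinear_def
proof (intro conjI allI impI)
  fix xs ys :: "'a list" and x y c
  assume len: "length xs + length ys + 1 = Suc n"
  show "B (f (butlast (xs @ (x + y) # ys))) (last (xs @ (x + y) # ys)) =
     B (f (butlast (xs @ x # ys))) (last (xs @ x # ys)) + B (f (butlast (xs @ y # ys))) (last (xs @ y # ys))"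
  proof (cases ys rule: rev_cases)
    case Nil
    then show ?thesis using B2 by (simp add: complex_linear_def)
  next
    case (snoc zs z)
    then show ?thesis using f len B1
      by (simp add: complex_linear_def butlast_append multilinear_def)
  qed
  show "B (f (butlast (xs @ (c *\<^sub>C x) # ys))) (last (xs @ (c *\<^sub>C x) # ys)) =
     c *\<^sub>C B (f (butlast (xs @ x # ys))) (last (xs @ x # ys))"
  proof (cases ys rule: rev_cases)
    case Nil
    then show ?thesis using B2 by (simp add: complex_linear_def)
  next
    case (snoc zs z)
    then show ?thesis using f len B1
      by (simp add: complex_linear_def butlast_append multilinear_def)
  qed
qed

lemma multilinear_snoc:
  assumes "multilinear (Suc n) f"
  shows "multilinear n (\<lambda>l. f (l @ [z]))"
  using assms unfolding multilinear_def by simp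

lemma multilinear_linear:
  assumes "multilinear n f" "complex_linear L"
  shows "multilinear n (\<lambda>l. L (f l))"
  using assms unfolding multilinear_def complex_linear_def by simp

lemma multilinear_map:
  assumes "multilinear n f" "complex_linear L"
  shows "multilinear n (\<lambda>l. f (map L l))"
  using assms unfolding multilinear_def complex_linear_def by simp

lemma multilinear_add: "multilinear n f \<Longrightarrow> multilinear n g \<Longrightarrow> multilinear n (\<lambda>l. f l + g l)"
  unfolding multilinear_def by (simp add: scaleC_add_right)

lemma multilinear_diff: "multilinear n f \<Longrightarrow> multilinear n g \<Longrightarrow> multilinear n (\<lambda>l. f l - g l)"
  unfolding multilinear_def by (simp add: scaleC_diff_right)

lemma multilinear_zero: "multilinear n (\<lambda>l. 0)"
  unfolding multilinear_def by simp

lemma multilinear_scale: "multilinear n f \<Longrightarrow> multilinear n (\<lambda>l. c *\<^sub>C f l)"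
  unfolding multilinear_def by (simp add: scaleC_add_right scaleC_scaleC mult.commute)

lemma multilinear_sum:
  "(\<And>i. i \<in> I \<Longrightarrow> multilinear n (f i)) \<Longrightarrow> multilinear n (\<lambda>l. \<Sum>i\<in>I. f i l)"
  by (induction I rule: infinite_finite_induct) (simp_all add: multilinear_zero multilinear_add)

lemma multilinear_cong:
  assumes "\<And>l. length l = n \<Longrightarrow> f l = g l"
  shows "multilinear n f \<longleftrightarrow> multilinear n g"
  unfolding multilinear_def using assms by simp

lemma multilinear_entry_0:
  assumes "multilinear n f" "length l = n" "0 \<in> set l"
  shows "f l = 0"
proof -
  obtain xs ys where l: "l = xs @ 0 # ys"
    using assms(3) by (meson split_list)
  have "f (xs @ (0 *\<^sub>C 0) # ys) = 0 *\<^sub>C f (xs @ 0 # ys)"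
    using assms(1,2) l unfolding multilinear_def by (simp del: scaleC_zero_left scaleC_zero_right)
  then show ?thesis by (simp add: l)
qed

lemma cochains_multilinear: "f \<in> cochains n \<Longrightarrow> multilinear n f"
  by (simp add: cochains_def)

lemma cochains_length: "f \<in> cochains n \<Longrightarrow> length l \<noteq> n \<Longrightarrow> f l = 0"
  by (simp add: cochains_def)

text \<open>In a wrong degree all values are 0. Later identities are stated for functions that are
  multilinear in every degree, a property that is preserved when the first argument is fixed; this
  lemma makes cochains an instance.\<close>

lemma cochains_multilinear_any: "f \<in> cochains n \<Longrightarrow> multilinear k f"
  by (cases "k = n") (auto simp: cochains_def multilinear_def)

lemma cochainsI:
  "multilinear n f \<Longrightarrow> (\<And>l. length l \<noteq> n \<Longrightarrow> f l = 0) \<Longrightarrow> f \<in> cochains n"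
  by (simp add: cochains_def)

lemma cochains_cut: "multilinear n f \<Longrightarrow> (\<lambda>l. if length l = n then f l else 0) \<in> cochains n"
  by (rule cochainsI) (simp_all add: multilinear_def)

lemma cochains_zero: "(\<lambda>_. 0) \<in> cochains n"
  by (simp add: cochains_def multilinear_zero)

lemma cochains_add: "f \<in> cochains n \<Longrightarrow> g \<in> cochains n \<Longrightarrow> (\<lambda>l. f l + g l) \<in> cochains n"
  by (simp add: cochains_def multilinear_add)

lemma cochains_diff: "f \<in> cochains n \<Longrightarrow> g \<in> cochains n \<Longrightarrow> (\<lambda>l. f l - g l) \<in> cochains n"
  by (simp add: cochains_def multilinear_diff)

lemma cochains_scale: "f \<in> cochains n \<Longrightarrow> (\<lambda>l. c *\<^sub>C f l) \<in> cochains n"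
  by (simp add: cochains_def multilinear_scale)

lemma cochains_Cons: "f \<in> cochains (Suc n) \<Longrightarrow> (\<lambda>l. f (x # l)) \<in> cochains n"
  by (simp add: cochains_def multilinear_Cons)


section \<open>The Gerstenhaber bracket\<close>

text \<open>This is (-1)^(q-1), the sign picked up when a block of \<open>q\<close> entries starts
  one place further to the right; the parity test keeps q = 0 free of truncated subtraction.\<close>

definition deg_sign :: "nat \<Rightarrow> complex" where
  "deg_sign q = (if even q then - 1 else 1)"

text \<open>The sign of (p - 1)(q - 1), a product that is odd exactly when both degrees are
  even.\<close>

definition koszul_sign :: "nat \<Rightarrow> nat \<Rightarrow> complex" where
  "koszul_sign p q = (if even p \<and> even q then - 1 else 1)"

lemma deg_sign_powi: "(- 1) powi (int q - 1) = deg_sign q"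
  by (simp add: deg_sign_def power_int_minus_left)

lemma koszul_sign_powi: "(- 1) powi ((int p - 1) * (int q - 1)) = koszul_sign p q"
  by (simp add: koszul_sign_def power_int_minus_left)

text \<open>The signed sum over all ways of replacing \<open>q\<close> consecutive entries of a list by their image
  under \<open>g\<close>; for a cochain \<open>F\<close> this is the circle product of \<open>F\<close> and \<open>g\<close>. Since \<open>F\<close> is an argument
  that changes along the recursion, identities are proved by induction on the list.\<close>

fun insertions :: "nat \<Rightarrow> ('a list \<Rightarrow> 'a) \<Rightarrow> ('a list \<Rightarrow> 'b::complex_vector) \<Rightarrow> 'a list \<Rightarrow> 'b" where
  "insertions q g F [] = (if q = 0 then F [g []] else 0)"
| "insertions q g F (x # l) =
     (if q \<le> length (x # l) then F (g (take q (x # l)) # drop q (x # l)) else 0)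
     + deg_sign q *\<^sub>C insertions q g (\<lambda>l'. F (x # l')) l"

lemma insertions_linear:
  assumes L: "complex_linear L"
  shows "L (insertions q g F l) = insertions q g (\<lambda>l. L (F l)) l"
proof (induction l arbitrary: F)
  case Nil
  then show ?case using complex_linear_0 [OF L] by simp
next
  case (Cons x l)
  have "L (insertions q g F (x # l)) =
      L (if q \<le> length (x # l) then F (g (take q (x # l)) # drop q (x # l)) else 0)
      + deg_sign q *\<^sub>C L (insertions q g (\<lambda>l'. F (x # l')) l)"
    using L by (simp only: insertions.simps complex_linear_def)
  then show ?case using complex_linear_0 [OF L] by (simp only: Cons.IH) simp
qed

lemma insertions_scale: "insertions q g (\<lambda>l. c *\<^sub>C F l) l = c *\<^sub>C insertions q g F l"
  by (rule insertions_linear [symmetric])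
    (simp add: complex_linear_def scaleC_add_right scaleC_scaleC mult.commute)

lemma insertions_add:
  "insertions q g (\<lambda>l. F l + F' l) l = insertions q g F l + insertions q g F' l"
  by (induction l arbitrary: F F') (simp_all add: scaleC_add_right algebra_simps)

lemma insertions_diff:
  "insertions q g (\<lambda>l. F l - F' l) l = insertions q g F l - insertions q g F' l"
  by (induction l arbitrary: F F') (simp_all add: scaleC_diff_right add_diff_add)

lemma insertions_zero [simp]: "insertions q g (\<lambda>l. 0) l = 0"
  by (induction l) simp_all

lemma insertions_sum:
  "insertions q g (\<lambda>l. \<Sum>i\<in>I. F i l) l = (\<Sum>i\<in>I. insertions q g (F i) l)"
  by (induction I rule: infinite_finite_induct) (simp_all add: insertions_add)

text \<open>\<open>F\<close> only sees nonempty lists, since one entry is always the value of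
  \<open>g\<close>. The condition \<open>l' \<noteq> []\<close> is what later makes an insertion
  into a cochain of degree 0 vanish.\<close>

lemma insertions_cong:
  assumes "\<And>l'. length l' + q = length l + 1 \<Longrightarrow> l' \<noteq> [] \<Longrightarrow> F l' = F' l'"
  shows "insertions q g F l = insertions q g F' l"
  using assms
proof (induction l arbitrary: F F')
  case Nil
  then show ?case by simp
next
  case (Cons x l)
  have "insertions q g (\<lambda>l'. F (x # l')) l = insertions q g (\<lambda>l'. F' (x # l')) l"
    by (rule Cons.IH) (simp add: Cons.prems)
  then show ?case by (simp add: Cons.prems)
qed

lemma insertions_vanish:
  assumes "\<And>l'. length l' + q = length l + 1 \<Longrightarrow> l' \<noteq> [] \<Longrightarrow> F l' = 0"
  shows "insertions q g F l = 0"
  using insertions_cong [of q l F "\<lambda>_. 0"] assms by simp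

text \<open>The truncated difference counts the possible positions of the block: there are length l
  + 1 of them for q = 0, and none when the list is shorter than the block.\<close>

lemma insertions_eq_sum:
  "insertions q g F l = (\<Sum>k<length l + 1 - q.
     deg_sign q ^ k *\<^sub>C F (take k l @ g (take q (drop k l)) # drop (k + q) l))"
proof (induction l arbitrary: F)
  case Nil
  then show ?case by (cases q) (simp_all add: scaleC_one)
next
  case (Cons x l)
  show ?case
  proof (cases "q \<le> length (x # l)")
    case True
    then have *: "length (x # l) + 1 - q = Suc (length l + 1 - q)" by simp
    show ?thesis
      using True unfolding * sum.lessThan_Suc_shift
      by (simp add: Cons.IH scaleC_one cvec.scale_sum_right scaleC_scaleC)
  next
    case False
    then show ?thesis by (simp add: Cons.IH)
  qed
qed

text \<open>\<open>circ\<close> cuts off by a length test, \<open>insertions\<close> by the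
  vanishing of \<open>f\<close> outside its degree. For p = 0 the length test may be truncated, but
  then the sum in \<open>circ\<close> is empty, and \<open>f\<close> vanishes on the nonempty lists
  that it receives.\<close>

lemma circ_eq_insertions:
  assumes "f \<in> cochains p"
  shows "circ p q f g = insertions q g f"
proof
  fix l
  show "circ p q f g l = insertions q g f l"
  proof (cases "length l = p + q - 1 \<and> p \<noteq> 0")
    case True
    then have len: "length l + 1 - q = p" by auto
    have "(\<Sum>k = 1..p. (- 1) powi ((int q - 1) * (int k - 1)) *\<^sub>C
        f (take (k - 1) l @ g (take q (drop (k - 1) l)) # drop (k - 1 + q) l)) =
      (\<Sum>k<p. deg_sign q ^ k *\<^sub>C f (take k l @ g (take q (drop k l)) # drop (k + q) l))"
      by (rule sum.reindex_bij_witness [of _ Suc "\<lambda>k. k - 1"])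
        (auto simp: power_int_mult deg_sign_powi simp flip: power_int_of_nat)
    then show ?thesis using True by (simp add: circ_def insertions_eq_sum len)
  next
    case False
    have "insertions q g f l = 0"
      by (rule insertions_vanish) (use False cochains_length [OF assms] in force)
    then show ?thesis using False by (auto simp: circ_def)
  qed
qed

lemma multilinear_front:
  assumes "multilinear q g" "multilinear (Suc k) F"
  shows "multilinear (q + k) (\<lambda>l. F (g (take q l) # drop q l))"
  using assms(1)
proof (induction q arbitrary: g)
  case 0
  then show ?case using multilinear_Cons [OF assms(2)] by simp
next
  case (Suc q)
  have "complex_linear (\<lambda>x. F (g (x # take q l) # drop q l))" if "length l = q + k" for l
    using multilinear_head [OF Suc.prems, of "take q l"] multilinear_head [OF assms(2), of "drop q l"] that
    by (simp add: complex_linear_def)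
  moreover have "multilinear (q + k) (\<lambda>l. F (g (x # take q l) # drop q l))" for x
    by (rule Suc.IH) (rule multilinear_Cons [OF Suc.prems])
  ultimately show ?case by (simp add: multilinear_Suc)
qed

text \<open>The degrees are related additively, so that nothing is truncated. The block either
  starts at the first entry, which is \<open>multilinear_front\<close>, or lies in the tail, which
  is the induction hypothesis for \<open>F\<close> with its first argument fixed.\<close>

lemma multilinear_insertions:
  assumes g: "multilinear q g" and F: "multilinear n F" and N: "N + 1 = n + q"
  shows "multilinear N (insertions q g F)"
  using F N
proof (induction N arbitrary: n F)
  case 0
  then show ?case by (simp add: multilinear_0)
next
  case (Suc N)
  show ?case
  proof (cases n)
    case 0
    have "insertions q g F l = 0" if "length l = Suc N" for l
      by (rule insertions_vanish) (use that Suc.prems 0 in auto)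
    then show ?thesis
      using multilinear_cong [of "Suc N" "insertions q g F" "\<lambda>_. 0"] by (simp add: multilinear_zero)
  next
    case (Suc n')
    then have Nq: "Suc N = q + n'" using Suc.prems by simp
    let ?A = "\<lambda>l. F (g (take q l) # drop q l)"
    let ?B = "\<lambda>l. case l of [] \<Rightarrow> 0 | x # l \<Rightarrow> deg_sign q *\<^sub>C insertions q g (\<lambda>l'. F (x # l')) l"
    have A: "multilinear (Suc N) ?A"
      unfolding Nq using g Suc.prems(1) Suc by (intro multilinear_front) simp_all
    have head: "complex_linear (\<lambda>x. insertions q g (\<lambda>l'. F (x # l')) l)" if l: "length l = N" for l
    proof -
      have lin: "complex_linear (\<lambda>x. F (x # l'))" if "length l' + q = length l + 1" for l'
        using multilinear_head [of n' F] Suc.prems(1) Suc that l Nq by simp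
      have "insertions q g (\<lambda>l'. F ((x + y) # l')) l
          = insertions q g (\<lambda>l'. F (x # l') + F (y # l')) l" for x y
        by (rule insertions_cong) (use lin in \<open>auto simp: complex_linear_def\<close>)
      moreover have "insertions q g (\<lambda>l'. F ((c *\<^sub>C x) # l')) l
          = insertions q g (\<lambda>l'. c *\<^sub>C F (x # l')) l" for x c
        by (rule insertions_cong) (use lin in \<open>auto simp: complex_linear_def\<close>)
      ultimately show ?thesis
        by (simp add: complex_linear_def insertions_add insertions_scale)
    qed
    have "multilinear N (insertions q g (\<lambda>l'. F (x # l')))" for x
      by (rule Suc.IH [of n']) (use Suc.prems Suc Nq multilinear_Cons in auto)
    then have B: "multilinear (Suc N) ?B"
      using head
      by (auto simp: multilinear_Suc complex_linear_def scaleC_add_right scaleC_scaleC mult.commute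
          intro!: multilinear_scale)
    have "insertions q g F l = ?A l + ?B l" if "length l = Suc N" for l
      using that Nq by (cases l) auto
    then have "multilinear (Suc N) (insertions q g F) \<longleftrightarrow> multilinear (Suc N) (\<lambda>l. ?A l + ?B l)"
      by (rule multilinear_cong)
    then show ?thesis
      using multilinear_add [OF A B] by simp
  qed
qed

lemma insertions_cochains_0:
  assumes "f \<in> cochains 0"
  shows "insertions q g f = (\<lambda>_. 0)"
  by (rule ext, rule insertions_vanish, rule cochains_length [OF assms]) simp

lemma insertions_cochains:
  assumes g: "g \<in> cochains q" and f: "f \<in> cochains n"
  shows "insertions q g f \<in> cochains (n + q - 1)"
proof (cases "n = 0")
  case True
  then show ?thesis using f by (simp add: insertions_cochains_0 cochains_zero)
next
  case False
  show ?thesis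
  proof (rule cochainsI)
    show "multilinear (n + q - 1) (insertions q g f)"
      using f g False by (intro multilinear_insertions [of q g n]) (auto simp: cochains_multilinear)
    show "insertions q g f l = 0" if "length l \<noteq> n + q - 1" for l
      by (rule insertions_vanish) (use that cochains_length [OF f] in auto)
  qed
qed

section \<open>Nested insertions and the graded pre-Lie identity\<close>

text \<open>The summand in which the block starts at the first entry. The positions of two blocks
  are sorted by which of them, if any, is of this kind.\<close>

definition front :: "nat \<Rightarrow> ('a list \<Rightarrow> 'a) \<Rightarrow> ('a list \<Rightarrow> 'b::complex_vector) \<Rightarrow> 'a list \<Rightarrow> 'b" where
  "front q g F l = (if q \<le> length l then F (g (take q l) # drop q l) else 0)"

lemma insertions_Cons:
  "insertions q g F (x # l) = front q g F (x # l) + deg_sign q *\<^sub>C insertions q g (\<lambda>l'. F (x # l')) l"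
  by (simp add: front_def)

lemma insertions_split:
  "insertions q g F l = front q g F l
     + (case l of [] \<Rightarrow> 0 | x # l \<Rightarrow> deg_sign q *\<^sub>C insertions q g (\<lambda>l'. F (x # l')) l)"
  by (cases l) (simp_all add: front_def)

text \<open>The value of \<open>h\<close> ends up either among the first \<open>q\<close> entries,
  hence inside \<open>g\<close>, or behind them. The sign \<open>deg_sign r ^ q\<close> of the
  second kind comes from the \<open>q\<close> entries that are passed over. The induction fixes one
  argument of \<open>g\<close> at a time.\<close>

lemma insertions_front:
  assumes "g \<in> cochains q" and F: "\<And>n. multilinear n F"
  shows "insertions r h (front q g F) l = front (q + r - 1) (insertions r h g) F l
    + (if q \<le> length l
       then deg_sign r ^ q *\<^sub>C insertions r h (\<lambda>v. F (g (take q l) # v)) (drop q l) else 0)"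
  using assms(1)
proof (induction q arbitrary: g l)
  case 0
  have "F (0 # w) = 0" for w
    using multilinear_entry_0 [OF F] by simp
  moreover have "front 0 g F = (\<lambda>v. F (g [] # v))"
    by (simp add: front_def fun_eq_iff)
  ultimately show ?case
    using 0 by (simp add: front_def insertions_cochains_0 scaleC_one)
next
  case (Suc q)
  have F0: "F (0 # w) = 0" for w
    using multilinear_entry_0 [OF F] by simp
  have Fadd: "F ((x + y) # w) = F (x # w) + F (y # w)" and Fscale: "F ((c *\<^sub>C x) # w) = c *\<^sub>C F (x # w)"
    for x y w c
    using multilinear_head [OF F refl] by (auto simp: complex_linear_def)
  show ?case
  proof (cases l)
    case Nil
    then show ?thesis by (auto simp: front_def)
  next
    case (Cons x l')
    let ?gx = "\<lambda>v. g (x # v)"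
    have gx: "?gx \<in> cochains q" by (rule cochains_Cons [OF Suc.prems])
    have *: "(\<lambda>v. front (Suc q) g F (x # v)) = front q ?gx F"
      by (simp add: front_def fun_eq_iff)
    have **: "front r h (front (Suc q) g F) l + deg_sign r *\<^sub>C front (q + r - 1) (insertions r h ?gx) F l'
        = front (q + r) (insertions r h g) F l"
    proof (cases "q + r = 0")
      \<comment> \<open>Only here is q + r - 1 truncated. The insertion into the cochain
        \<open>?gx\<close> of degree 0 vanishes, and \<open>F\<close> vanishes when an entry is
        0.\<close>
      case True
      then show ?thesis
        using gx by (simp add: front_def Cons insertions_cochains_0 F0)
    next
      case False
      then obtain s where s: "q + r = Suc s" by (cases "q + r") auto
      show ?thesis
      proof (cases "s \<le> length l'")
        case True

        have len: "Suc q \<le> Suc (length l - r)" "q + r \<le> length l" "r \<le> length l"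
          using True s by (auto simp: Cons)
        have t: "take (q + r) l = x # take s l'" and d: "drop (q + r) l = drop s l'"
          by (simp_all add: Cons s)
        have "front r h (front (Suc q) g F) l
            = F (g (h (take r l) # take q (drop r l)) # drop (q + r) l)"
          using len by (simp add: front_def)
        moreover have "insertions r h g (x # take s l') = g (h (take r l) # take q (drop r l))
            + deg_sign r *\<^sub>C insertions r h ?gx (take s l')"
        proof -
          have "r \<le> length (x # take s l')" using True s by simp
          moreover have "take r (x # take s l') = take r l" "drop r (x # take s l') = take q (drop r l)"
            unfolding t [symmetric] by (simp_all add: min_def drop_take)
          ultimately show ?thesis by (simp only: insertions.simps if_True)
        qed
        ultimately show ?thesis
          using True len s by (simp only: front_def t d Fadd Fscale) (simp add: Cons Fadd Fscale)
      next
        case False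
        then show ?thesis using s by (auto simp: front_def Cons)
      qed
    qed
    let ?T = "\<lambda>q g l. if q \<le> length l
       then deg_sign r ^ q *\<^sub>C insertions r h (\<lambda>v. F (g (take q l) # v)) (drop q l) else 0"
    have T: "deg_sign r *\<^sub>C ?T q ?gx l' = ?T (Suc q) g l"
      by (simp add: Cons scaleC_scaleC)
    have "insertions r h (front (Suc q) g F) l
        = front r h (front (Suc q) g F) l + deg_sign r *\<^sub>C insertions r h (front q ?gx F) l'"
      by (subst Cons, subst insertions_Cons, simp only: * Cons)
    also have "\<dots> = front r h (front (Suc q) g F) l
        + deg_sign r *\<^sub>C (front (q + r - 1) (insertions r h ?gx) F l' + ?T q ?gx l')"
      by (simp only: Suc.IH [OF gx])
    also have "\<dots> = front (q + r) (insertions r h g) F l + ?T (Suc q) g l"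
      unfolding scaleC_add_right T add.assoc [symmetric] ** ..
    finally show ?thesis unfolding add_Suc diff_Suc_1 .
  qed
qed

text \<open>The four terms sort the two blocks: \<open>h\<close> inside \<open>g\<close> at the
  front; \<open>g\<close> at the front and \<open>h\<close> behind it; \<open>h\<close> at the front
  and \<open>g\<close> behind it; both behind the first entry. Exchanging \<open>g\<close> and
  \<open>h\<close> exchanges the second and the third up to sign.\<close>

lemma insertions_insertions:
  assumes g: "g \<in> cochains q" and F: "\<And>n. multilinear n F"
  shows "insertions r h (insertions q g F) l =
      front (q + r - 1) (insertions r h g) F l
      + (if q \<le> length l
         then deg_sign r ^ q *\<^sub>C insertions r h (\<lambda>v. F (g (take q l) # v)) (drop q l) else 0)
      + (if r \<le> length l
         then deg_sign q *\<^sub>C insertions q g (\<lambda>v. F (h (take r l) # v)) (drop r l) else 0)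
      + (case l of [] \<Rightarrow> 0 | x # l \<Rightarrow>
           (deg_sign q * deg_sign r) *\<^sub>C insertions r h (insertions q g (\<lambda>l'. F (x # l'))) l)"
proof -
  let ?T = "\<lambda>l. case l of [] \<Rightarrow> 0 | x # l \<Rightarrow> deg_sign q *\<^sub>C insertions q g (\<lambda>l'. F (x # l')) l"
  have "insertions r h ?T l =
      (if r \<le> length l
         then deg_sign q *\<^sub>C insertions q g (\<lambda>v. F (h (take r l) # v)) (drop r l) else 0)
      + (case l of [] \<Rightarrow> 0 | x # l \<Rightarrow>
           (deg_sign q * deg_sign r) *\<^sub>C insertions r h (insertions q g (\<lambda>l'. F (x # l'))) l)"
    by (cases l) (simp_all add: insertions_scale scaleC_scaleC mult.commute del: insertions.simps(2),
        simp add: insertions_scale scaleC_scaleC mult.commute)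
  moreover have "insertions q g F = (\<lambda>l. front q g F l + ?T l)"
    using insertions_split by fast
  ultimately show ?thesis
    using insertions_front [OF g F, where r = r and h = h and l = l]
    by (simp only: insertions_add add.assoc)
qed

lemma insertions_zero_arg:
  assumes "\<And>n. multilinear n F"
  shows "insertions q (\<lambda>_. 0) F l = 0"
  using assms
proof (induction l arbitrary: F)
  case Nil
  then show ?case using multilinear_entry_0 [OF Nil refl, of "[0]"] by simp
next
  case (Cons x l)
  then show ?case
    using multilinear_entry_0 [OF Cons.prems refl, of "0 # drop q (x # l)"]
      Cons.IH [OF multilinear_Cons [OF Cons.prems]] by simp
qed

text \<open>Insertions of \<open>g\<close> and \<open>h\<close> at disjoint positions occur in both
  orders and cancel by sign; only the nested ones survive. \<open>F\<close> is multilinear in every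
  degree rather than a cochain, so that the induction on the list can fix its first argument and the
  identity also applies to \<open>F = tensor\<close>.\<close>

lemma pre_Lie:
  assumes g: "g \<in> cochains q" and h: "h \<in> cochains r" and "\<And>n. multilinear n F"
  shows "insertions r h (insertions q g F) l
      - koszul_sign q r *\<^sub>C insertions q g (insertions r h F) l =
    insertions (q + r - 1) (insertions r h g) F l
      - koszul_sign q r *\<^sub>C insertions (q + r - 1) (insertions q g h) F l"
  using assms(3)
proof (induction l arbitrary: F)
  case Nil
  have "front 0 u F [] = 0" if "u [] = 0" for u
    using multilinear_entry_0 [OF Nil, of "[0]"] that by (simp add: front_def)
  then show ?case
    using insertions_insertions [OF g Nil, of r h "[]"] insertions_insertions [OF h Nil, of q g "[]"]
      insertions_split [of "q + r - 1" _ F "[]"] cochains_length [OF g] cochains_length [OF h]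
    by (cases q; cases r) (simp_all add: koszul_sign_def deg_sign_def add.commute del: insertions.simps)
next
  case (Cons x l)
  let ?e = "deg_sign q * deg_sign r" and ?k = "koszul_sign q r"
  let ?F = "\<lambda>l. F (x # l)"
  have IH: "insertions r h (insertions q g ?F) l - ?k *\<^sub>C insertions q g (insertions r h ?F) l =
    insertions (q + r - 1) (insertions r h g) ?F l - ?k *\<^sub>C insertions (q + r - 1) (insertions q g h) ?F l"
    by (rule Cons.IH) (rule multilinear_Cons [OF Cons.prems])
  let ?A = "if q \<le> length (x # l)
    then insertions r h (\<lambda>v. F (g (take q (x # l)) # v)) (drop q (x # l)) else 0"
  let ?B = "if r \<le> length (x # l)
    then insertions q g (\<lambda>v. F (h (take r (x # l)) # v)) (drop r (x # l)) else 0"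
  have L: "insertions r h (insertions q g F) (x # l) = front (q + r - 1) (insertions r h g) F (x # l)
      + deg_sign r ^ q *\<^sub>C ?A + deg_sign q *\<^sub>C ?B + ?e *\<^sub>C insertions r h (insertions q g ?F) l"
    by (subst insertions_insertions [OF g Cons.prems])
      (simp only: list.case if_distrib [of "scaleC _"] scaleC_zero_right)
  have R: "insertions q g (insertions r h F) (x # l) = front (q + r - 1) (insertions q g h) F (x # l)
      + deg_sign q ^ r *\<^sub>C ?B + deg_sign r *\<^sub>C ?A + ?e *\<^sub>C insertions q g (insertions r h ?F) l"
    by (subst insertions_insertions [OF h Cons.prems])
      (simp only: list.case if_distrib [of "scaleC _"] scaleC_zero_right mult.commute [of "deg_sign r"] add.commute [of r q])
  \<comment> \<open>With these signs the terms with \<open>g\<close> in front and \<open>h\<close>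
    behind, and those with \<open>h\<close> in front and \<open>g\<close> behind, cancel in the
    graded commutator.\<close>
  have k: "?k * deg_sign q ^ r = deg_sign q" "?k * deg_sign r = deg_sign r ^ q"
    by (simp_all add: koszul_sign_def deg_sign_def)
  \<comment> \<open>For q = r = 0 the degree q + r - 1 is truncated and this multiplicativity fails;
    the nested cochains are then 0, as recorded below in \<open>zero\<close>.\<close>
  have e: "deg_sign (q + r - 1) = ?e" if "q + r \<noteq> 0"
    using that even_add [of q r] by (cases "q + r") (auto simp: deg_sign_def)
  have S: "insertions (q + r - 1) u F (x # l) = front (q + r - 1) u F (x # l)
      + ?e *\<^sub>C insertions (q + r - 1) u ?F l" if "q + r = 0 \<Longrightarrow> u = (\<lambda>_. 0)" for u
  proof (cases "q + r = 0")
    case True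
    then show ?thesis
      using that insertions_zero_arg [OF Cons.prems] insertions_zero_arg [OF multilinear_Cons [OF Cons.prems]]
        multilinear_entry_0 [OF Cons.prems refl, of "0 # x # l"]
      by (simp add: front_def del: insertions.simps)
  next
    case False
    show ?thesis unfolding insertions_Cons e [OF False] ..
  qed
  have zero: "q + r = 0 \<Longrightarrow> insertions r h g = (\<lambda>_. 0)" "q + r = 0 \<Longrightarrow> insertions q g h = (\<lambda>_. 0)"
    using g h insertions_cochains_0 by auto
  have S': "insertions (q + r - 1) (insertions r h g) F (x # l)
        = front (q + r - 1) (insertions r h g) F (x # l)
          + ?e *\<^sub>C insertions (q + r - 1) (insertions r h g) ?F l"
      "insertions (q + r - 1) (insertions q g h) F (x # l)
        = front (q + r - 1) (insertions q g h) F (x # l)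
          + ?e *\<^sub>C insertions (q + r - 1) (insertions q g h) ?F l"
    by (rule S, erule zero)+
  have "insertions r h (insertions q g F) (x # l) - ?k *\<^sub>C insertions q g (insertions r h F) (x # l)
     = front (q + r - 1) (insertions r h g) F (x # l) - ?k *\<^sub>C front (q + r - 1) (insertions q g h) F (x # l)
      + ?e *\<^sub>C (insertions r h (insertions q g ?F) l - ?k *\<^sub>C insertions q g (insertions r h ?F) l)"
    unfolding L R scaleC_add_right scaleC_diff_right scaleC_scaleC k mult.commute [of ?e]
    by (simp only: algebra_simps)
  also have "\<dots> = insertions (q + r - 1) (insertions r h g) F (x # l)
      - ?k *\<^sub>C insertions (q + r - 1) (insertions q g h) F (x # l)"
    unfolding IH S' scaleC_add_right scaleC_diff_right scaleC_scaleC
      mult.commute [of ?e]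
    by (simp only: algebra_simps)
  finally show ?case .
qed

section \<open>The product as a 2-cochain, and bilinearity of the bracket\<close>

definition mult_list :: "('a \<Rightarrow> 'a \<Rightarrow> 'a::complex_vector) \<Rightarrow> 'a list \<Rightarrow> 'a" where
  "mult_list m l = (if length l = 2 then m (l ! 0) (l ! 1) else 0)"

text \<open>For a cochain these are, up to sign, the inner terms of the Hochschild differential; for
  \<open>F = tensor\<close> they are the bar differential. One set of identities thus serves both
  complexes.\<close>

abbreviation merges ::
    "('a \<Rightarrow> 'a \<Rightarrow> 'a::complex_vector) \<Rightarrow> ('a list \<Rightarrow> 'b::complex_vector) \<Rightarrow> 'a list \<Rightarrow> 'b" where
  "merges m \<equiv> insertions 2 (mult_list m)"

lemma merges_simps:
  "merges m F [] = 0" "merges m F [x] = 0"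
  "merges m F (x # y # l) = F (m x y # l) - merges m (\<lambda>l'. F (x # l')) (y # l)"
  by (simp_all add: mult_list_def deg_sign_def)

declare insertions.simps [simp del]

lemma merges_eq_sum:
  "merges m F l = (\<Sum>k<length l - 1. (- 1) ^ k *\<^sub>C F (take k l @ m (l ! k) (l ! (k + 1)) # drop (k + 2) l))"
proof -
  have "length l + 1 - 2 = length l - 1" by simp
  then show ?thesis
    unfolding insertions_eq_sum by (simp add: mult_list_def deg_sign_def)
qed

lemma insertions_arg_linear:
  assumes "\<And>n. multilinear n F"
  shows "insertions q (\<lambda>l. g l + c *\<^sub>C g' l) F l = insertions q g F l + c *\<^sub>C insertions q g' F l"
  using assms
proof (induction l arbitrary: F)
  case Nil
  show ?case
    using multilinear_head [OF Nil refl, of "[]"] by (simp add: complex_linear_def insertions.simps)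
next
  case (Cons x l)
  show ?case
    using multilinear_head [OF Cons.prems refl, of "drop q (x # l)"]
      Cons.IH [OF multilinear_Cons [OF Cons.prems]]
    by (simp add: insertions.simps complex_linear_def scaleC_add_right scaleC_scaleC mult.commute del: drop_Cons')
qed

lemma insertions_arg_diff:
  assumes F: "\<And>n. multilinear n F"
  shows "insertions q (\<lambda>l. c *\<^sub>C g l - g' l) F l = c *\<^sub>C insertions q g F l - insertions q g' F l"
proof -
  have "insertions q (\<lambda>l. c *\<^sub>C g l - g' l) F l
      = insertions q (\<lambda>l. c *\<^sub>C g l) F l + (- 1) *\<^sub>C insertions q g' F l"
    using insertions_arg_linear [OF F, of q "\<lambda>l. c *\<^sub>C g l" "-1" g' l] by (simp add: scaleC_one)
  also have "insertions q (\<lambda>l. c *\<^sub>C g l) F l = c *\<^sub>C insertions q g F l"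
    using insertions_arg_linear [OF F, of q "\<lambda>_. 0" c g l] by (simp add: insertions_zero_arg [OF F])
  finally show ?thesis by (simp add: scaleC_one)
qed

lemma coh_class_eq:
  fixes B :: "('x \<Rightarrow> 'b::ab_group_add) set"
  assumes "(\<lambda>_. 0) \<in> B" and diff: "\<And>u v. u \<in> B \<Longrightarrow> v \<in> B \<Longrightarrow> u - v \<in> B"
  shows "coh_class B f = coh_class B g \<longleftrightarrow> f - g \<in> B"
proof
  assume "coh_class B f = coh_class B g"
  moreover have "f \<in> coh_class B f" using assms(1) by (simp add: coh_class_def fun_diff_def)
  ultimately show "f - g \<in> B" by (simp add: coh_class_def)
next
  assume fg: "f - g \<in> B"
  have "h - f \<in> B \<longleftrightarrow> h - g \<in> B" for h
  proof
    assume "h - g \<in> B"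
    then have "(h - g) - (f - g) \<in> B" using fg diff by blast
    then show "h - f \<in> B" by (simp add: fun_diff_def)
  next
    assume "h - f \<in> B"
    moreover have "(\<lambda>_. 0) - (f - g) \<in> B" using fg assms by blast
    ultimately have "(h - f) - ((\<lambda>_. 0) - (f - g)) \<in> B" using diff by blast
    then show "h - g \<in> B" by (simp add: fun_diff_def)
  qed
  then show "coh_class B f = coh_class B g" by (simp add: coh_class_def)
qed

lemma gerst_bracket_eq:
  assumes "f \<in> cochains p" "g \<in> cochains q"
  shows "gerst_bracket p q f g = (\<lambda>l. insertions q g f l - koszul_sign p q *\<^sub>C insertions p f g l)"
  by (rule ext) (simp add: gerst_bracket_def circ_eq_insertions [OF assms(1)]
      circ_eq_insertions [OF assms(2)] koszul_sign_powi)

text \<open>\<open>koszul_sign\<close> is symmetric and squares to 1. This graded antisymmetry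
  transfers the treatment of coboundaries from the first argument to the second.\<close>

lemma gerst_bracket_commute:
  assumes "f \<in> cochains p" "g \<in> cochains q"
  shows "gerst_bracket p q f g = (\<lambda>l. (- koszul_sign p q) *\<^sub>C gerst_bracket q p g f l)"
  unfolding gerst_bracket_eq [OF assms] gerst_bracket_eq [OF assms(2,1)]
  by (rule ext) (simp add: koszul_sign_def scaleC_one scaleC_diff_right scaleC_scaleC)

lemma gerst_bracket_cochains:
  assumes "f \<in> cochains p" "g \<in> cochains q"
  shows "gerst_bracket p q f g \<in> cochains (p + q - 1)"
  unfolding gerst_bracket_eq [OF assms]
  using insertions_cochains [OF assms] insertions_cochains [OF assms(2,1)]
  by (intro cochains_diff cochains_scale) (simp_all add: add.commute)

lemma gerst_bracket_linear_left:
  assumes "f \<in> cochains p" "f' \<in> cochains p" "g \<in> cochains q"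
  shows "gerst_bracket p q (\<lambda>l. f l + c *\<^sub>C f' l) g
    = (\<lambda>l. gerst_bracket p q f g l + c *\<^sub>C gerst_bracket p q f' g l)"
  using assms
  by (simp add: gerst_bracket_eq cochains_add cochains_scale insertions_add insertions_scale
      insertions_arg_linear [OF cochains_multilinear_any [OF assms(3)]]
      scaleC_add_right scaleC_diff_right scaleC_scaleC mult.commute fun_eq_iff algebra_simps)

lemma gerst_bracket_linear_right:
  assumes "f \<in> cochains p" "g \<in> cochains q" "g' \<in> cochains q"
  shows "gerst_bracket p q f (\<lambda>l. g l + c *\<^sub>C g' l)
    = (\<lambda>l. gerst_bracket p q f g l + c *\<^sub>C gerst_bracket p q f g' l)"
  using assms
  by (simp add: gerst_bracket_eq cochains_add cochains_scale insertions_add insertions_scale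
      insertions_arg_linear [OF cochains_multilinear_any [OF assms(1)]]
      scaleC_add_right scaleC_diff_right scaleC_scaleC mult.commute fun_eq_iff algebra_simps)


section \<open>The Hochschild complex\<close>

text \<open>The product is a parameter rather than a class operation, because the product of S#G is
  not the pointwise product of the type \<open>vec\<close>. Both S and S#G become instances.\<close>

locale unital_algebra =
  fixes m :: "'a::complex_vector \<Rightarrow> 'a \<Rightarrow> 'a" and e :: 'a
  assumes linear_left: "complex_linear (\<lambda>x. m x y)"
    and linear_right: "complex_linear (m x)"
    and assoc: "m (m x y) z = m x (m y z)"
    and unit_left [simp]: "m e x = x"
    and unit_right [simp]: "m x e = x"
begin

abbreviation mu :: "'a list \<Rightarrow> 'a" where "mu \<equiv> mult_list m"

lemma mu_cochains: "mu \<in> cochains 2"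
proof (rule cochainsI)
  show "multilinear 2 mu"
    using linear_left linear_right
    by (simp add: eval_nat_numeral multilinear_Suc multilinear_0 mult_list_def length_Suc_conv
        complex_linear_def)
qed (simp add: mult_list_def)

lemmas mu_multilinear = cochains_multilinear_any [OF mu_cochains]

text \<open>Associativity: on three entries the two insertions give the two bracketings with
  opposite signs.\<close>

lemma mu_mu: "insertions 2 mu mu = (\<lambda>_. 0)"
proof
  fix l
  show "insertions 2 mu mu l = 0"
  proof (cases "length l = 3")
    case True
    then obtain x y z where l: "l = [x, y, z]"
      by (auto simp: eval_nat_numeral length_Suc_conv)
    show ?thesis
      unfolding l by (simp only: merges_simps) (simp add: mult_list_def assoc)
  next
    case False
    then show ?thesis
      using cochains_length [OF insertions_cochains [OF mu_cochains mu_cochains], of l] by simp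
  qed
qed

lemma hoch_diff_Suc:
  assumes "length l = n + 1"
  shows "hoch_diff m n f l = m (hd l) (f (tl l)) - merges m f l
    + deg_sign n *\<^sub>C m (f (butlast l)) (last l)"
proof -
  have "(\<Sum>i = 1..n. (- 1) ^ i *\<^sub>C f (take (i - 1) l @ m (l ! (i - 1)) (l ! i) # drop (i + 1) l))
    = (\<Sum>k<n. - ((- 1) ^ k *\<^sub>C f (take k l @ m (l ! k) (l ! (k + 1)) # drop (k + 2) l)))"
    by (simp add: sum.atLeast1_atMost_eq)
  also have "\<dots> = - merges m f l"
    by (simp add: merges_eq_sum assms sum_negf)
  finally show ?thesis
    by (simp add: hoch_diff_def assms deg_sign_def)
qed

text \<open>The two insertions of \<open>f\<close> into the product are the outer terms, the
  insertions of the product into \<open>f\<close> are the inner ones. In this form d d = 0 and the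
  derivation rule for the bracket become consequences of \<open>pre_Lie\<close> and
  \<open>mu_mu\<close>.\<close>

lemma hoch_diff_eq:
  assumes f: "f \<in> cochains n"
  shows "hoch_diff m n f = (\<lambda>l. deg_sign n *\<^sub>C insertions n f mu l - insertions 2 mu f l)"
proof
  fix l
  show "hoch_diff m n f l = deg_sign n *\<^sub>C insertions n f mu l - insertions 2 mu f l"
  proof (cases "length l = n + 1")
    case True
    obtain x t where x: "l = x # t" using True by (cases l) auto
    obtain b z where b: "l = b @ [z]" using True by (cases l rule: rev_cases) auto
    have d: "drop n l = [last l]" "take n l = butlast l"
      using True unfolding b by simp_all
    have "length l + 1 - n = 2" using True by simp
    then have "insertions n f mu l = m (f (butlast l)) (last l) + deg_sign n *\<^sub>C m x (f t)"
      unfolding insertions_eq_sum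
      using d True by (simp add: eval_nat_numeral mult_list_def x scaleC_one)
    then show ?thesis
      using True unfolding hoch_diff_Suc [OF True]
      by (simp add: x deg_sign_def scaleC_add_right scaleC_one)
  next
    case False
    have "insertions n f mu \<in> cochains (2 + n - 1)" "insertions 2 mu f \<in> cochains (n + 2 - 1)"
      by (rule insertions_cochains [OF f mu_cochains], rule insertions_cochains [OF mu_cochains f])
    then have "insertions n f mu l = 0" "insertions 2 mu f l = 0"
      using False cochains_length [of "insertions n f mu" "n + 1" l]
        cochains_length [of "insertions 2 mu f" "n + 1" l] by auto
    then show ?thesis using False by (simp add: hoch_diff_def)
  qed
qed

lemma hoch_diff_cochains:
  assumes f: "f \<in> cochains n"
  shows "hoch_diff m n f \<in> cochains (n + 1)"
  unfolding hoch_diff_eq [OF f]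
  using insertions_cochains [OF f mu_cochains] insertions_cochains [OF mu_cochains f]
  by (intro cochains_diff cochains_scale) simp_all

lemma hoch_diff_linear:
  assumes f: "f \<in> cochains n" and g: "g \<in> cochains n"
  shows "hoch_diff m n (\<lambda>l. f l + c *\<^sub>C g l) = (\<lambda>l. hoch_diff m n f l + c *\<^sub>C hoch_diff m n g l)"
  using f g
  by (simp add: hoch_diff_eq cochains_add cochains_scale insertions_add insertions_scale
      insertions_arg_linear [OF mu_multilinear]
      scaleC_add_right scaleC_diff_right scaleC_scaleC mult.commute fun_eq_iff algebra_simps)

text \<open>In \<open>pre_Lie\<close> with the product for both \<open>g\<close> and
  \<open>h\<close>, the sign \<open>koszul_sign 2 2 = - 1\<close> turns the commutator into twice
  the square, while the right side vanishes by associativity; 2 is invertible. With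
  \<open>F = tensor\<close> this becomes d d = 0 on the bar resolution.\<close>

lemma merges_merges:
  assumes F: "\<And>n. multilinear n F"
  shows "insertions 2 mu (insertions 2 mu F) l = 0"
proof -
  have "koszul_sign 2 2 = - 1" by (simp add: koszul_sign_def)
  then have "insertions 2 mu (insertions 2 mu F) l + insertions 2 mu (insertions 2 mu F) l = 0"
    using pre_Lie [OF mu_cochains mu_cochains F, of l]
    by (simp add: mu_mu insertions_zero_arg [OF F] scaleC_one)
  then have "2 *\<^sub>C insertions 2 mu (insertions 2 mu F) l = 0"
    using scaleC_add_left [of 1 1 "insertions 2 mu (insertions 2 mu F) l"] by (simp add: scaleC_one)
  then have "(1 / 2) *\<^sub>C 2 *\<^sub>C insertions 2 mu (insertions 2 mu F) l = 0" by simp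
  then show ?thesis by (simp add: scaleC_scaleC scaleC_one)
qed

lemma merges_multilinear:
  assumes "\<And>n. multilinear n F"
  shows "multilinear n (insertions 2 mu F)"
proof (cases n)
  case (Suc k)
  then show ?thesis
    by (intro multilinear_insertions [OF mu_multilinear assms]) simp
qed (simp add: multilinear_0)

lemma hoch_diff_hoch_diff:
  assumes f: "f \<in> cochains n"
  shows "hoch_diff m (n + 1) (hoch_diff m n f) = (\<lambda>_. 0)"
proof
  fix l
  let ?e = "deg_sign n" and ?A = "insertions n f mu" and ?B = "insertions 2 mu f"
  note fm = cochains_multilinear_any [OF f]
  have k: "koszul_sign n 2 = ?e"
    by (simp add: koszul_sign_def deg_sign_def)
  have BB: "insertions 2 mu ?B l = 0"
    by (rule merges_merges [OF fm])
  \<comment> \<open>The term in which the product is inserted into itself has dropped out by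
    associativity. What remains expresses the merges of \<open>?A\<close> by insertions into the
    product, which the second differential produces as well.\<close>
  have AB: "insertions 2 mu ?A l
      = insertions (n + 1) ?B mu l - ?e *\<^sub>C insertions (n + 1) ?A mu l"
    using pre_Lie [OF f mu_cochains mu_multilinear, of l]
    by (simp add: k mu_mu)
  have "insertions (n + 1) (hoch_diff m n f) mu l
      = ?e *\<^sub>C insertions (n + 1) ?A mu l - insertions (n + 1) ?B mu l"
    unfolding hoch_diff_eq [OF f] by (rule insertions_arg_diff [OF mu_multilinear])
  then have "hoch_diff m (n + 1) (hoch_diff m n f) l =
     deg_sign (n + 1) *\<^sub>C (?e *\<^sub>C insertions (n + 1) ?A mu l - insertions (n + 1) ?B mu l)
       - (?e *\<^sub>C insertions 2 mu ?A l - insertions 2 mu ?B l)"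
    unfolding hoch_diff_eq [OF hoch_diff_cochains [OF f]]
    by (simp add: hoch_diff_eq [OF f] insertions_diff insertions_scale)
  then show "hoch_diff m (n + 1) (hoch_diff m n f) l = 0"
    unfolding AB BB by (simp add: deg_sign_def scaleC_one scaleC_diff_right)
qed

text \<open>\<open>pre_Lie\<close> is used three times: to expand the insertion of the product into
  each of the two compositions of \<open>f\<close> and \<open>g\<close> (facts 1 and 2), and to turn
  the bracket inserted into the product into a commutator of insertions (fact 3). The differential
  is thus a graded derivation of the bracket.\<close>

lemma hoch_diff_gerst_bracket:
  assumes f: "f \<in> cochains p" and g: "g \<in> cochains q"
  shows "hoch_diff m (p + q - 1) (gerst_bracket p q f g) =
    (\<lambda>l. deg_sign q *\<^sub>C gerst_bracket (p + 1) q (hoch_diff m p f) g l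
      + gerst_bracket p (q + 1) f (hoch_diff m q g) l)"
proof
  fix l
  note fm = cochains_multilinear_any [OF f] and gm = cochains_multilinear_any [OF g]
  note df = hoch_diff_cochains [OF f] and dg = hoch_diff_cochains [OF g]
  let ?FG = "insertions q g f" and ?GF = "insertions p f g" and ?N = "p + q - 1"
  have k: "koszul_sign n 2 = deg_sign n" for n
    by (simp add: koszul_sign_def deg_sign_def)
  have 1: "insertions 2 mu ?FG l = deg_sign q *\<^sub>C insertions q g (insertions 2 mu f) l
      + insertions (q + 1) (insertions 2 mu g) f l
      - deg_sign q *\<^sub>C insertions (q + 1) (insertions q g mu) f l"
    using pre_Lie [OF g mu_cochains fm, of l] by (simp add: k diff_eq_eq algebra_simps)
  have 2: "insertions 2 mu ?GF l = deg_sign p *\<^sub>C insertions p f (insertions 2 mu g) l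
      + insertions (p + 1) (insertions 2 mu f) g l
      - deg_sign p *\<^sub>C insertions (p + 1) (insertions p f mu) g l"
    using pre_Lie [OF f mu_cochains gm, of l] by (simp add: k diff_eq_eq algebra_simps)
  have br: "gerst_bracket p q f g = (\<lambda>l. ?FG l + (- koszul_sign p q) *\<^sub>C ?GF l)"
    by (simp add: gerst_bracket_eq [OF f g])
  have 3: "insertions ?N (gerst_bracket p q f g) mu l =
      insertions q g (insertions p f mu) l - koszul_sign p q *\<^sub>C insertions p f (insertions q g mu) l"
    using pre_Lie [OF f g mu_multilinear, of l]
    unfolding br insertions_arg_linear [OF mu_multilinear] by simp
  \<comment> \<open>For p = q = 0 the truncated degree p + q - 1 has the wrong sign, but there the
    bracket is 0.\<close>
  have 4: "deg_sign ?N *\<^sub>C insertions ?N (gerst_bracket p q f g) mu l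
    = (deg_sign p * deg_sign q) *\<^sub>C insertions ?N (gerst_bracket p q f g) mu l"
  proof (cases "p + q = 0")
    case True
    then have "gerst_bracket p q f g = (\<lambda>_. 0)"
      using f g unfolding br by (simp add: insertions_cochains_0)
    then show ?thesis by (simp add: insertions_zero_arg [OF mu_multilinear])
  next
    case False
    then have "deg_sign ?N = deg_sign p * deg_sign q"
      using even_add [of p q] by (cases "p + q") (auto simp: deg_sign_def)
    then show ?thesis by simp
  qed
  have arg: "insertions (n + 1) (hoch_diff m n u) v l
      = deg_sign n *\<^sub>C insertions (n + 1) (insertions n u mu) v l - insertions (n + 1) (insertions 2 mu u) v l"
    if "u \<in> cochains n" "\<And>n. multilinear n v" for u v n
    unfolding hoch_diff_eq [OF that(1)] by (rule insertions_arg_diff [OF that(2)])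
  show "hoch_diff m ?N (gerst_bracket p q f g) l =
     deg_sign q *\<^sub>C gerst_bracket (p + 1) q (hoch_diff m p f) g l
      + gerst_bracket p (q + 1) f (hoch_diff m q g) l"
    unfolding hoch_diff_eq [OF gerst_bracket_cochains [OF f g]] 4
    unfolding 3
    unfolding br insertions_add insertions_scale 1 2
    unfolding gerst_bracket_eq [OF df g] gerst_bracket_eq [OF f dg] arg [OF f gm] arg [OF g fm]
    unfolding hoch_diff_eq [OF f] hoch_diff_eq [OF g] insertions_diff insertions_scale
    by (simp add: deg_sign_def koszul_sign_def scaleC_add_right scaleC_diff_right scaleC_scaleC scaleC_one)
qed

section \<open>Cocycles, coboundaries and the bracket on Hochschild cohomology\<close>

lemma cocycles_cochains: "f \<in> hoch_cocycles m n \<Longrightarrow> f \<in> cochains n"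
  by (simp add: hoch_cocycles_def)

lemma cocycles_linear:
  "f \<in> hoch_cocycles m n \<Longrightarrow> g \<in> hoch_cocycles m n \<Longrightarrow> (\<lambda>l. f l + c *\<^sub>C g l) \<in> hoch_cocycles m n"
  by (simp add: hoch_cocycles_def hoch_diff_linear cochains_add cochains_scale)

lemma coboundaries_zero: "(\<lambda>_. 0) \<in> hoch_coboundaries m n"
proof (cases n)
  case (Suc k)
  have "hoch_diff m k (\<lambda>_. 0) = (\<lambda>_. 0)"
    using hoch_diff_eq [OF cochains_zero] by (simp add: insertions_zero_arg [OF mu_multilinear])
  then show ?thesis using Suc cochains_zero by (force simp: hoch_coboundaries_def)
qed (simp add: hoch_coboundaries_def)

lemma coboundaries_linear:
  assumes "f \<in> hoch_coboundaries m n" "g \<in> hoch_coboundaries m n"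
  shows "(\<lambda>l. f l + c *\<^sub>C g l) \<in> hoch_coboundaries m n"
proof (cases n)
  case 0
  then show ?thesis using assms by (simp add: hoch_coboundaries_def)
next
  case (Suc k)
  then obtain f' g' where "f' \<in> cochains k" "f = hoch_diff m k f'" "g' \<in> cochains k" "g = hoch_diff m k g'"
    using assms by (auto simp: hoch_coboundaries_def)
  then show ?thesis
    using hoch_diff_linear [of f' k g' c] Suc
    by (auto simp: hoch_coboundaries_def intro!: image_eqI [where x = "\<lambda>l. f' l + c *\<^sub>C g' l"]
        cochains_add cochains_scale)
qed

lemma coboundaries_scale: "f \<in> hoch_coboundaries m n \<Longrightarrow> (\<lambda>l. c *\<^sub>C f l) \<in> hoch_coboundaries m n"
  using coboundaries_linear [OF coboundaries_zero] by simp

lemma coboundaries_add: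
  "f \<in> hoch_coboundaries m n \<Longrightarrow> g \<in> hoch_coboundaries m n \<Longrightarrow> (\<lambda>l. f l + g l) \<in> hoch_coboundaries m n"
  using coboundaries_linear [of f n g 1] by (simp add: scaleC_one)

lemma coboundaries_diff:
  "f \<in> hoch_coboundaries m n \<Longrightarrow> g \<in> hoch_coboundaries m n \<Longrightarrow> f - g \<in> hoch_coboundaries m n"
  using coboundaries_linear [of f n g "-1"] by (simp add: scaleC_one fun_diff_def)

lemma coboundaries_cocycles: "hoch_coboundaries m n \<subseteq> hoch_cocycles m n"
proof (cases n)
  case 0
  then show ?thesis
    using coboundaries_zero [of 1] hoch_diff_eq [OF cochains_zero, of 0]
    by (simp add: hoch_coboundaries_def hoch_cocycles_def cochains_zero insertions_zero_arg [OF mu_multilinear])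
next
  case (Suc k)
  then show ?thesis
    using hoch_diff_cochains hoch_diff_hoch_diff
    by (auto simp: hoch_coboundaries_def hoch_cocycles_def)
qed

lemma hoch_class_eq:
  "coh_class (hoch_coboundaries m n) f = coh_class (hoch_coboundaries m n) g
    \<longleftrightarrow> f - g \<in> hoch_coboundaries m n"
  by (rule coh_class_eq) (use coboundaries_zero coboundaries_diff in simp_all)

lemma gerst_bracket_cocycles:
  assumes f: "f \<in> hoch_cocycles m p" and g: "g \<in> hoch_cocycles m q"
  shows "gerst_bracket p q f g \<in> hoch_cocycles m (p + q - 1)"
proof -
  note fc = cocycles_cochains [OF f] and gc = cocycles_cochains [OF g]
  have "gerst_bracket (p + 1) q (\<lambda>_. 0) g = (\<lambda>_. 0)"
    by (simp add: gerst_bracket_eq [OF cochains_zero gc] insertions_zero_arg [OF cochains_multilinear_any [OF gc]])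
  moreover have "gerst_bracket p (q + 1) f (\<lambda>_. 0) = (\<lambda>_. 0)"
    by (simp add: gerst_bracket_eq [OF fc cochains_zero] insertions_zero_arg [OF cochains_multilinear_any [OF fc]])
  ultimately show ?thesis
    using f g gerst_bracket_cochains [OF fc gc] hoch_diff_gerst_bracket [OF fc gc]
    by (simp add: hoch_cocycles_def)
qed

text \<open>If f = d f' and d g = 0, the derivation rule makes d [f', g] equal to [f, g] up to
  sign.\<close>

lemma gerst_bracket_coboundary_left:
  assumes f: "f \<in> hoch_coboundaries m p" and g: "g \<in> hoch_cocycles m q"
  shows "gerst_bracket p q f g \<in> hoch_coboundaries m (p + q - 1)"
proof (cases p)
  note gc = cocycles_cochains [OF g]
  case 0
  then have "gerst_bracket p q f g = (\<lambda>_. 0)"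
    using f by (simp add: hoch_coboundaries_def gerst_bracket_eq [OF cochains_zero gc]
        insertions_zero_arg [OF cochains_multilinear_any [OF gc]])
  then show ?thesis by (simp add: coboundaries_zero)
next
  note gc = cocycles_cochains [OF g]
  case (Suc k)
  then obtain f' where f': "f' \<in> cochains k" "f = hoch_diff m k f'"
    using f by (auto simp: hoch_coboundaries_def)
  have "gerst_bracket k (q + 1) f' (\<lambda>_. 0) = (\<lambda>_. 0)"
    by (simp add: gerst_bracket_eq [OF f'(1) cochains_zero]
        insertions_zero_arg [OF cochains_multilinear_any [OF f'(1)]])
  then have d: "hoch_diff m (k + q - 1) (gerst_bracket k q f' g) = (\<lambda>l. deg_sign q *\<^sub>C gerst_bracket p q f g l)"
    using hoch_diff_gerst_bracket [OF f'(1) gc] g f'(2) Suc by (simp add: hoch_cocycles_def)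
  have "(\<lambda>l. deg_sign q *\<^sub>C gerst_bracket p q f g l) \<in> hoch_coboundaries m (p + q - 1)"
  proof (cases "k + q = 0")
    \<comment> \<open>Here p = 1 and q = 0, and the truncated degree of [f', g] would put its
      differential in degree 1 instead of 0. Both brackets are 0.\<close>
    case True
    then have "gerst_bracket k q f' g = (\<lambda>_. 0)"
      using gc f' by (simp add: gerst_bracket_eq insertions_cochains_0)
    then show ?thesis
      using d hoch_diff_eq [OF cochains_zero, of "k + q - 1"] coboundaries_zero
      by (simp add: insertions_zero_arg [OF mu_multilinear])
  next
    case False
    then have "p + q - 1 = Suc (k + q - 1)" using Suc by simp
    then show ?thesis
      using d gerst_bracket_cochains [OF f'(1) gc]
      by (auto simp: hoch_coboundaries_def intro!: image_eqI [where x = "gerst_bracket k q f' g"])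
  qed
  from coboundaries_scale [OF this, of "deg_sign q"] show ?thesis
    by (simp add: scaleC_scaleC deg_sign_def scaleC_one split: if_splits)
qed

lemma gerst_bracket_coboundary_right:
  assumes f: "f \<in> hoch_cocycles m p" and g: "g \<in> hoch_coboundaries m q"
  shows "gerst_bracket p q f g \<in> hoch_coboundaries m (p + q - 1)"
proof -
  have gc: "g \<in> cochains q"
    using g coboundaries_cocycles cocycles_cochains by blast
  show ?thesis
    unfolding gerst_bracket_commute [OF cocycles_cochains [OF f] gc]
    using gerst_bracket_coboundary_left [OF g f]
    by (intro coboundaries_scale) (simp add: add.commute)
qed

text \<open>\<open>HH_bracket\<close> is a union over all pairs of representatives; since the class
  of the bracket does not depend on them, the union is a single class.\<close>

lemma HH_bracket_class:
  assumes f: "f \<in> hoch_cocycles m p" and g: "g \<in> hoch_cocycles m q"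
  shows "HH_bracket m p q (coh_class (hoch_coboundaries m p) f) (coh_class (hoch_coboundaries m q) g)
    = coh_class (hoch_coboundaries m (p + q - 1)) (gerst_bracket p q f g)"
proof -
  have "gerst_bracket p q f' g' - gerst_bracket p q f g \<in> hoch_coboundaries m (p + q - 1)"
    if f': "f' - f \<in> hoch_coboundaries m p" and g': "g' - g \<in> hoch_coboundaries m q" for f' g'
  proof -
    have ff': "f' \<in> hoch_cocycles m p"
      using cocycles_linear [of "f' - f" p f 1] f f' coboundaries_cocycles by (auto simp: scaleC_one)
    note c = cocycles_cochains [OF ff'] cocycles_cochains [OF f] cocycles_cochains [OF g]
    have gd: "g' - g \<in> cochains q"
      using g' coboundaries_cocycles cocycles_cochains by blast
    have fd: "f' - f \<in> cochains p"
      using f' coboundaries_cocycles cocycles_cochains by blast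
    have "gerst_bracket p q f' g' = (\<lambda>l. gerst_bracket p q f' g l + gerst_bracket p q f' (g' - g) l)"
      using gerst_bracket_linear_right [OF c(1,3) gd, of 1] by (simp add: scaleC_one)
    moreover have "gerst_bracket p q f' g = (\<lambda>l. gerst_bracket p q f g l + gerst_bracket p q (f' - f) g l)"
      using gerst_bracket_linear_left [OF c(2) fd c(3), of 1] by (simp add: scaleC_one)
    ultimately have "gerst_bracket p q f' g' - gerst_bracket p q f g
        = (\<lambda>l. gerst_bracket p q (f' - f) g l + gerst_bracket p q f' (g' - g) l)"
      by (simp add: fun_eq_iff)
    then show ?thesis
      using coboundaries_add gerst_bracket_coboundary_left [OF f' g]
        gerst_bracket_coboundary_right [OF ff' g'] by simp
  qed
  then have "coh_class (hoch_coboundaries m (p + q - 1)) (gerst_bracket p q f' g')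
      = coh_class (hoch_coboundaries m (p + q - 1)) (gerst_bracket p q f g)"
    if "f' \<in> coh_class (hoch_coboundaries m p) f" "g' \<in> coh_class (hoch_coboundaries m q) g" for f' g'
    using that by (simp add: hoch_class_eq) (simp add: coh_class_def)
  moreover have "h \<in> coh_class (hoch_coboundaries m n) h" for h n
    using coboundaries_zero by (simp add: coh_class_def fun_diff_def)
  ultimately show ?thesis
    unfolding HH_bracket_def by blast
qed

end

section \<open>Averages over a finite group\<close>

definition avg :: "('g::finite \<Rightarrow> 'b::complex_vector) \<Rightarrow> 'b" where
  "avg F = (1 / of_nat CARD('g)) *\<^sub>C (\<Sum>g\<in>UNIV. F g)"

lemma avg_const [simp]: "avg (\<lambda>_::'g::finite. x) = x"
  by (simp add: avg_def cvec.sum_constant_scale scaleC_scaleC scaleC_one)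

lemma avg_add: "avg (\<lambda>g. F g + F' g) = avg F + avg F'"
  by (simp add: avg_def sum.distrib scaleC_add_right)

lemma avg_diff: "avg (\<lambda>g. F g - F' g) = avg F - avg F'"
  by (simp add: avg_def sum_subtractf scaleC_diff_right)

lemma complex_linear_scaleC: "complex_linear (scaleC c)"
  by (simp add: complex_linear_def scaleC_add_right scaleC_scaleC mult.commute)

lemma avg_linear: "complex_linear L \<Longrightarrow> L (avg F) = avg (\<lambda>g. L (F g))"
  using complex_linear_sum [of L F UNIV] by (simp add: avg_def complex_linear_def)

lemma avg_shift:
  fixes F :: "'g::{group_add,finite} \<Rightarrow> 'b::complex_vector"
  shows "avg (\<lambda>g. F (k + g)) = avg F"
proof -
  have "(\<Sum>g\<in>UNIV. F (k + g)) = (\<Sum>g\<in>UNIV. F g)"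
    by (rule sum.reindex_bij_witness [of _ "\<lambda>g. - k + g" "\<lambda>g. k + g"])
      (simp_all flip: add.assoc)
  then show ?thesis by (simp add: avg_def)
qed

lemma insertions_avg:
  "insertions q g (\<lambda>l. avg (\<lambda>h. F h l)) l = avg (\<lambda>h. insertions q g (F h) l)"
  by (simp add: avg_def insertions_scale insertions_sum)

lemma multilinear_avg: "(\<And>h. multilinear n (F h)) \<Longrightarrow> multilinear n (\<lambda>l. avg (\<lambda>h. F h l))"
  unfolding avg_def by (intro multilinear_scale multilinear_sum)

lemma cochains_avg: "(\<And>h. F h \<in> cochains n) \<Longrightarrow> (\<lambda>l. avg (\<lambda>h. F h l)) \<in> cochains n"
  by (simp add: cochains_def multilinear_avg)


section \<open>The skew group algebra\<close>

lemma axis_0 [simp]: "axis g 0 = 0"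
  by (simp add: axis_def vec_eq_iff)

lemma complex_linear_axis: "complex_linear (axis g)"
  by (simp add: complex_linear_def axis_def vec_eq_iff scaleC_vec_def)

lemma axis_add: "axis g (x + y) = axis g x + axis g y"
  and axis_scale: "axis g (c *\<^sub>C x) = c *\<^sub>C axis g x"
  using complex_linear_axis [of g] by (auto simp: complex_linear_def)

lemma axis_nth_if: "axis g x $ h = (if h = g then x else 0)"
  by (simp add: axis_def)

lemma scaleC_nth: "(c *\<^sub>C v) $ g = c *\<^sub>C v $ g"
  by (simp add: scaleC_vec_def)

lemma sum_axis: "(\<Sum>g\<in>UNIV. axis g (a $ g)) = (a :: ('s::complex_vector, 'g::finite) vec)"
  by (simp add: vec_eq_iff axis_def)

lemma multilinear_eq_on_axis:
  fixes f f' :: "('s::complex_vector, 'g::finite) vec list \<Rightarrow> 'b::complex_vector"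
  assumes "multilinear n f" "multilinear n f'"
    and "\<And>ps. length ps = n \<Longrightarrow> f (map (\<lambda>(s, g). axis g s) ps) = f' (map (\<lambda>(s, g). axis g s) ps)"
    and "length l = n"
  shows "f l = f' l"
  using assms
proof (induction n arbitrary: f f' l)
  case 0
  then show ?case by fastforce
next
  case (Suc n)
  obtain x t where l: "l = x # t" "length t = n"
    using Suc.prems(4) by (cases l) auto
  have "f (axis g s # t) = f' (axis g s # t)" for g s
    by (rule Suc.IH [OF multilinear_Cons [OF Suc.prems(1)] multilinear_Cons [OF Suc.prems(2)]])
      (use Suc.prems(3) [of "(s, g) # _"] l in auto)
  moreover have "f (x # t) = (\<Sum>g\<in>UNIV. f (axis g (x $ g) # t))"
    using complex_linear_sum [OF multilinear_head [OF Suc.prems(1) l(2)]] by (subst sum_axis [symmetric]) auto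
  moreover have "f' (x # t) = (\<Sum>g\<in>UNIV. f' (axis g (x $ g) # t))"
    using complex_linear_sum [OF multilinear_head [OF Suc.prems(2) l(2)]] by (subst sum_axis [symmetric]) auto
  ultimately show ?case by (simp add: l)
qed

text \<open>Each position has its own linear map: in \<open>Theta_star\<close> the i-th argument
  passes through a component and an action that both depend on i.\<close>

lemma multilinear_entries:
  assumes "multilinear n f" "\<And>i. complex_linear (L i)"
  shows "multilinear n (\<lambda>l. f (map (\<lambda>i. L i (l ! i)) [0..<n]))"
  using assms
proof (induction n arbitrary: f L)
  case 0
  then show ?case by (simp add: multilinear_0)
next
  case (Suc n)
  have "multilinear n (\<lambda>l. f (L 0 x # map (\<lambda>i. L (Suc i) (l ! i)) [0..<n]))" for x
    by (rule Suc.IH) (use Suc.prems multilinear_Cons in auto)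
  moreover have "complex_linear (\<lambda>x. f (L 0 x # map (\<lambda>i. L (Suc i) (l ! i)) [0..<n]))" for l
    using multilinear_head [OF Suc.prems(1), of "map (\<lambda>i. L (Suc i) (l ! i)) [0..<n]"] Suc.prems(2) [of 0]
    by (simp add: complex_linear_def)
  ultimately show ?case
    by (simp add: multilinear_Suc map_upt_Suc del: upt_Suc)
qed

lemma merges_map:
  assumes "\<And>x y. \<phi> (m x y) = m' (\<phi> x) (\<phi> y)"
  shows "merges m (\<lambda>l. F (map \<phi> l)) l = merges m' F (map \<phi> l)"
proof (induction l arbitrary: F rule: induct_list012)
  case (3 x y l)
  show ?case
    using 3(2) [of "\<lambda>l. F (\<phi> x # l)"] by (simp add: merges_simps assms)
qed (simp_all add: merges_simps)

text \<open>All merges but the last take place among the arguments of \<open>f\<close>; the last one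
  multiplies the final entry of \<open>xs\<close> with \<open>z\<close>. For xs = [] there is no
  merge at all.\<close>

lemma merges_snoc:
  assumes B: "\<And>z. complex_linear (\<lambda>x. B x z)"
  shows "merges m (\<lambda>l. B (f (butlast l)) (last l)) (xs @ [z]) =
    B (merges m f xs) z
    - (if xs = [] then 0 else (- 1) ^ length xs *\<^sub>C B (f (butlast xs)) (m (last xs) z))"
proof (induction xs arbitrary: f rule: induct_list012)
  case 1
  then show ?case using complex_linear_0 [OF B] by (simp add: merges_simps)
next
  case (2 x)
  then show ?case
    using complex_linear_0 [OF B] by (simp add: merges_simps scaleC_one)
next
  case (3 x y l)
  have "merges m (\<lambda>l'. B (f (butlast (x # l'))) (last (x # l'))) (y # l @ [z])
      = merges m (\<lambda>l'. B (f (x # butlast l')) (last l')) (y # l @ [z])"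
    by (rule insertions_cong) simp
  then show ?case
    using 3(2) [of "\<lambda>l. f (x # l)"] complex_linear_diff [OF B]
    by (simp add: merges_simps butlast_append)
qed

locale smash =
  fixes act :: "'g::{group_add,finite} \<Rightarrow> 's::complex_algebra \<Rightarrow> 's"
  assumes action: "algebra_action act"
begin

abbreviation mul (infixl \<open>\<star>\<close> 70) where "a \<star> b \<equiv> smash_mult act a b"

abbreviation \<iota> :: "'s \<Rightarrow> ('s, 'g) smash" where "\<iota> \<equiv> axis 0"

abbreviation u :: "'g \<Rightarrow> ('s, 'g) smash" where "u g \<equiv> axis g 1"

lemma act_simps [simp]:
  "act 0 s = s" "act g (act h s) = act (g + h) s" "act g (s + t) = act g s + act g t"
  "act g (s * t) = act g s * act g t" "act g 1 = 1" "act g (c *\<^sub>C s) = c *\<^sub>C act g s"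
  using action by (simp_all add: algebra_action_def)

lemma complex_linear_act: "complex_linear (act g)"
  by (simp add: complex_linear_def)

lemma act_0 [simp]: "act g 0 = 0"
  by (rule complex_linear_0 [OF complex_linear_act])

lemma mul_axis: "axis g s \<star> axis h t = axis (g + h) (s * act g t)"
proof -
  have "axis (g' + h') (axis g s $ g' * act g' (axis h t $ h'))
      = (if h' = h then if g' = g then axis (g + h) (s * act g t) else 0 else 0)" for g' h'
    by (simp add: axis_nth_if)
  then show ?thesis by (simp add: smash_mult_def)
qed

lemma linear_mul_left: "complex_linear (\<lambda>x. x \<star> y)"
  by (simp add: complex_linear_def smash_mult_def scaleC_nth distrib_right sum.distrib cvec.scale_sum_right
      axis_add axis_scale mult_scaleC_left)

lemma linear_mul_right: "complex_linear (\<lambda>y. x \<star> y)"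
  by (simp add: complex_linear_def smash_mult_def scaleC_nth distrib_left sum.distrib cvec.scale_sum_right
      axis_add axis_scale mult_scaleC_right)

lemma mul_assoc: "a \<star> b \<star> c = a \<star> (b \<star> c)"
proof -
  have 1: "axis g s \<star> axis h t \<star> axis k r = axis g s \<star> (axis h t \<star> axis k r)" for g s h t k r
    by (simp add: mul_axis add.assoc mult.assoc)
  have 2: "axis g s \<star> axis h t \<star> c = axis g s \<star> (axis h t \<star> c)" for g s h t
  proof -
    have "axis g s \<star> axis h t \<star> (\<Sum>k\<in>UNIV. axis k (c $ k))
        = axis g s \<star> (axis h t \<star> (\<Sum>k\<in>UNIV. axis k (c $ k)))"
      by (simp only: complex_linear_sum [OF linear_mul_right] 1)
    then show ?thesis by (simp only: sum_axis)
  qed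
  have 3: "axis g s \<star> b \<star> c = axis g s \<star> (b \<star> c)" for g s
  proof -
    have "axis g s \<star> (\<Sum>k\<in>UNIV. axis k (b $ k)) \<star> c
        = axis g s \<star> ((\<Sum>k\<in>UNIV. axis k (b $ k)) \<star> c)"
      by (simp only: complex_linear_sum [OF linear_mul_right] complex_linear_sum [OF linear_mul_left] 2)
    then show ?thesis by (simp only: sum_axis)
  qed
  have "(\<Sum>k\<in>UNIV. axis k (a $ k)) \<star> b \<star> c = (\<Sum>k\<in>UNIV. axis k (a $ k)) \<star> (b \<star> c)"
    by (simp only: complex_linear_sum [OF linear_mul_left] 3)
  then show ?thesis by (simp only: sum_axis)
qed

lemma mul_unit_left: "u 0 \<star> a = a"
proof -
  have "u 0 \<star> (\<Sum>k\<in>UNIV. axis k (a $ k)) = (\<Sum>k\<in>UNIV. axis k (a $ k))"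
    by (simp add: complex_linear_sum [OF linear_mul_right] mul_axis)
  then show ?thesis by (simp only: sum_axis)
qed

lemma mul_unit_right: "a \<star> u 0 = a"
proof -
  have "(\<Sum>k\<in>UNIV. axis k (a $ k)) \<star> u 0 = (\<Sum>k\<in>UNIV. axis k (a $ k))"
    by (simp add: complex_linear_sum [OF linear_mul_left] mul_axis)
  then show ?thesis by (simp only: sum_axis)
qed

sublocale unital_algebra "smash_mult act" "axis 0 1"
  by unfold_locales
    (rule linear_mul_left linear_mul_right mul_assoc mul_unit_left mul_unit_right)+

lemmas mul_0_left [simp] = complex_linear_0 [OF linear_mul_left]
lemmas mul_0_right [simp] = complex_linear_0 [OF linear_mul_right]

lemma mul_add_left: "(x + y) \<star> z = x \<star> z + y \<star> z"
  and mul_add_right: "z \<star> (x + y) = z \<star> x + z \<star> y"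
  using linear_mul_left [of z] linear_mul_right [of z] by (auto simp: complex_linear_def)

lemma iota_mult: "\<iota> (s * t) = \<iota> s \<star> \<iota> t"
  by (simp add: mul_axis)

lemma u_mult: "u g \<star> u h = u (g + h)" "u g \<star> (u h \<star> a) = u (g + h) \<star> a"
  by (simp_all add: mul_axis flip: mul_assoc)

lemma u_iota: "u g \<star> \<iota> s = \<iota> (act g s) \<star> u g" "u g \<star> (\<iota> s \<star> a) = \<iota> (act g s) \<star> (u g \<star> a)"
  by (simp_all add: mul_axis flip: mul_assoc)

lemma axis_eq: "axis g s = \<iota> s \<star> u g"
  by (simp add: mul_axis)

lemma smash_conj_eq: "smash_conj act g a = u g \<star> (a \<star> u (- g))"
  by (simp add: smash_conj_def mul_assoc)

lemma linear_conj: "complex_linear (smash_conj act g)"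
  using linear_mul_left linear_mul_right by (simp add: smash_conj_eq complex_linear_def)

lemma conj_mult: "smash_conj act g (a \<star> b) = smash_conj act g a \<star> smash_conj act g b"
  by (simp add: smash_conj_eq mul_assoc u_mult mul_unit_left)

lemma conj_iota: "smash_conj act g (\<iota> s) = \<iota> (act g s)"
  by (simp add: smash_conj_eq mul_axis)

lemma conj_conj: "smash_conj act g (smash_conj act h a) = smash_conj act (g + h) a"
  by (simp add: smash_conj_eq mul_assoc u_mult minus_add)

lemma conj_0: "smash_conj act 0 a = a"
  by (simp add: smash_conj_eq mul_unit_left mul_unit_right)


section \<open>Cochains relative to the group algebra\<close>

text \<open>With \<open>h\<^sub>0 = g\<close>, \<open>rel_conj\<close> is the average of \<open>F [h\<^sub>0\<inverse>a\<^sub>1h\<^sub>1, \<dots>, h\<^sub>n\<^sub>-\<^sub>1\<inverse>a\<^sub>n]\<close>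
  over all \<open>h\<^sub>i\<close>, and \<open>rel_homotopy\<close> the alternating sum over \<open>k\<close> of the averages of
  \<open>F [h\<^sub>0\<inverse>a\<^sub>1h\<^sub>1, \<dots>, h\<^sub>k\<^sub>-\<^sub>1\<inverse>a\<^sub>kh\<^sub>k, h\<^sub>k\<inverse>, a\<^sub>k\<^sub>+\<^sub>1, \<dots>, a\<^sub>n]\<close>. Up to left multiplication by \<open>g\<close> and the
  average over \<open>g\<close>, the latter is the homotopy between the identity and the projection onto cochains
  that are multilinear over the group algebra.\<close>

fun rel_conj :: "'g \<Rightarrow> (('s, 'g) smash list \<Rightarrow> 'b::complex_vector) \<Rightarrow> ('s, 'g) smash list \<Rightarrow> 'b" where
  "rel_conj g F [] = 0"
| "rel_conj g F [a] = F [u (- g) \<star> a]"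
| "rel_conj g F (a # b # l) = avg (\<lambda>h. rel_conj h (\<lambda>l'. F (u (- g) \<star> a \<star> u h # l')) (b # l))"

fun rel_homotopy :: "'g \<Rightarrow> (('s, 'g) smash list \<Rightarrow> 'b::complex_vector) \<Rightarrow> ('s, 'g) smash list \<Rightarrow> 'b" where
  "rel_homotopy g F [] = 0"
| "rel_homotopy g F (a # l) =
     F (u (- g) # a # l) - avg (\<lambda>h. rel_homotopy h (\<lambda>l'. F (u (- g) \<star> a \<star> u h # l')) l)"

lemma rel_homotopy_diff:
  "rel_homotopy g (\<lambda>l. F l - F' l) l = rel_homotopy g F l - rel_homotopy g F' l"
  by (induction l arbitrary: g F F') (simp_all add: avg_diff)

lemma rel_homotopy_linear:
  "complex_linear L \<Longrightarrow> rel_homotopy g (\<lambda>l. L (F l)) l = L (rel_homotopy g F l)"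
  by (induction l arbitrary: g F)
    (simp_all add: complex_linear_0 complex_linear_diff avg_linear)

lemmas rel_homotopy_scale = rel_homotopy_linear [OF complex_linear_scaleC]

lemma rel_homotopy_add:
  "rel_homotopy g (\<lambda>l. F l + F' l) l = rel_homotopy g F l + rel_homotopy g F' l"
  by (induction l arbitrary: g F F') (simp_all add: avg_add)

lemma rel_homotopy_cong:
  assumes "\<And>l'. length l' = Suc (length l) \<Longrightarrow> F l' = F' l'"
  shows "rel_homotopy g F l = rel_homotopy g F' l"
  using assms
proof (induction l arbitrary: g F F')
  case (Cons a l)
  have "rel_homotopy h (\<lambda>l'. F (x # l')) l = rel_homotopy h (\<lambda>l'. F' (x # l')) l" for h x
    by (rule Cons.IH) (simp add: Cons.prems)
  then show ?case by (simp add: Cons.prems)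
qed simp

lemma multilinear_rel_homotopy:
  "multilinear (Suc n) F \<Longrightarrow> multilinear n (rel_homotopy g F)"
proof (induction n arbitrary: g F)
  case 0
  then show ?case by (simp add: multilinear_0)
next
  case (Suc n)
  have lin: "complex_linear (\<lambda>x. F (y \<star> x \<star> z # l))" if "length l = Suc n" for l y z
    using multilinear_head [OF Suc.prems that] linear_mul_left linear_mul_right
    by (simp add: complex_linear_def)
  have lin2: "complex_linear (\<lambda>x. F (y # x # l))" if "length l = n" for l y
    using multilinear_head [OF multilinear_Cons [OF Suc.prems] that] .
  have A: "multilinear n (\<lambda>l. F (u (- g) # a # l))" for a
    by (rule multilinear_Cons [OF multilinear_Cons [OF Suc.prems]])
  have B: "multilinear n (\<lambda>l. avg (\<lambda>h. rel_homotopy h (\<lambda>l'. F (u (- g) \<star> a \<star> u h # l')) l))" for a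
    by (intro multilinear_avg Suc.IH multilinear_Cons [OF Suc.prems])
  have C: "complex_linear (\<lambda>a. rel_homotopy h (\<lambda>l'. F (y \<star> a \<star> z # l')) l)" if "length l = n" for h l y z
  proof -
    have "rel_homotopy h (\<lambda>l'. F (y \<star> (a + b) \<star> z # l')) l
        = rel_homotopy h (\<lambda>l'. F (y \<star> a \<star> z # l') + F (y \<star> b \<star> z # l')) l" for a b
      by (rule rel_homotopy_cong) (use lin that in \<open>simp add: complex_linear_def\<close>)
    moreover have "rel_homotopy h (\<lambda>l'. F (y \<star> (c *\<^sub>C a) \<star> z # l')) l
        = rel_homotopy h (\<lambda>l'. c *\<^sub>C F (y \<star> a \<star> z # l')) l" for a c
      by (rule rel_homotopy_cong) (use lin that in \<open>simp add: complex_linear_def\<close>)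
    ultimately show ?thesis
      by (simp add: complex_linear_def rel_homotopy_add rel_homotopy_scale)
  qed
  have D: "complex_linear (\<lambda>a. rel_homotopy g F (a # l))" if "length l = n" for l
    using lin2 [OF that, of "u (- g)"] C [OF that]
    by (simp add: complex_linear_def avg_add scaleC_diff_right avg_linear [OF complex_linear_scaleC]
        scaleC_add_right scaleC_scaleC mult.commute)
  show ?case
    using D multilinear_diff [OF A B] by (simp add: multilinear_Suc)
qed

text \<open>A telescope: multiplying the inserted h_k^-1 into the entry behind it cancels against
  multiplying h_(k+1)^-1 into the entry in front of it, and merges away from the inserted element
  occur in both summands with opposite signs. Only the product of the last inserted element with the
  last entry survives, and this is \<open>rel_conj\<close>.\<close>

lemma rel_homotopy_merges:
  "l \<noteq> [] \<Longrightarrow> rel_homotopy g (merges (smash_mult act) F) l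
     + merges (smash_mult act) (rel_homotopy g F) l = rel_conj g F l"
proof (induction l arbitrary: g F rule: induct_list012)
  case (2 a)
  show ?case by (simp add: merges_simps)
next
  case (3 a b l)
  let ?M = "merges (smash_mult act)" and ?g = "u (- g)"
  let ?x = "\<lambda>h. ?g \<star> a \<star> u h"
  have x: "?x h \<star> u (- h) = ?g \<star> a" for h
    by (simp add: mul_assoc u_mult mul_unit_right)
  have 1: "rel_homotopy h (\<lambda>l. ?M F (y # l)) (b # l) =
      F (y \<star> u (- h) # b # l) - avg (\<lambda>k. rel_homotopy k (\<lambda>l. F (y \<star> (u (- h) \<star> b \<star> u k) # l)) l)
      - rel_homotopy h (?M (\<lambda>l. F (y # l))) (b # l)" for h y
    by (simp add: merges_simps rel_homotopy_diff avg_diff)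
  have 2: "?M (\<lambda>l. rel_homotopy g F (a # l)) (b # l) = ?M (\<lambda>l. F (?g # a # l)) (b # l)
      - avg (\<lambda>h. ?M (rel_homotopy h (\<lambda>l'. F (?x h # l'))) (b # l))"
    by (simp add: insertions_diff insertions_avg)
  \<comment> \<open>The product of two neighbouring conjugated entries no longer contains the group
    element between them, so the average over it is trivial.\<close>
  have 3: "avg (\<lambda>k. rel_homotopy k (\<lambda>l. F (?x h \<star> (u (- h) \<star> b \<star> u k) # l)) l)
      = avg (\<lambda>k. rel_homotopy k (\<lambda>l. F (?g \<star> (a \<star> b) \<star> u k # l)) l)" for h
    by (simp add: mul_assoc u_mult)
  have IH: "rel_homotopy h (?M (\<lambda>l. F (?x h # l))) (b # l) + ?M (rel_homotopy h (\<lambda>l. F (?x h # l))) (b # l)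
      = rel_conj h (\<lambda>l. F (?x h # l)) (b # l)" for h
    by (rule "3.IH"(2)) simp
  have "rel_homotopy g (?M F) (a # b # l) = ?M F (?g # a # b # l)
      - (F (?g \<star> a # b # l) - avg (\<lambda>k. rel_homotopy k (\<lambda>l. F (?g \<star> (a \<star> b) \<star> u k # l)) l)
        - avg (\<lambda>h. rel_homotopy h (?M (\<lambda>l. F (?x h # l))) (b # l)))"
    unfolding rel_homotopy.simps(2) [of g "?M F" a] 1 3 x by (simp only: avg_diff avg_const)
  also have "?M F (?g # a # b # l)
      = F (?g \<star> a # b # l) - F (?g # a \<star> b # l) + ?M (\<lambda>l. F (?g # a # l)) (b # l)"
    by (simp add: merges_simps)
  finally have L: "rel_homotopy g (?M F) (a # b # l) = - F (?g # a \<star> b # l)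
      + ?M (\<lambda>l. F (?g # a # l)) (b # l)
      + avg (\<lambda>k. rel_homotopy k (\<lambda>l. F (?g \<star> (a \<star> b) \<star> u k # l)) l)
      + avg (\<lambda>h. rel_homotopy h (?M (\<lambda>l. F (?x h # l))) (b # l))"
    by simp
  have R: "?M (rel_homotopy g F) (a # b # l)
      = F (?g # a \<star> b # l) - avg (\<lambda>k. rel_homotopy k (\<lambda>l. F (?g \<star> (a \<star> b) \<star> u k # l)) l)
        - ?M (\<lambda>l. F (?g # a # l)) (b # l)
        + avg (\<lambda>h. ?M (rel_homotopy h (\<lambda>l'. F (?x h # l'))) (b # l))"
    unfolding merges_simps(3) 2 by simp
  have "rel_homotopy g (?M F) (a # b # l) + ?M (rel_homotopy g F) (a # b # l)
      = avg (\<lambda>h. rel_homotopy h (?M (\<lambda>l. F (?x h # l))) (b # l)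
          + ?M (rel_homotopy h (\<lambda>l. F (?x h # l))) (b # l))"
    unfolding L R avg_add by simp
  then show ?case unfolding IH by simp
qed simp

lemma rel_conj_u_left: "rel_conj g F (u k \<star> a # l) = rel_conj (- k + g) F (a # l)"
proof -
  have "u (- g) \<star> (u k \<star> a) = u (- (- k + g)) \<star> a"
    by (simp add: u_mult minus_add)
  then show ?thesis by (cases l) simp_all
qed

text \<open>Moving \<open>u k\<close> across the gap shifts the variable \<open>h\<close> over which
  the average at this gap is taken.\<close>

lemma rel_conj_u_middle: "rel_conj g F (a \<star> u k # b # l) = rel_conj g F (a # u k \<star> b # l)"
proof -
  have "rel_conj g F (a # u k \<star> b # l)
      = avg (\<lambda>h. rel_conj (- k + h) (\<lambda>l'. F (u (- g) \<star> a \<star> u h # l')) (b # l))"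
    by (simp add: rel_conj_u_left)
  also have "\<dots> = avg (\<lambda>h. rel_conj (- k + (k + h)) (\<lambda>l'. F (u (- g) \<star> a \<star> u (k + h) # l')) (b # l))"
    by (rule avg_shift [symmetric])
  also have "\<dots> = rel_conj g F (a \<star> u k # b # l)"
    by (simp add: mul_assoc u_mult flip: add.assoc)
  finally show ?thesis ..
qed

lemma rel_conj_Cons: "l \<noteq> [] \<Longrightarrow>
    rel_conj g F (a # l) = avg (\<lambda>h. rel_conj h (\<lambda>l'. F (u (- g) \<star> a \<star> u h # l')) l)"
  by (cases l) simp_all

text \<open>\<open>u k\<close> crosses one gap at a time by \<open>rel_conj_u_middle\<close> and
  passes each entry from S by \<open>u_iota\<close>, which applies \<open>act k\<close> to
  it.\<close>

lemma rel_conj_u_iota: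
  "rel_conj g F (a \<star> u k # map \<iota> xs @ [w]) = rel_conj g F (a # map \<iota> (map (act k) xs) @ [u k \<star> w])"
proof (induction xs arbitrary: a g F)
  case Nil
  then show ?case by (simp only: list.map append.simps rel_conj_u_middle)
next
  case (Cons x xs)
  have "rel_conj g F (a \<star> u k # map \<iota> (x # xs) @ [w])
      = rel_conj g F (a # (\<iota> (act k x) \<star> u k # map \<iota> xs @ [w]))"
    by (simp only: list.map append.simps rel_conj_u_middle u_iota)
  also have "\<dots> = rel_conj g F (a # map \<iota> (map (act k) (x # xs)) @ [u k \<star> w])"
    by (simp only: rel_conj_Cons list.simps not_False_eq_True Cons.IH list.map append.simps)
  finally show ?case .
qed

end

section \<open>Restriction to S, the map \<open>Theta_star\<close> and invariant cochains\<close>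

context smash
begin

text \<open>The differential of the bar complex of S with coefficients in the bimodule A, written on
  multilinear maps on S instead of homomorphisms from the bar resolution.\<close>

definition coef_diff :: "nat \<Rightarrow> ('s list \<Rightarrow> ('s, 'g) smash) \<Rightarrow> 's list \<Rightarrow> ('s, 'g) smash" where
  "coef_diff n \<kappa> xs = (if length xs = n + 1
     then \<iota> (hd xs) \<star> \<kappa> (tl xs) - merges (*) \<kappa> xs + deg_sign n *\<^sub>C (\<kappa> (butlast xs) \<star> \<iota> (last xs))
     else 0)"

lemma restrict_cochains: "f \<in> cochains n \<Longrightarrow> restrict_S f \<in> cochains n"
  unfolding restrict_S_def cochains_def
  by (simp add: multilinear_map complex_linear_axis)

text \<open>The inclusion of S into A is multiplicative, so the terms of the two differentials
  correspond one by one.\<close>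

lemma restrict_hoch_diff:
  "restrict_S (hoch_diff (smash_mult act) n f) = coef_diff n (restrict_S f)"
proof
  fix xs :: "'s list"
  show "restrict_S (hoch_diff (smash_mult act) n f) xs = coef_diff n (restrict_S f) xs"
  proof (cases "length xs = n + 1")
    case True
    then have "xs \<noteq> []" by auto
    moreover have "merges (*) (\<lambda>l. f (map \<iota> l)) xs = merges (smash_mult act) f (map \<iota> xs)"
      by (rule merges_map) (rule iota_mult)
    ultimately show ?thesis
      using True hoch_diff_Suc [of "map \<iota> xs" n f]
      by (simp add: restrict_S_def [abs_def] coef_diff_def hd_map last_map map_tl map_butlast)
  next
    case False
    then show ?thesis by (simp add: restrict_S_def coef_diff_def hoch_diff_def)
  qed
qed

text \<open>The argument list of \<kappa> in \<open>Theta_star\<close>: each entry is acted on by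
  the product of all group elements before it. The recursion applies \<open>act g\<close> to the
  whole twisted tail, which suits induction; \<open>twist_eq\<close> connects it with the indexed
  form in the definition of \<open>Theta_star\<close>.\<close>

fun twist :: "('s \<times> 'g) list \<Rightarrow> 's list" where
  "twist [] = []"
| "twist ((s, g) # ps) = s # map (act g) (twist ps)"

abbreviation axes :: "('s \<times> 'g) list \<Rightarrow> ('s, 'g) smash list" where
  "axes \<equiv> map (\<lambda>(s, g). axis g s)"

abbreviation grade :: "('s \<times> 'g) list \<Rightarrow> 'g" where
  "grade ps \<equiv> sum_list (map snd ps)"

lemma length_twist [simp]: "length (twist ps) = length ps"
  by (induction ps rule: twist.induct) simp_all

lemma map_act_0: "map (act 0) xs = xs"
  by (simp add: map_idI)

lemma twist_snoc: "twist (ps @ [(s, g)]) = twist ps @ [act (grade ps) s]"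
  by (induction ps rule: twist.induct) simp_all

lemma twist_eq:
  "map (\<lambda>i. act (sum_list (take i (map snd ps))) (fst (ps ! i))) [0..<length ps] = twist ps"
proof (induction ps rule: twist.induct)
  case (2 s g ps)
  then show ?case
    by (simp add: map_upt_Suc del: upt_Suc flip: 2)
qed simp

lemma twist_ungraded: "twist (map (\<lambda>s. (s, 0)) xs) = xs"
  by (induction xs) (simp_all add: map_act_0)

lemma grade_ungraded: "grade (map (\<lambda>s. (s, 0)) xs) = 0"
  by (induction xs) simp_all

lemma Theta_cochains:
  assumes "multilinear n \<kappa>"
  shows "Theta_star act n \<kappa> \<in> cochains n"
proof (rule cochainsI)
  have "complex_linear (\<lambda>x. act k (x $ g))" for k g
    by (simp add: complex_linear_def scaleC_nth)
  then have "multilinear n (\<lambda>as. \<Sum>gs | length gs = n. smash_mult act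
      (\<kappa> (map (\<lambda>i. act (sum_list (take i gs)) ((as ! i) $ (gs ! i))) [0..<n])) (u (sum_list gs)))"
    by (intro multilinear_sum multilinear_linear [OF _ linear_left] multilinear_entries [OF assms])
  then show "multilinear n (Theta_star act n \<kappa>)"
    by (rule iffD1 [OF multilinear_cong, rotated]) (simp add: Theta_star_def)
qed (simp add: Theta_star_def)

text \<open>On elements s \<otimes> g, every choice of group elements other than the actual ones
  selects a component 0, so a single summand remains.\<close>

lemma Theta_axes:
  assumes \<kappa>: "multilinear n \<kappa>" and ps: "length ps = n"
  shows "Theta_star act n \<kappa> (axes ps) = \<kappa> (twist ps) \<star> u (grade ps)"
proof -
  let ?t = "\<lambda>gs. \<kappa> (map (\<lambda>i. act (sum_list (take i gs)) ((axes ps ! i) $ (gs ! i))) [0..<n])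
    \<star> u (sum_list gs)"
  have fin: "finite {gs :: 'g list. length gs = n}"
    using finite_lists_length_eq [of "UNIV :: 'g set" n] by simp
  have zero: "?t gs = 0" if gs: "length gs = n" "gs \<noteq> map snd ps" for gs
  proof -
    obtain i where i: "i < n" "gs ! i \<noteq> snd (ps ! i)"
      using gs ps by (auto simp: list_eq_iff_nth_eq)
    then have "act (sum_list (take i gs)) ((axes ps ! i) $ (gs ! i)) = 0"
      using ps by (simp add: case_prod_unfold axis_nth_if)
    then have "\<kappa> (map (\<lambda>i. act (sum_list (take i gs)) ((axes ps ! i) $ (gs ! i))) [0..<n]) = 0"
      by (intro multilinear_entry_0 [OF \<kappa>]) (use i in \<open>auto simp: image_iff intro: bexI [of _ i]\<close>)
    then show ?thesis by simp
  qed
  have "Theta_star act n \<kappa> (axes ps) = (\<Sum>gs | length gs = n. ?t gs)"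
    using ps by (simp add: Theta_star_def)
  also have "\<dots> = (\<Sum>gs\<in>{map snd ps}. ?t gs)"
    by (rule sum.mono_neutral_right) (use fin zero ps in auto)
  also have "map (\<lambda>i. act (sum_list (take i (map snd ps))) ((axes ps ! i) $ (map snd ps ! i))) [0..<n]
      = map (\<lambda>i. act (sum_list (take i (map snd ps))) (fst (ps ! i))) [0..<length ps]"
    using ps by (simp add: case_prod_unfold axis_nth_if)
  then have "(\<Sum>gs\<in>{map snd ps}. ?t gs) = \<kappa> (twist ps) \<star> u (grade ps)"
    unfolding twist_eq by simp
  finally show ?thesis .
qed

text \<open>The group components of elements of S are the unit, so nothing is twisted and the
  trailing factor is \<open>u 0\<close>.\<close>

lemma restrict_Theta:
  assumes "\<kappa> \<in> cochains n"
  shows "restrict_S (Theta_star act n \<kappa>) = \<kappa>"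
proof
  fix xs
  have m: "map \<iota> xs = axes (map (\<lambda>s. (s, 0)) xs)" by simp
  show "restrict_S (Theta_star act n \<kappa>) xs = \<kappa> xs"
  proof (cases "length xs = n")
    case True
    then show ?thesis
      unfolding restrict_S_def m
      by (subst Theta_axes [OF cochains_multilinear [OF assms]])
        (simp_all add: twist_ungraded grade_ungraded mul_unit_right del: map_map flip: map_map)
  next
    case False
    then show ?thesis
      using cochains_length [OF assms False] by (simp add: restrict_S_def Theta_star_def)
  qed
qed

lemma Theta_linear:
  assumes "multilinear n \<kappa>" "multilinear n \<kappa>'"
  shows "Theta_star act n (\<lambda>l. \<kappa> l + c *\<^sub>C \<kappa>' l)
    = (\<lambda>l. Theta_star act n \<kappa> l + c *\<^sub>C Theta_star act n \<kappa>' l)"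
  using linear_left
  by (simp add: fun_eq_iff Theta_star_def complex_linear_def sum.distrib cvec.scale_sum_right)

lemma cochain_act_cochains:
  "\<kappa> \<in> cochains n \<Longrightarrow> cochain_act act g \<kappa> \<in> cochains n"
  unfolding cochain_act_def cochains_def
  by (simp add: multilinear_linear [OF multilinear_map] complex_linear_act linear_conj
      complex_linear_0)

lemma cochain_act_act: "cochain_act act g (cochain_act act h \<kappa>) = cochain_act act (g + h) \<kappa>"
  by (simp add: fun_eq_iff cochain_act_def conj_conj comp_def minus_add)

lemma cochain_act_invariant:
  assumes "cochain_act act g \<kappa> = \<kappa>"
  shows "\<kappa> (map (act g) xs) = u g \<star> (\<kappa> xs \<star> u (- g))"
proof -
  have "\<kappa> (map (act g) xs) = cochain_act act g \<kappa> (map (act g) xs)"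
    using assms by simp
  then show ?thesis
    by (simp add: cochain_act_def smash_conj_eq comp_def)
qed

text \<open>Merging \<open>axis g s\<close> with \<open>axis g' t\<close> multiplies s by
  \<open>act g t\<close>, which is a merge in the twisted list. The parameters \<open>k\<close> and
  \<open>h\<close> collect the group elements already passed in the induction, as an action on the
  arguments and as a trailing factor.\<close>

lemma merges_axes:
  assumes "\<And>qs. length qs = n \<Longrightarrow> F (axes qs) = \<kappa> (map (act k) (twist qs)) \<star> u (h + grade qs)"
    and "length ps = Suc n"
  shows "merges (smash_mult act) F (axes ps) = merges (*) \<kappa> (map (act k) (twist ps)) \<star> u (h + grade ps)"
  using assms
proof (induction ps arbitrary: n F \<kappa> k h rule: induct_list012)
  case (2 p)
  then show ?case by (cases p) (simp add: merges_simps)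
next
  case (3 p q ps)
  obtain s g t g' where pq: "p = (s, g)" "q = (t, g')" by fastforce
  obtain n' where n: "n = Suc n'" "length ps = n'" using 3 by simp
  have "merges (smash_mult act) (\<lambda>l. F (axis g s # l)) (axes (q # ps))
      = merges (*) (\<lambda>l. \<kappa> (act k s # l)) (map (act (k + g)) (twist (q # ps))) \<star> u (h + g + grade (q # ps))"
    by (rule "3.IH"(2) [of n'])
      (use "3.prems"(1) [of "(s, g) # _"] n in \<open>auto simp: comp_def add.assoc\<close>)
  moreover have "F (axis (g + g') (s * act g t) # axes ps)
      = \<kappa> (act k s * act (k + g) t # map (act (k + (g + g'))) (twist ps)) \<star> u (h + (g + g' + grade ps))"
    using "3.prems"(1) [of "(s * act g t, g + g') # ps"] n by (simp add: comp_def)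
  ultimately show ?case
    by (simp add: pq merges_simps mul_axis comp_def add.assoc complex_linear_diff [OF linear_left]
       )
qed simp

text \<open>The inner terms agree by \<open>merges_axes\<close>, and the right outer term because
  the twist already acts on the last entry by the group elements before it. The left outer term is
  where invariance enters: the group element of the first entry has to pass \<kappa>.\<close>

lemma Theta_coef_diff:
  assumes \<kappa>: "\<kappa> \<in> cochains n" and inv: "\<And>g. cochain_act act g \<kappa> = \<kappa>"
  shows "hoch_diff (smash_mult act) n (Theta_star act n \<kappa>) = Theta_star act (n + 1) (coef_diff n \<kappa>)"
proof
  fix l
  note \<kappa>m = cochains_multilinear [OF \<kappa>]
  note T = Theta_cochains [OF \<kappa>m]
  let ?d = "hoch_diff (smash_mult act) n (Theta_star act n \<kappa>)"
  have d: "coef_diff n \<kappa> \<in> cochains (n + 1)"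
    using restrict_cochains [OF hoch_diff_cochains [OF T]]
    by (simp add: restrict_hoch_diff restrict_Theta [OF \<kappa>])
  show "?d l = Theta_star act (n + 1) (coef_diff n \<kappa>) l"
  proof (cases "length l = n + 1")
    case True
    show ?thesis
    proof (rule multilinear_eq_on_axis [OF _ _ _ True])
      show "multilinear (n + 1) ?d"
        by (rule cochains_multilinear [OF hoch_diff_cochains [OF T]])
      show "multilinear (n + 1) (Theta_star act (n + 1) (coef_diff n \<kappa>))"
        by (rule cochains_multilinear [OF Theta_cochains [OF cochains_multilinear [OF d]]])
      fix ps :: "('s \<times> 'g) list"
      assume ps: "length ps = n + 1"
      obtain s g qs where p: "ps = (s, g) # qs" "length qs = n"
        using ps by (cases ps) auto
      obtain t h rs where r: "ps = rs @ [(t, h)]" "length rs = n"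
        using ps by (cases ps rule: rev_cases) auto
      \<comment> \<open>Invariance trades left multiplication by \<open>u g\<close> for the action
        of \<open>g\<close> on the arguments, which is the twist caused by the first entry.\<close>
      have "axis g s \<star> (\<kappa> (twist qs) \<star> u (grade qs))
          = \<iota> s \<star> \<kappa> (map (act g) (twist qs)) \<star> u (grade ps)"
        by (simp add: cochain_act_invariant [OF inv] axis_eq [of g s] mul_assoc u_mult p)
      then have 1: "hd (axes ps) \<star> Theta_star act n \<kappa> (tl (axes ps))
          = \<iota> (hd (twist ps)) \<star> \<kappa> (tl (twist ps)) \<star> u (grade ps)"
        using Theta_axes [OF \<kappa>m p(2)] by (simp add: p)
      have "merges (smash_mult act) (Theta_star act n \<kappa>) (axes ps)
          = merges (*) \<kappa> (map (act 0) (twist ps)) \<star> u (0 + grade ps)"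
        by (rule merges_axes) (use ps Theta_axes [OF \<kappa>m] in \<open>simp_all add: map_act_0\<close>)
      then have 2: "merges (smash_mult act) (Theta_star act n \<kappa>) (axes ps)
          = merges (*) \<kappa> (twist ps) \<star> u (grade ps)"
        by (simp add: map_act_0)
      have "\<kappa> (twist rs) \<star> u (grade rs) \<star> axis h t
          = \<kappa> (twist rs) \<star> \<iota> (act (grade rs) t) \<star> u (grade ps)"
        by (simp add: mul_assoc mul_axis r)
      then have 3: "Theta_star act n \<kappa> (butlast (axes ps)) \<star> last (axes ps)
          = \<kappa> (butlast (twist ps)) \<star> \<iota> (last (twist ps)) \<star> u (grade ps)"
        using Theta_axes [OF \<kappa>m r(2)] by (simp add: r twist_snoc)
      have lin: "(a - b + c *\<^sub>C d) \<star> w = a \<star> w - b \<star> w + c *\<^sub>C (d \<star> w)" for a b c d w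
        using linear_left [of w] complex_linear_diff [OF linear_left [of w]]
        by (simp add: complex_linear_def)
      have "length (axes ps) = n + 1" using ps by simp
      from hoch_diff_Suc [OF this] have "?d (axes ps) = coef_diff n \<kappa> (twist ps) \<star> u (grade ps)"
        using ps by (simp only: 1 2 3 coef_diff_def lin length_twist if_True simp_thms)
      then show "?d (axes ps) = Theta_star act (n + 1) (coef_diff n \<kappa>) (axes ps)"
        by (simp only: Theta_axes [OF cochains_multilinear [OF d] ps])
    qed
  next
    case False
    then show ?thesis by (simp add: hoch_diff_def Theta_star_def)
  qed
qed

text \<open>Read off from A: \<kappa> is the restriction of
  \<open>Theta_star act n \<kappa>\<close>, and restriction takes the Hochschild differential to
  \<open>coef_diff\<close>.\<close>

lemma coef_diff_cochains:
  assumes \<kappa>: "\<kappa> \<in> cochains n"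
  shows "coef_diff n \<kappa> \<in> cochains (n + 1)"
  using restrict_cochains [OF hoch_diff_cochains [OF Theta_cochains [OF cochains_multilinear [OF \<kappa>]]]]
  by (simp add: restrict_hoch_diff restrict_Theta [OF \<kappa>])

lemma coef_diff_add:
  "coef_diff n (\<lambda>l. \<kappa> l + \<kappa>' l) = (\<lambda>l. coef_diff n \<kappa> l + coef_diff n \<kappa>' l)"
  using linear_left linear_right
  by (simp add: fun_eq_iff coef_diff_def complex_linear_def insertions_add scaleC_add_right algebra_simps)

lemma coef_diff_scale: "coef_diff n (\<lambda>l. c *\<^sub>C \<kappa> l) = (\<lambda>l. c *\<^sub>C coef_diff n \<kappa> l)"
  using linear_left linear_right
  by (simp add: fun_eq_iff coef_diff_def complex_linear_def insertions_scale scaleC_add_right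
      scaleC_diff_right scaleC_scaleC mult.commute)

lemma coef_diff_sum: "coef_diff n (\<lambda>l. \<Sum>i\<in>I. \<kappa> i l) = (\<lambda>l. \<Sum>i\<in>I. coef_diff n (\<kappa> i) l)"
proof (induction I rule: infinite_finite_induct)
  case (insert i I)
  then show ?case by (simp add: coef_diff_add)
qed (simp_all add: fun_eq_iff coef_diff_def)

lemma coef_diff_avg:
  fixes \<kappa> :: "'i::finite \<Rightarrow> 's list \<Rightarrow> ('s, 'g) smash"
  shows "coef_diff n (\<lambda>l. avg (\<lambda>h. \<kappa> h l)) = (\<lambda>l. avg (\<lambda>h. coef_diff n (\<kappa> h) l))"
  by (simp add: avg_def coef_diff_scale coef_diff_sum)

lemma coef_diff_act: "coef_diff n (cochain_act act g \<kappa>) = cochain_act act g (coef_diff n \<kappa>)"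
proof
  fix xs
  show "coef_diff n (cochain_act act g \<kappa>) xs = cochain_act act g (coef_diff n \<kappa>) xs"
  proof (cases "length xs = n + 1")
    case True
    then have xs: "xs \<noteq> []" by auto
    have "merges (*) (cochain_act act g \<kappa>) xs
        = smash_conj act g (merges (*) (\<lambda>l. \<kappa> (map (act (- g)) l)) xs)"
      unfolding cochain_act_def [abs_def] by (rule insertions_linear [OF linear_conj, symmetric])
    also have "merges (*) (\<lambda>l. \<kappa> (map (act (- g)) l)) xs = merges (*) \<kappa> (map (act (- g)) xs)"
      by (rule merges_map) simp
    finally have 1: "merges (*) (cochain_act act g \<kappa>) xs = smash_conj act g (merges (*) \<kappa> (map (act (- g)) xs))" .
    have "smash_conj act g (a - b + c *\<^sub>C d) = smash_conj act g a - smash_conj act g b + c *\<^sub>C smash_conj act g d"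
      for a b c d
      using linear_conj [of g] complex_linear_diff [OF linear_conj, of g a b]
      by (simp add: complex_linear_def)
    then show ?thesis
      using True xs
      by (simp add: coef_diff_def cochain_act_def [of act g "coef_diff n \<kappa>"] 1 conj_mult conj_iota
          hd_map last_map)
        (simp add: cochain_act_def map_tl map_butlast)
  next
    case False
    then show ?thesis
      by (simp add: coef_diff_def cochain_act_def complex_linear_0 [OF linear_conj])
  qed
qed

lemma avg_invariant:
  "cochain_act act g (\<lambda>l. avg (\<lambda>h. cochain_act act h \<kappa> l)) = (\<lambda>l. avg (\<lambda>h. cochain_act act h \<kappa> l))"
proof
  fix l
  have "cochain_act act g (\<lambda>l. avg (\<lambda>h. cochain_act act h \<kappa> l)) l
      = avg (\<lambda>h. cochain_act act g (cochain_act act h \<kappa>) l)"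
    by (simp add: cochain_act_def avg_linear [OF linear_conj])
  then show "cochain_act act g (\<lambda>l. avg (\<lambda>h. cochain_act act h \<kappa> l)) l
      = avg (\<lambda>h. cochain_act act h \<kappa> l)"
    by (simp only: cochain_act_act avg_shift [of "\<lambda>h. cochain_act act h \<kappa> l" g])
qed

subsection \<open>The projection onto relative cochains\<close>

text \<open>Each entry has the form \<open>\<iota> s \<star> u k\<close>. The factors
  \<open>u k\<close> are pushed into the last slot, those furthest to the right before the others,
  and twist the entries that they pass.\<close>

lemma rel_conj_axes:
  "rel_conj g F (axes ps @ [w]) = rel_conj g F (map \<iota> (twist ps) @ [u (grade ps) \<star> w])"
proof (induction ps arbitrary: g F)
  case Nil
  show ?case by (simp add: mul_unit_left)
next
  case (Cons p ps)
  obtain s k where p: "p = (s, k)" by fastforce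
  have "rel_conj g F (axes (p # ps) @ [w])
      = rel_conj g F (\<iota> s \<star> u k # map \<iota> (twist ps) @ [u (grade ps) \<star> w])"
    by (simp add: p axis_eq [of k s] rel_conj_Cons Cons.IH)
  also have "\<dots> = rel_conj g F (map \<iota> (twist (p # ps)) @ [u (grade (p # ps)) \<star> w])"
    by (simp only: rel_conj_u_iota) (simp add: p u_mult)
  finally show ?case .
qed

text \<open>The last entry is multiplied only from the left, so right linearity in it survives the
  averages.\<close>

lemma rel_conj_snoc:
  assumes "\<And>l w. F (l @ [w]) = F (l @ [u 0]) \<star> w"
  shows "rel_conj g F (l @ [w]) = rel_conj g F (l @ [u 0]) \<star> w"
  using assms
proof (induction l arbitrary: g F)
  case Nil
  then show ?case using Nil [of "[]" "u (- g) \<star> w"] Nil [of "[]" "u (- g)"]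
    by (simp add: mul_assoc)
next
  case (Cons a l)
  have prem: "F (x # l' @ [z]) = F (x # l' @ [u 0]) \<star> z" for x l' z
    using Cons.prems [of "x # l'" z] by (simp only: append.simps)
  have "rel_conj h (\<lambda>l'. F (x # l')) (l @ [w]) = rel_conj h (\<lambda>l'. F (x # l')) (l @ [u 0]) \<star> w" for h x
    by (rule Cons.IH) (rule prem)
  then show ?case by (simp add: rel_conj_Cons avg_linear [OF linear_left])
qed

lemma rel_homotopy_snoc:
  assumes "\<And>l w. F (l @ [w]) = F (l @ [u 0]) \<star> w"
  shows "rel_homotopy g F (l @ [w]) = rel_homotopy g F (l @ [u 0]) \<star> w"
  using assms
proof (induction l arbitrary: g F)
  case Nil
  then show ?case using Nil [of "[u (- g)]" w] by simp
next
  case (Cons a l)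
  have prem: "F (x # l' @ [z]) = F (x # l' @ [u 0]) \<star> z" for x l' z
    using Cons.prems [of "x # l'" z] by (simp only: append.simps)
  have "rel_homotopy h (\<lambda>l'. F (x # l')) (l @ [w])
      = rel_homotopy h (\<lambda>l'. F (x # l')) (l @ [u 0]) \<star> w" for h x
    by (rule Cons.IH) (rule prem)
  moreover have "F (u (- g) # a # l @ [w]) = F (u (- g) # a # l @ [u 0]) \<star> w"
    using prem [of "u (- g)" "a # l" w] by (simp only: append.simps)
  ultimately show ?case
    by (simp add: avg_linear [OF linear_left] complex_linear_diff [OF linear_left])
qed

text \<open>An n-cochain as a right A-linear function of n + 1 arguments. The additional slot
  receives the group elements that are pushed to the right; when it is filled with
  \<open>u 0\<close>, \<open>rel_conj\<close> produces in it the trailing factor g_n^-1 of the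
  average.\<close>

definition ext_right :: "(('s, 'g) smash list \<Rightarrow> ('s, 'g) smash) \<Rightarrow> ('s, 'g) smash list \<Rightarrow> ('s, 'g) smash" where
  "ext_right f l = f (butlast l) \<star> last l"

definition rel_proj :: "(('s, 'g) smash list \<Rightarrow> ('s, 'g) smash) \<Rightarrow> ('s, 'g) smash list \<Rightarrow> ('s, 'g) smash" where
  "rel_proj f l = avg (\<lambda>g. u g \<star> rel_conj g (ext_right f) (l @ [u 0]))"

lemma ext_right_snoc: "ext_right f (l @ [w]) = ext_right f (l @ [u 0]) \<star> w"
  by (simp add: ext_right_def)

text \<open>The group components travel into the last slot and leave it by right linearity. This is
  the shape of a value of \<open>Theta_star\<close>, so the projection is determined by its
  restriction to S.\<close>

lemma rel_proj_axes: "rel_proj f (axes ps) = restrict_S (rel_proj f) (twist ps) \<star> u (grade ps)"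
  unfolding restrict_S_def rel_proj_def rel_conj_axes
  by (simp add: rel_conj_snoc [OF ext_right_snoc, where w = "u (grade ps)"] mul_unit_right mul_assoc
      avg_linear [OF linear_left])

text \<open>The factor \<open>u (- k)\<close> on the right of the conjugate enters the last slot,
  runs through the list to the left while undoing the action on the entries, and shifts the average
  over \<open>g\<close> when it reaches the front.\<close>

lemma rel_proj_invariant: "cochain_act act k (restrict_S (rel_proj f)) = restrict_S (rel_proj f)"
proof
  fix xs
  let ?F = "ext_right f"
  have *: "rel_conj g ?F (map \<iota> (map (act (- k)) xs) @ [u (- k)])
      = rel_conj (k + g) ?F (map \<iota> xs @ [u 0])" for g
  proof (cases xs)
    case Nil
    have "rel_conj g ?F [u (- k) \<star> u 0] = rel_conj (- (- k) + g) ?F [u 0]"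
      by (rule rel_conj_u_left)
    then show ?thesis by (simp add: Nil mul_unit_right)
  next
    case (Cons x t)
    have "rel_conj g ?F (map \<iota> (map (act (- k)) xs) @ [u (- k)])
        = rel_conj g ?F (\<iota> (act (- k) x) \<star> u (- k) # map \<iota> t @ [u 0])"
      by (simp only: rel_conj_u_iota) (simp add: Cons mul_unit_right)
    also have "\<dots> = rel_conj g ?F (u (- k) \<star> \<iota> x # map \<iota> t @ [u 0])"
      by (simp only: u_iota)
    also have "\<dots> = rel_conj (k + g) ?F (map \<iota> xs @ [u 0])"
      by (simp only: rel_conj_u_left) (simp add: Cons)
    finally show ?thesis .
  qed
  have "cochain_act act k (restrict_S (rel_proj f)) xs
      = avg (\<lambda>g. u k \<star> (u g \<star> (rel_conj g ?F (map \<iota> (map (act (- k)) xs) @ [u 0]) \<star> u (- k))))"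
    by (simp add: cochain_act_def restrict_S_def rel_proj_def smash_conj_eq avg_linear [OF linear_left]
        avg_linear [OF linear_right] mul_assoc del: map_map)
  also have "\<dots> = avg (\<lambda>g. u (k + g) \<star> rel_conj (k + g) ?F (map \<iota> xs @ [u 0]))"
    by (simp only: rel_conj_snoc [OF ext_right_snoc, symmetric] * u_mult)
  also have "\<dots> = restrict_S (rel_proj f) xs"
    by (simp only: avg_shift [of "\<lambda>g. u g \<star> rel_conj g ?F (map \<iota> xs @ [u 0])"])
      (simp add: restrict_S_def rel_proj_def)
  finally show "cochain_act act k (restrict_S (rel_proj f)) xs = restrict_S (rel_proj f) xs" .
qed

text \<open>The merges of \<open>ext_right f\<close> omit the left outer term of the differential.
  For a cocycle they therefore equal that term, and \<open>rel_homotopy_merges\<close> becomes the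
  equation f - d \<eta> = \<open>rel_proj f\<close>. In degree 0 there is no \<eta> and the two
  sides agree.\<close>

lemma rel_proj_cohomologous:
  assumes f: "f \<in> hoch_cocycles (smash_mult act) n"
  shows "\<exists>b \<in> hoch_coboundaries (smash_mult act) n. \<forall>l. length l = n \<longrightarrow> f l = rel_proj f l + b l"
proof -
  let ?F = "ext_right f" and ?M = "merges (smash_mult act)"
  let ?S = "\<lambda>l. avg (\<lambda>g. u g \<star> rel_homotopy g ?F l)"
  have fc: "f \<in> cochains n" and df: "hoch_diff (smash_mult act) n f = (\<lambda>_. 0)"
    using f by (simp_all add: hoch_cocycles_def)
  \<comment> \<open>The cocycle condition: \<open>?M ?F\<close> collects all terms of the
    differential except the left outer one, the right outer term being the last merge of
    \<open>ext_right f\<close>.\<close>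
  have MF: "?M ?F (x # l) = x \<star> ?F l" if "length l = n + 1" for x l
  proof -
    obtain b z where l: "l = b @ [z]" "length b = n"
      using \<open>length l = n + 1\<close> by (cases l rule: rev_cases) auto
    have "x \<star> f b - ?M f (x # b) + deg_sign n *\<^sub>C (f (butlast (x # b)) \<star> last (x # b)) = 0"
      using hoch_diff_Suc [of "x # b" n f] df l by simp
    then have "?M f (x # b) = x \<star> f b + deg_sign n *\<^sub>C (f (butlast (x # b)) \<star> last (x # b))"
      by (simp add: algebra_simps)
    moreover have "?M ?F ((x # b) @ [z]) = ?M f (x # b) \<star> z
        - (- 1) ^ length (x # b) *\<^sub>C (f (butlast (x # b)) \<star> (last (x # b) \<star> z))"
      unfolding ext_right_def [abs_def]
      using merges_snoc [of "smash_mult act" "smash_mult act" f "x # b" z, OF linear_left] by simp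
    ultimately show ?thesis
      using linear_left [of z]
      by (simp add: l ext_right_def complex_linear_def mul_assoc deg_sign_def scaleC_one)
  qed
  have S: "?F (a # l) - a \<star> ?S l + ?M ?S (a # l) = avg (\<lambda>g. u g \<star> rel_conj g ?F (a # l))"
    if "length l = n" for a l
  proof -
    \<comment> \<open>By \<open>MF\<close> the leading \<open>u (- g)\<close> comes out as a left
      factor, and \<open>f\<close> itself appears in the first summand. The outer factor
      \<open>u g\<close> of the average will cancel \<open>u (- g)\<close>.\<close>
    have 1: "rel_homotopy g (?M ?F) (a # l) = u (- g) \<star> (?F (a # l) - a \<star> ?S l)" for g
    proof -
      have "rel_homotopy g (?M ?F) (a # l) = u (- g) \<star> ?F (a # l)
          - avg (\<lambda>h. rel_homotopy h (\<lambda>l'. (u (- g) \<star> a \<star> u h) \<star> ?F l') l)"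
        using MF that by (simp cong: rel_homotopy_cong)
      also have "\<dots> = u (- g) \<star> (?F (a # l) - a \<star> ?S l)"
        by (simp add: rel_homotopy_linear [OF linear_right] complex_linear_diff [OF linear_right]
            avg_linear [OF linear_right] mul_assoc)
      finally show ?thesis .
    qed
    have 2: "?M ?S (a # l) = avg (\<lambda>g. u g \<star> ?M (rel_homotopy g ?F) (a # l))"
      by (simp only: insertions_avg insertions_linear [OF linear_right])
    have "avg (\<lambda>g. u g \<star> rel_conj g ?F (a # l))
        = avg (\<lambda>g. u g \<star> (rel_homotopy g (?M ?F) (a # l) + ?M (rel_homotopy g ?F) (a # l)))"
      using rel_homotopy_merges [of "a # l" _ ?F] by simp
    also have "\<dots> = avg (\<lambda>g. (?F (a # l) - a \<star> ?S l) + u g \<star> ?M (rel_homotopy g ?F) (a # l))"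
      by (simp only: 1 mul_add_right u_mult right_minus mul_unit_left)
    finally show ?thesis by (simp only: 2 avg_add avg_const)
  qed
  show ?thesis
  proof (cases n)
    case 0
    have "f [] = rel_proj f []"
      using S [of "[]" "u 0"] 0 by (simp add: ext_right_def rel_proj_def complex_linear_0 [OF linear_right] merges_simps)
    then show ?thesis using 0 coboundaries_zero by (intro bexI [of _ "\<lambda>_. 0"]) auto
  next
    case (Suc k)
    \<comment> \<open>\<open>?S\<close> is right linear in its last argument, so filling that slot
      with the unit loses nothing and leaves a cochain of one degree less than
      \<open>f\<close>.\<close>
    define \<eta> where "\<eta> l = (if length l = k then ?S (l @ [u 0]) else 0)" for l
    have "multilinear (Suc n) ?F"
      unfolding ext_right_def [abs_def]
      by (intro multilinear_butlast cochains_multilinear [OF fc] linear_left linear_right)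
    then have "multilinear k (\<lambda>l. ?S (l @ [u 0]))"
      unfolding Suc by (intro multilinear_snoc multilinear_avg multilinear_linear [OF _ linear_right]
          multilinear_rel_homotopy)
    then have \<eta>: "\<eta> \<in> cochains k"
      unfolding \<eta>_def by (rule cochains_cut)
    have S\<eta>: "?S (b @ [w]) = \<eta> b \<star> w" if "length b = k" for b w
      using that unfolding \<eta>_def
      by (simp add: rel_homotopy_snoc [OF ext_right_snoc, where w = w] avg_linear [OF linear_left] mul_assoc)
    have "f l = rel_proj f l + hoch_diff (smash_mult act) k \<eta> l" if l: "length l = n" for l
    proof -
      obtain a t where a: "l = a # t" "length t = k" using l Suc by (cases l) auto
      have "?M ?S (l @ [u 0]) = ?M (\<lambda>l. \<eta> (butlast l) \<star> last l) (l @ [u 0])"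
      proof (rule insertions_cong)
        fix l' :: "('s, 'g) smash list"
        assume "length l' + 2 = length (l @ [u 0]) + 1"
        then obtain b w where "l' = b @ [w]" "length b = k"
          using l Suc by (cases l' rule: rev_cases) auto
        then show "?S l' = \<eta> (butlast l') \<star> last l'" by (simp only: S\<eta>) simp
      qed
      also have "\<dots> = ?M \<eta> l - (- 1) ^ n *\<^sub>C (\<eta> (butlast l) \<star> last l)"
        using merges_snoc [of "smash_mult act" "smash_mult act" \<eta> l "u 0", OF linear_left] l Suc
        by (auto simp: mul_unit_right)
      finally have eq: "f l - a \<star> \<eta> t + (?M \<eta> l - (- 1) ^ n *\<^sub>C (\<eta> (butlast l) \<star> last l)) = rel_proj f l"
        using S [of "t @ [u 0]" a] a Suc S\<eta> [OF a(2)]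
        by (simp add: ext_right_def rel_proj_def mul_unit_right)
      have "hoch_diff (smash_mult act) k \<eta> l
          = a \<star> \<eta> t - ?M \<eta> l + (- 1) ^ n *\<^sub>C (\<eta> (butlast l) \<star> last l)"
        using hoch_diff_Suc [of l k \<eta>] l Suc by (simp add: a deg_sign_def)
      then show ?thesis unfolding eq [symmetric] by simp
    qed
    moreover have "hoch_diff (smash_mult act) k \<eta> \<in> hoch_coboundaries (smash_mult act) n"
      using \<eta> Suc by (simp add: hoch_coboundaries_def)
    ultimately show ?thesis by blast
  qed
qed

text \<open>\<open>rel_proj f\<close> is not cut off in other degrees. Taking \<kappa> as the
  restriction of f - b, with b the coboundary from \<open>rel_proj_cohomologous\<close>, gives a
  genuine cochain that agrees with it on lists of length n.\<close>

lemma cocycle_cohomologous_Theta: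
  assumes f: "f \<in> hoch_cocycles (smash_mult act) n"
  obtains \<kappa> where "\<kappa> \<in> cochains n" "\<And>g. cochain_act act g \<kappa> = \<kappa>"
    "f - Theta_star act n \<kappa> \<in> hoch_coboundaries (smash_mult act) n"
proof -
  obtain b where b: "b \<in> hoch_coboundaries (smash_mult act) n"
    and fb: "\<And>l. length l = n \<Longrightarrow> f l = rel_proj f l + b l"
    using rel_proj_cohomologous [OF f] by blast
  have fc: "f \<in> cochains n" and bc: "b \<in> cochains n"
    using f b coboundaries_cocycles cocycles_cochains by blast+
  let ?p = "\<lambda>l. f l - b l"
  have p: "?p \<in> cochains n" by (rule cochains_diff [OF fc bc])
  have pr: "?p l = rel_proj f l" if "length l = n" for l
    using fb [OF that] by simp
  have rp: "restrict_S ?p xs = restrict_S (rel_proj f) xs" if "length xs = n" for xs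
    using pr [of "map \<iota> xs"] that by (simp add: restrict_S_def)
  have rc: "restrict_S ?p \<in> cochains n" by (rule restrict_cochains [OF p])
  have inv: "cochain_act act g (restrict_S ?p) = restrict_S ?p" for g
  proof
    fix xs
    show "cochain_act act g (restrict_S ?p) xs = restrict_S ?p xs"
    proof (cases "length xs = n")
      case True
      have "cochain_act act g (restrict_S ?p) xs = cochain_act act g (restrict_S (rel_proj f)) xs"
        using True by (simp add: cochain_act_def rp)
      then show ?thesis using True by (simp only: rel_proj_invariant rp)
    next
      case False
      then show ?thesis
        using cochains_length [OF rc] cochains_length [OF cochain_act_cochains [OF rc]] by simp
    qed
  qed
  have "Theta_star act n (restrict_S ?p) = ?p"
  proof
    fix l
    show "Theta_star act n (restrict_S ?p) l = ?p l"
    proof (cases "length l = n")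
      case True
      have "Theta_star act n (restrict_S ?p) (axes ps) = ?p (axes ps)" if ps: "length ps = n" for ps
        using ps rel_proj_axes [of f ps] rp [of "twist ps"] pr [of "axes ps"]
        by (simp add: Theta_axes [OF cochains_multilinear [OF rc] ps])
      then show ?thesis
        using multilinear_eq_on_axis [OF _ cochains_multilinear [OF p] _ True]
          cochains_multilinear [OF Theta_cochains [OF cochains_multilinear [OF rc]]] by blast
    next
      case False
      then show ?thesis
        using cochains_length [OF p] by (simp add: Theta_star_def)
    qed
  qed
  then have "f - Theta_star act n (restrict_S ?p) = b"
    by (simp add: fun_eq_iff)
  then show thesis using that [OF rc inv] b by simp
qed

text \<open>After passing to a cohomologous \<open>Theta_star act n \<kappa>\<close>, the cochain
  \<kappa> bounds over S. \<open>Theta_star\<close> carries invariant primitives to primitives, so a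
  primitive is averaged over G beforehand. This is injectivity of restriction on cohomology.\<close>

lemma coboundary_of_restrict:
  assumes f: "f \<in> hoch_cocycles (smash_mult act) n"
    and R: "case n of 0 \<Rightarrow> restrict_S f = (\<lambda>_. 0)
      | Suc k \<Rightarrow> \<exists>\<zeta> \<in> cochains k. restrict_S f = coef_diff k \<zeta>"
  shows "f \<in> hoch_coboundaries (smash_mult act) n"
proof -
  obtain \<kappa> where \<kappa>: "\<kappa> \<in> cochains n" "\<And>g. cochain_act act g \<kappa> = \<kappa>"
    and b: "f - Theta_star act n \<kappa> \<in> hoch_coboundaries (smash_mult act) n"
    using cocycle_cohomologous_Theta [OF f] by metis
  have R\<kappa>: "\<kappa> = restrict_S f - restrict_S (f - Theta_star act n \<kappa>)"
    using restrict_Theta [OF \<kappa>(1)] by (simp add: fun_eq_iff restrict_S_def)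
  have "Theta_star act n \<kappa> \<in> hoch_coboundaries (smash_mult act) n"
  proof (cases n)
    case 0
    have "\<kappa> = (\<lambda>_. 0)"
      using R\<kappa> R b 0 by (simp add: hoch_coboundaries_def restrict_S_def fun_eq_iff)
    then have "Theta_star act n \<kappa> = (\<lambda>_. 0)"
      by (simp add: Theta_star_def fun_eq_iff)
    then show ?thesis using coboundaries_zero by simp
  next
    case (Suc k)
    obtain \<zeta> where \<zeta>: "\<zeta> \<in> cochains k" "restrict_S f = coef_diff k \<zeta>"
      using R Suc by auto
    obtain \<eta> where \<eta>: "\<eta> \<in> cochains k" "f - Theta_star act n \<kappa> = hoch_diff (smash_mult act) k \<eta>"
      using b Suc by (auto simp: hoch_coboundaries_def)
    let ?\<xi> = "\<lambda>l. \<zeta> l + (- 1) *\<^sub>C restrict_S \<eta> l"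
    have \<xi>: "?\<xi> \<in> cochains k"
      by (intro cochains_add cochains_scale \<zeta> restrict_cochains \<eta>)
    have \<kappa>\<xi>: "\<kappa> = coef_diff k ?\<xi>"
      using R\<kappa> \<eta>(2) \<zeta>(2)
      by (simp only: restrict_hoch_diff coef_diff_add coef_diff_scale) (simp add: fun_eq_iff scaleC_one)
    \<comment> \<open>\<kappa> is invariant, so the averaged primitive still bounds it.\<close>
    let ?\<nu> = "\<lambda>l. avg (\<lambda>h. cochain_act act h ?\<xi> l)"
    have \<nu>: "?\<nu> \<in> cochains k"
      by (intro cochains_avg cochain_act_cochains \<xi>)
    have "coef_diff k ?\<nu> = (\<lambda>l. avg (\<lambda>h. cochain_act act h \<kappa> l))"
      by (simp only: coef_diff_avg coef_diff_act flip: \<kappa>\<xi>)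
    then have "coef_diff k ?\<nu> = \<kappa>"
      by (simp add: \<kappa>(2))
    then have "Theta_star act n \<kappa> = hoch_diff (smash_mult act) k (Theta_star act k ?\<nu>)"
      using Theta_coef_diff [OF \<nu> avg_invariant] Suc by simp
    then show ?thesis
      using Theta_cochains [OF cochains_multilinear [OF \<nu>]] Suc
      by (simp add: hoch_coboundaries_def)
  qed
  from coboundaries_add [OF this b] show ?thesis by simp
qed

end

section \<open>Tensor powers\<close>

lemma poly_mapping_induct_keys [consumes 1, case_names zero add]:
  assumes "Poly_Mapping.keys v \<subseteq> K" and "P 0"
    and "\<And>k c v. k \<in> K \<Longrightarrow> Poly_Mapping.keys v \<subseteq> K \<Longrightarrow> P v \<Longrightarrow> P (Poly_Mapping.single k c + v)"
  shows "P (v :: 'k \<Rightarrow>\<^sub>0 'b::comm_monoid_add)"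
proof -
  let ?s = "\<lambda>I. \<Sum>k\<in>I. Poly_Mapping.single k (Poly_Mapping.lookup v k)"
  have "P (?s I) \<and> Poly_Mapping.keys (?s I) \<subseteq> K" if "finite I" "I \<subseteq> Poly_Mapping.keys v" for I
    using that
  proof (induction I rule: finite_induct)
    case empty
    then show ?case using assms(2) by simp
  next
    case (insert k I)
    then have "P (?s I)" "Poly_Mapping.keys (?s I) \<subseteq> K" "k \<in> K" using assms(1) by auto
    moreover have "Poly_Mapping.keys (Poly_Mapping.single k (Poly_Mapping.lookup v k) + ?s I) \<subseteq> K"
      using \<open>k \<in> K\<close> \<open>Poly_Mapping.keys (?s I) \<subseteq> K\<close>
        Poly_Mapping.keys_add [of "Poly_Mapping.single k (Poly_Mapping.lookup v k)" "?s I"]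
      by (auto split: if_splits)
    ultimately show ?case using insert.hyps assms(3) by simp
  qed
  moreover have "?s (Poly_Mapping.keys v) = v"
    by (rule poly_mapping_eqI) (simp add: lookup_sum lookup_single when_def in_keys_iff)
  ultimately show ?thesis by (metis finite_keys order_refl)
qed

lemma abs_tens_add: "abs_tens (v + w) = abs_tens v + abs_tens w"
  by (simp add: plus_tens.abs_eq)

lemma abs_tens_diff: "abs_tens (v - w) = abs_tens v - abs_tens w"
  by (simp add: minus_tens.abs_eq)

lemma abs_tens_0: "abs_tens 0 = 0"
  by (simp add: zero_tens_def)

lemma abs_tens_single: "abs_tens (Poly_Mapping.single xs c) = c *\<^sub>C tensor xs"
  by (simp add: tensor_def scaleC_tens.abs_eq)

lemma abs_tens_eq: "v - w \<in> tens_null \<Longrightarrow> abs_tens v = abs_tens w"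
  by (simp add: tens.abs_eq_iff tens_rel_def)

lemma tensor_add: "tensor (xs @ (x + y) # ys) = tensor (xs @ x # ys) + tensor (xs @ y # ys)"
proof -
  have "abs_tens (Poly_Mapping.single (xs @ (x + y) # ys) 1)
      = abs_tens (Poly_Mapping.single (xs @ x # ys) 1 + Poly_Mapping.single (xs @ y # ys) 1)"
    by (rule abs_tens_eq) (use tens_null_add [of xs x y ys 1] in \<open>simp add: algebra_simps\<close>)
  then show ?thesis by (simp add: abs_tens_add tensor_def)
qed

lemma tensor_scaleC: "tensor (xs @ (c *\<^sub>C x) # ys) = c *\<^sub>C tensor (xs @ x # ys)"
proof -
  have "abs_tens (Poly_Mapping.single (xs @ (c *\<^sub>C x) # ys) 1)
      = abs_tens (Poly_Mapping.single (xs @ x # ys) c)"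
    by (rule abs_tens_eq) (use tens_null_scale [of xs c x ys 1] in simp)
  then show ?thesis by (simp add: abs_tens_single scaleC_one)
qed

lemma tensor_multilinear: "multilinear n tensor"
  by (simp add: multilinear_def tensor_add tensor_scaleC)

lemma tens_power_induct [consumes 1, case_names zero add]:
  assumes "t \<in> tens_power n" "P 0"
    and "\<And>xs c t. length xs = n \<Longrightarrow> t \<in> tens_power n \<Longrightarrow> P t \<Longrightarrow> P (c *\<^sub>C tensor xs + t)"
  shows "P t"
proof -
  obtain v where v: "t = abs_tens v" "Poly_Mapping.keys v \<subseteq> {xs. length xs = n}"
    using assms(1) by (auto simp: tens_power_def)
  from v(2) have "P (abs_tens v)"
  proof (induction rule: poly_mapping_induct_keys)
    case zero
    then show ?case using assms(2) by (simp add: abs_tens_0)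
  next
    case (add xs c v)
    then have "abs_tens v \<in> tens_power n" by (auto simp: tens_power_def)
    then show ?case
      using add assms(3) [of xs "abs_tens v" c] by (simp add: abs_tens_add abs_tens_single)
  qed
  then show ?thesis by (simp add: v)
qed

lemma tens_power_0: "0 \<in> tens_power n"
  by (force simp: tens_power_def abs_tens_0 intro: exI [of _ 0])

lemma tens_power_diff: "s \<in> tens_power n \<Longrightarrow> t \<in> tens_power n \<Longrightarrow> s - t \<in> tens_power n"
  unfolding tens_power_def
proof clarify
  fix v w :: "'a list \<Rightarrow>\<^sub>0 complex"
  assume "Poly_Mapping.keys v \<subseteq> {xs. length xs = n}" "Poly_Mapping.keys w \<subseteq> {xs. length xs = n}"
  then show "\<exists>r. abs_tens v - abs_tens w = abs_tens r \<and> Poly_Mapping.keys r \<subseteq> {xs. length xs = n}"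
    using keys_diff [of v w] by (intro exI [of _ "v - w"]) (auto simp: abs_tens_diff)
qed

lemma tens_power_add: "s \<in> tens_power n \<Longrightarrow> t \<in> tens_power n \<Longrightarrow> s + t \<in> tens_power n"
  using tens_power_diff [OF _ tens_power_diff [OF tens_power_0]] by fastforce

lemma tensor_tens_power: "length xs = n \<Longrightarrow> c *\<^sub>C tensor xs \<in> tens_power n"
  unfolding tens_power_def abs_tens_single [symmetric] by (auto intro!: exI split: if_splits)

lemma tensor_in_tens_power: "length xs = n \<Longrightarrow> tensor xs \<in> tens_power n"
  using tensor_tens_power [of xs n 1] by (simp add: scaleC_one)

lemma tens_eqI:
  assumes "complex_linear L" "complex_linear L'"
    and "\<And>xs. length xs = n \<Longrightarrow> L (tensor xs) = L' (tensor xs)" and "t \<in> tens_power n"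
  shows "L t = L' t"
  using assms(4)
proof (induction rule: tens_power_induct)
  case zero
  then show ?case using assms(1,2) by (simp add: complex_linear_0)
next
  case (add xs c t)
  then show ?case using assms(1-3) by (simp add: complex_linear_def)
qed

lemma tens_eqI_all:
  assumes "complex_linear L" "complex_linear L'" "\<And>xs. L (tensor xs) = L' (tensor xs)"
  shows "L t = L' t"
proof -
  obtain v where t: "t = abs_tens v"
    by (metis Quotient3_abs_rep Quotient3_tens)
  have "Poly_Mapping.keys v \<subseteq> UNIV" by simp
  then have "L (abs_tens v) = L' (abs_tens v)"
  proof (induction rule: poly_mapping_induct_keys)
    case zero
    then show ?case using assms(1,2) by (simp add: abs_tens_0 complex_linear_0)
  next
    case (add xs c v)
    then show ?case using assms by (simp add: abs_tens_add abs_tens_single complex_linear_def)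
  qed
  then show ?thesis by (simp add: t)
qed

lemma tens_power_mapsto:
  assumes "complex_linear L" and "\<And>xs. length xs = n \<Longrightarrow> L (tensor xs) \<in> tens_power k"
    and "t \<in> tens_power n"
  shows "L t \<in> tens_power k"
  using assms(3)
proof (induction rule: tens_power_induct)
  case zero
  then show ?case using assms(1) by (simp add: complex_linear_0 tens_power_0)
next
  case (add xs c t)
  have scale: "c *\<^sub>C r \<in> tens_power k" if "r \<in> tens_power k" for r :: "'b tens"
    using that
    by (induction rule: tens_power_induct)
      (simp_all add: tens_power_0 scaleC_add_right scaleC_scaleC tens_power_add tensor_tens_power)
  show ?case
    using add assms(1,2) scale by (simp add: complex_linear_def tens_power_add)
qed

lemma tens_lift_linear:
  assumes F: "\<And>n. multilinear n F"
  shows "complex_linear (tens_lift F)"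
  unfolding complex_linear_def
proof (intro conjI allI)
  fix s t :: "'a tens" and c
  obtain v w where vw: "s = abs_tens v" "t = abs_tens w"
    by (metis Quotient3_abs_rep Quotient3_tens)
  have "s + t = abs_tens (v - (0 - w))"
    by (simp add: vw flip: abs_tens_add)
  then show "tens_lift F (s + t) = tens_lift F s + tens_lift F t"
    using free_lift_diff [of F 0 0] by (simp add: tens_lift_abs [OF F] vw free_lift_diff del: diff_0)
  have "free_lift F (Poly_Mapping.map ((*) c) v) = c *\<^sub>C free_lift F v"
  proof -
    have "Poly_Mapping.keys (Poly_Mapping.map ((*) c) v) \<subseteq> Poly_Mapping.keys v"
      by (auto simp: in_keys_iff map.rep_eq when_def)
    then have "free_lift F (Poly_Mapping.map ((*) c) v)
        = (\<Sum>xs\<in>Poly_Mapping.keys v. Poly_Mapping.lookup (Poly_Mapping.map ((*) c) v) xs *\<^sub>C F xs)"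
      by (rule free_lift_superset [OF finite_keys])
    also have "\<dots> = (\<Sum>xs\<in>Poly_Mapping.keys v. c *\<^sub>C Poly_Mapping.lookup v xs *\<^sub>C F xs)"
      by (rule sum.cong) (simp_all add: map.rep_eq when_def scaleC_scaleC)
    finally show ?thesis by (simp add: free_lift_def cvec.scale_sum_right)
  qed
  then show "tens_lift F (c *\<^sub>C s) = c *\<^sub>C tens_lift F s"
    by (simp add: tens_lift_abs [OF F] vw scaleC_tens.abs_eq)
qed

lemma multilinear_all_CaseI:
  assumes "\<And>x l. F (x # l) = G x l" and "\<And>l. complex_linear (\<lambda>x. G x l)" and "\<And>x n. multilinear n (G x)"
  shows "multilinear n F"
  using assms by (cases n) (simp_all add: multilinear_0 multilinear_Suc)

lemma complex_linear_comp: "complex_linear L \<Longrightarrow> complex_linear L' \<Longrightarrow> complex_linear (\<lambda>x. L (L' x))"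
  by (simp add: complex_linear_def)

lemma complex_linear_mult_left: "complex_linear (\<lambda>x. (s::'s::complex_algebra) * x)"
  by (simp add: complex_linear_def distrib_left mult_scaleC_right)

lemma complex_linear_mult_right: "complex_linear (\<lambda>x. x * (s::'s::complex_algebra))"
  by (simp add: complex_linear_def distrib_right mult_scaleC_left)

lemma complex_linear_tensor_Cons: "complex_linear (\<lambda>x. tensor (x # l))"
  by (rule multilinear_head [OF tensor_multilinear refl])

lemma tens_lmul_multilinear:
  "multilinear n (\<lambda>xs. if xs = [] then 0 else tensor ((s * hd xs) # tl (xs :: 's::complex_algebra list)))"
proof (rule multilinear_all_CaseI)
  show "complex_linear (\<lambda>x. tensor ((s * x) # l))" for l
    using complex_linear_tensor_Cons [of l] complex_linear_mult_left [of s]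
    by (simp add: complex_linear_def)
  show "multilinear n (\<lambda>l. tensor ((s * x) # l))" for x n
    by (rule multilinear_Cons [OF tensor_multilinear])
qed simp

lemma multilinear_map_last:
  assumes "multilinear n f" "complex_linear L"
  shows "multilinear n (\<lambda>l. if l = [] then 0 else f (butlast l @ [L (last l)]))"
  unfolding multilinear_def
proof (intro conjI allI impI)
  fix xs ys :: "'a list" and x y c
  assume len: "length xs + length ys + 1 = n"
  let ?g = "\<lambda>l. if l = [] then 0 else f (butlast l @ [L (last l)])"
  show "?g (xs @ (x + y) # ys) = ?g (xs @ x # ys) + ?g (xs @ y # ys)"
    using assms len by (cases ys rule: rev_cases)
      (simp_all add: butlast_append multilinear_def complex_linear_def)
  show "?g (xs @ (c *\<^sub>C x) # ys) = c *\<^sub>C ?g (xs @ x # ys)"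
    using assms len by (cases ys rule: rev_cases)
      (simp_all add: butlast_append multilinear_def complex_linear_def)
qed

lemma tens_rmul_multilinear:
  "multilinear n (\<lambda>xs. if xs = [] then 0 else tensor (butlast xs @ [last xs * (s :: 's::complex_algebra)]))"
  by (rule multilinear_map_last [where L = "\<lambda>x. x * s", OF tensor_multilinear complex_linear_mult_right])

lemma tens_lmul_tensor: "tens_lmul s (tensor (x # l)) = tensor ((s * x) # l)"
  by (simp add: tens_lmul_def tens_lift_tensor [OF tens_lmul_multilinear])

lemma tens_rmul_tensor: "tens_rmul (tensor (l @ [x])) s = tensor (l @ [x * s])"
  by (simp add: tens_rmul_def tens_lift_tensor [OF tens_rmul_multilinear])

lemma tens_lmul_linear: "complex_linear (tens_lmul s)"
  unfolding tens_lmul_def by (rule tens_lift_linear [OF tens_lmul_multilinear])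

lemma tens_rmul_linear: "complex_linear (\<lambda>t. tens_rmul t s)"
  unfolding tens_rmul_def by (rule tens_lift_linear [OF tens_rmul_multilinear])

lemma tens_lmul_nil: "tens_lmul s (tensor []) = 0"
  by (simp add: tens_lmul_def tens_lift_tensor [OF tens_lmul_multilinear])

lemma tens_rmul_nil: "tens_rmul (tensor []) s = 0"
  by (simp add: tens_rmul_def tens_lift_tensor [OF tens_rmul_multilinear])

lemma complex_linear_plus: "complex_linear L \<Longrightarrow> complex_linear L' \<Longrightarrow> complex_linear (\<lambda>x. L x + L' x)"
  by (simp add: complex_linear_def scaleC_add_right)

lemma complex_linear_scale: "complex_linear L \<Longrightarrow> complex_linear (\<lambda>x. c *\<^sub>C L x)"
  by (rule complex_linear_comp [OF complex_linear_scaleC])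

lemma tens_lmul_linear_left: "complex_linear (\<lambda>s. tens_lmul s t)"
  unfolding complex_linear_def
proof (intro conjI allI)
  fix a b :: 'a and c
  show "tens_lmul (a + b) t = tens_lmul a t + tens_lmul b t"
  proof (rule tens_eqI_all [of "tens_lmul (a + b)"])
    show "tens_lmul (a + b) (tensor xs) = tens_lmul a (tensor xs) + tens_lmul b (tensor xs)" for xs
      using complex_linear_tensor_Cons [of "tl xs"]
      by (cases xs) (simp_all add: tens_lmul_nil tens_lmul_tensor distrib_right complex_linear_def)
  qed (intro complex_linear_plus tens_lmul_linear)+
  show "tens_lmul (c *\<^sub>C a) t = c *\<^sub>C tens_lmul a t"
  proof (rule tens_eqI_all [of "tens_lmul (c *\<^sub>C a)"])
    show "tens_lmul (c *\<^sub>C a) (tensor xs) = c *\<^sub>C tens_lmul a (tensor xs)" for xs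
      using complex_linear_tensor_Cons [of "tl xs"]
      by (cases xs) (simp_all add: tens_lmul_nil tens_lmul_tensor mult_scaleC_left complex_linear_def)
  qed (intro complex_linear_scale tens_lmul_linear)+
qed

lemma complex_linear_tensor_snoc: "complex_linear (\<lambda>x. tensor (l @ [x]))"
  by (simp add: complex_linear_def tensor_add tensor_scaleC)

lemma tens_rmul_linear_right: "complex_linear (tens_rmul t)"
  unfolding complex_linear_def
proof (intro conjI allI)
  fix a b :: 'a and c
  show "tens_rmul t (a + b) = tens_rmul t a + tens_rmul t b"
  proof (rule tens_eqI_all [of "\<lambda>t. tens_rmul t (a + b)"])
    show "tens_rmul (tensor xs) (a + b) = tens_rmul (tensor xs) a + tens_rmul (tensor xs) b" for xs
      using complex_linear_tensor_snoc [of "butlast xs"]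
      by (cases xs rule: rev_cases)
        (simp_all add: tens_rmul_nil tens_rmul_tensor distrib_left complex_linear_def)
  qed (intro complex_linear_plus tens_rmul_linear)+
  show "tens_rmul t (c *\<^sub>C a) = c *\<^sub>C tens_rmul t a"
  proof (rule tens_eqI_all [of "\<lambda>t. tens_rmul t (c *\<^sub>C a)"])
    show "tens_rmul (tensor xs) (c *\<^sub>C a) = c *\<^sub>C tens_rmul (tensor xs) a" for xs
      using complex_linear_tensor_snoc [of "butlast xs"]
      by (cases xs rule: rev_cases)
        (simp_all add: tens_rmul_nil tens_rmul_tensor mult_scaleC_right complex_linear_def)
  qed (intro complex_linear_scale tens_rmul_linear)+
qed

lemma tens_mul_add:
  "tens_lmul s (t + t') = tens_lmul s t + tens_lmul s t'"
  "tens_rmul (t + t') s = tens_rmul t s + tens_rmul t' s"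
  "tens_lmul (s + s') t = tens_lmul s t + tens_lmul s' t"
  "tens_rmul t (s + s') = tens_rmul t s + tens_rmul t s'"
  using tens_lmul_linear [of s] tens_rmul_linear [of s] tens_lmul_linear_left [of t]
    tens_rmul_linear_right [of t] by (simp_all add: complex_linear_def)

lemma tens_mul_scaleC:
  "tens_lmul s (c *\<^sub>C t) = c *\<^sub>C tens_lmul s t"
  "tens_rmul (c *\<^sub>C t) s = c *\<^sub>C tens_rmul t s"
  "tens_lmul (c *\<^sub>C s) t = c *\<^sub>C tens_lmul s t"
  "tens_rmul t (c *\<^sub>C s) = c *\<^sub>C tens_rmul t s"
  using tens_lmul_linear [of s] tens_rmul_linear [of s] tens_lmul_linear_left [of t]
    tens_rmul_linear_right [of t] by (simp_all add: complex_linear_def)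

lemma tens_lmul_power: "t \<in> tens_power (Suc n) \<Longrightarrow> tens_lmul s t \<in> tens_power (Suc n)"
  by (rule tens_power_mapsto [OF tens_lmul_linear])
    (auto simp: length_Suc_conv tens_lmul_tensor intro!: tensor_in_tens_power)

lemma tens_rmul_power:
  assumes "t \<in> tens_power (Suc n)"
  shows "tens_rmul t s \<in> tens_power (Suc n)"
proof (rule tens_power_mapsto [OF tens_rmul_linear _ assms])
  fix xs :: "'a list"
  assume "length xs = Suc n"
  then show "tens_rmul (tensor xs) s \<in> tens_power (Suc n)"
    by (cases xs rule: rev_cases) (auto simp: tens_rmul_tensor intro!: tensor_in_tens_power)
qed


section \<open>Bimodules\<close>

lemma bimodule_zero: "bimodule M \<Longrightarrow> 0 \<in> bcarrier M"
  and bimodule_diff: "bimodule M \<Longrightarrow> x \<in> bcarrier M \<Longrightarrow> y \<in> bcarrier M \<Longrightarrow> x - y \<in> bcarrier M"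
  and bimodule_lmul: "bimodule M \<Longrightarrow> x \<in> bcarrier M \<Longrightarrow> lmul M s x \<in> bcarrier M"
  and bimodule_rmul: "bimodule M \<Longrightarrow> x \<in> bcarrier M \<Longrightarrow> rmul M x s \<in> bcarrier M"
  and lmul_add: "bimodule M \<Longrightarrow> x \<in> bcarrier M \<Longrightarrow> y \<in> bcarrier M \<Longrightarrow> lmul M s (x + y) = lmul M s x + lmul M s y"
  and rmul_add: "bimodule M \<Longrightarrow> x \<in> bcarrier M \<Longrightarrow> y \<in> bcarrier M \<Longrightarrow> rmul M (x + y) s = rmul M x s + rmul M y s"
  and add_lmul: "bimodule M \<Longrightarrow> x \<in> bcarrier M \<Longrightarrow> lmul M (s + t) x = lmul M s x + lmul M t x"
  and add_rmul: "bimodule M \<Longrightarrow> x \<in> bcarrier M \<Longrightarrow> rmul M x (s + t) = rmul M x s + rmul M x t"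
  and mult_lmul: "bimodule M \<Longrightarrow> x \<in> bcarrier M \<Longrightarrow> lmul M (s * t) x = lmul M s (lmul M t x)"
  and mult_rmul: "bimodule M \<Longrightarrow> x \<in> bcarrier M \<Longrightarrow> rmul M x (s * t) = rmul M (rmul M x s) t"
  and lmul_rmul: "bimodule M \<Longrightarrow> x \<in> bcarrier M \<Longrightarrow> lmul M s (rmul M x t) = rmul M (lmul M s x) t"
  and one_lmul: "bimodule M \<Longrightarrow> x \<in> bcarrier M \<Longrightarrow> lmul M 1 x = x"
  and one_rmul: "bimodule M \<Longrightarrow> x \<in> bcarrier M \<Longrightarrow> rmul M x 1 = x"
  and scalar_lmul: "bimodule M \<Longrightarrow> x \<in> bcarrier M \<Longrightarrow> lmul M (c *\<^sub>C 1) x = rmul M x (c *\<^sub>C 1)"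
  by (simp_all add: bimodule_def)

lemma bimodule_add:
  assumes "bimodule M" "x \<in> bcarrier M" "y \<in> bcarrier M"
  shows "x + y \<in> bcarrier M"
  using bimodule_diff [OF assms(1,2) bimodule_diff [OF assms(1) bimodule_zero [OF assms(1)] assms(3)]] by simp

lemma bimodule_sum:
  "bimodule M \<Longrightarrow> (\<And>i. i \<in> I \<Longrightarrow> f i \<in> bcarrier M) \<Longrightarrow> (\<Sum>i\<in>I. f i) \<in> bcarrier M"
  by (induction I rule: infinite_finite_induct) (simp_all add: bimodule_zero bimodule_add)

lemma lmul_0: "bimodule M \<Longrightarrow> lmul M s 0 = 0"
  using lmul_add [of M 0 0 s] by (simp add: bimodule_zero)

lemma rmul_0: "bimodule M \<Longrightarrow> rmul M 0 s = 0"
  using rmul_add [of M 0 0 s] by (simp add: bimodule_zero)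

lemma zero_lmul: "bimodule M \<Longrightarrow> x \<in> bcarrier M \<Longrightarrow> lmul M 0 x = 0"
  using add_lmul [of M x 0 0] by simp

lemma lmul_diff:
  assumes "bimodule M" "x \<in> bcarrier M" "y \<in> bcarrier M"
  shows "lmul M s (x - y) = lmul M s x - lmul M s y"
  using lmul_add [OF assms(1) bimodule_diff [OF assms] assms(3), of s] by simp

lemma rmul_diff:
  assumes "bimodule M" "x \<in> bcarrier M" "y \<in> bcarrier M"
  shows "rmul M (x - y) s = rmul M x s - rmul M y s"
  using rmul_add [OF assms(1) bimodule_diff [OF assms] assms(3), of s] by simp

lemma lmul_sum:
  "bimodule M \<Longrightarrow> (\<And>i. i \<in> I \<Longrightarrow> f i \<in> bcarrier M) \<Longrightarrow> lmul M s (\<Sum>i\<in>I. f i) = (\<Sum>i\<in>I. lmul M s (f i))"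
  by (induction I rule: infinite_finite_induct) (simp_all add: lmul_0 lmul_add bimodule_sum)

lemma rmul_sum:
  "bimodule M \<Longrightarrow> (\<And>i. i \<in> I \<Longrightarrow> f i \<in> bcarrier M) \<Longrightarrow> rmul M (\<Sum>i\<in>I. f i) s = (\<Sum>i\<in>I. rmul M (f i) s)"
  by (induction I rule: infinite_finite_induct) (simp_all add: rmul_0 rmul_add bimodule_sum)

lemma bimod_hom_mem: "bimod_hom M N f \<Longrightarrow> x \<in> bcarrier M \<Longrightarrow> f x \<in> bcarrier N"
  and bimod_hom_add: "bimod_hom M N f \<Longrightarrow> x \<in> bcarrier M \<Longrightarrow> y \<in> bcarrier M \<Longrightarrow> f (x + y) = f x + f y"
  and bimod_hom_lmul: "bimod_hom M N f \<Longrightarrow> x \<in> bcarrier M \<Longrightarrow> f (lmul M s x) = lmul N s (f x)"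
  and bimod_hom_rmul: "bimod_hom M N f \<Longrightarrow> x \<in> bcarrier M \<Longrightarrow> f (rmul M x s) = rmul N (f x) s"
  by (simp_all add: bimod_hom_def)

lemma bimod_hom_0: "bimodule M \<Longrightarrow> bimod_hom M N f \<Longrightarrow> f 0 = 0"
  using bimod_hom_add [of M N f 0 0] by (simp add: bimodule_zero)

lemma bimod_hom_diff:
  assumes "bimodule M" "bimod_hom M N f" "x \<in> bcarrier M" "y \<in> bcarrier M"
  shows "f (x - y) = f x - f y"
  using bimod_hom_add [OF assms(2) bimodule_diff [OF assms(1,3,4)] assms(4)] by simp

lemma bimod_hom_sum:
  "bimodule M \<Longrightarrow> bimod_hom M N f \<Longrightarrow> (\<And>i. i \<in> I \<Longrightarrow> x i \<in> bcarrier M)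
    \<Longrightarrow> f (\<Sum>i\<in>I. x i) = (\<Sum>i\<in>I. f (x i))"
  by (induction I rule: infinite_finite_induct) (simp_all add: bimod_hom_0 bimod_hom_add bimodule_sum)

lemma bimod_hom_comp:
  "bimod_hom M N f \<Longrightarrow> bimod_hom N K g \<Longrightarrow> bimod_hom M K (\<lambda>x. g (f x))"
  by (simp add: bimod_hom_def)

lemma bimod_hom_minus:
  assumes "bimodule N" "bimod_hom M N f" "bimod_hom M N g"
  shows "bimod_hom M N (\<lambda>x. f x - g x)"
  using assms by (simp add: bimod_hom_def bimodule_diff lmul_diff rmul_diff)

text \<open>The exponent is positive because both multiplications send the empty tensor to 0, so
  that 1 would not act as the identity on the tensor power of exponent 0.\<close>

lemma bimodule_tens: "bimodule (tens_bimod (Suc n))"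
proof -
  have l: "length xs = Suc n \<Longrightarrow> \<exists>x l. xs = x # l" and r: "length xs = Suc n \<Longrightarrow> \<exists>x l. xs = l @ [x]"
    for xs :: "'a list"
    by (cases xs; simp) (cases xs rule: rev_cases; simp)
  have 1: "tens_lmul (s * s') t = tens_lmul s (tens_lmul s' t)" if "t \<in> tens_power (Suc n)" for s s' and t :: "'a tens"
  proof (rule tens_eqI [OF tens_lmul_linear complex_linear_comp [OF tens_lmul_linear tens_lmul_linear] _ that])
    fix xs :: "'a list" assume "length xs = Suc n"
    then obtain x k where xs: "xs = x # k" using l by blast
    show "tens_lmul (s * s') (tensor xs) = tens_lmul s (tens_lmul s' (tensor xs))"
      by (simp add: xs tens_lmul_tensor mult.assoc)
  qed
  have 2: "tens_rmul t (s * s') = tens_rmul (tens_rmul t s) s'" if "t \<in> tens_power (Suc n)" for s s' and t :: "'a tens"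
  proof (rule tens_eqI [OF tens_rmul_linear complex_linear_comp [OF tens_rmul_linear tens_rmul_linear] _ that])
    fix xs :: "'a list" assume "length xs = Suc n"
    then obtain x k where xs: "xs = k @ [x]" using r by blast
    show "tens_rmul (tensor xs) (s * s') = tens_rmul (tens_rmul (tensor xs) s) s'"
      by (simp add: xs tens_rmul_tensor mult.assoc)
  qed
  have 3: "tens_lmul 1 t = t" "tens_rmul t 1 = t" if "t \<in> tens_power (Suc n)" for t :: "'a tens"
  proof -
    have id: "complex_linear (\<lambda>t :: 'a tens. t)" by (simp add: complex_linear_def)
    show "tens_lmul 1 t = t"
      by (rule tens_eqI [OF tens_lmul_linear id _ that]) (auto dest: l simp: tens_lmul_tensor)
    show "tens_rmul t 1 = t"
      by (rule tens_eqI [OF tens_rmul_linear id _ that]) (auto dest: r simp: tens_rmul_tensor)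
  qed
  have 4: "tens_lmul s (tens_rmul t s') = tens_rmul (tens_lmul s t) s'" if "t \<in> tens_power (Suc n)"
    for s s' and t :: "'a tens"
  proof (rule tens_eqI [OF complex_linear_comp [OF tens_lmul_linear tens_rmul_linear]
        complex_linear_comp [OF tens_rmul_linear tens_lmul_linear] _ that])
    fix xs :: "'a list" assume "length xs = Suc n"
    then obtain x k where xs: "xs = x # k" using l by blast
    show "tens_lmul s (tens_rmul (tensor xs) s') = tens_rmul (tens_lmul s (tensor xs)) s'"
    proof (cases k rule: rev_cases)
      case Nil
      then show ?thesis
        using tens_rmul_tensor [of "[] :: 'a list"] by (simp add: xs tens_lmul_tensor mult.assoc)
    next
      case (snoc k' z)
      then show ?thesis
        using tens_rmul_tensor [of "_ # k'"] by (simp add: xs tens_lmul_tensor)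
    qed
  qed
  show ?thesis
    by (simp add: bimodule_def tens_bimod_def tens_power_0 tens_power_diff tens_lmul_power tens_rmul_power
        tens_mul_add tens_mul_scaleC 1 2 3 4)
qed

section \<open>Lifting along projective bimodules\<close>

text \<open>The bimodule homomorphism \<open>S \<otimes> S \<rightarrow> N\<close> with \<open>1 \<otimes> 1 \<mapsto> \<nu>\<close>. The target is only an additive group,
  so the scalars of a representative are absorbed into the left factor.\<close>

definition free_ext :: "('s::complex_algebra, 'n::ab_group_add) bimod \<Rightarrow> 'n \<Rightarrow> ('s list \<Rightarrow>\<^sub>0 complex) \<Rightarrow> 'n" where
  "free_ext N \<nu> v = (\<Sum>xs\<in>Poly_Mapping.keys v. if length xs = 2
     then lmul N (Poly_Mapping.lookup v xs *\<^sub>C (xs ! 0)) (rmul N \<nu> (xs ! 1)) else 0)"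

definition tens_ext :: "('s::complex_algebra, 'n::ab_group_add) bimod \<Rightarrow> 'n \<Rightarrow> 's tens \<Rightarrow> 'n" where
  "tens_ext N \<nu> t = free_ext N \<nu> (rep_tens t)"

context
  fixes N :: "('s::complex_algebra, 'n::ab_group_add) bimod" and \<nu> :: 'n
  assumes N: "bimodule N" and \<nu>: "\<nu> \<in> bcarrier N"
begin

lemma free_ext_add: "free_ext N \<nu> (v + w) = free_ext N \<nu> v + free_ext N \<nu> w"
  unfolding free_ext_def
  by (rule setsum_keys_plus_distrib)
    (simp_all add: zero_lmul bimodule_rmul N \<nu> scaleC_add_left add_lmul)

lemma free_ext_diff: "free_ext N \<nu> (v - w) = free_ext N \<nu> v - free_ext N \<nu> w"
  using free_ext_add [of "v - w" w] by simp

lemma free_ext_single: "free_ext N \<nu> (Poly_Mapping.single xs c)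
    = (if length xs = 2 then lmul N (c *\<^sub>C (xs ! 0)) (rmul N \<nu> (xs ! 1)) else 0)"
  by (simp add: free_ext_def zero_lmul bimodule_rmul N \<nu>)

text \<open>The left and right actions of c 1 agree in a bimodule. This moves a scalar from the
  right factor to the left one, where \<open>free_ext\<close> keeps all scalars.\<close>

lemma rmul_scaleC: "rmul N x (b *\<^sub>C s) = lmul N (b *\<^sub>C 1) (rmul N x s)" if "x \<in> bcarrier N"
proof -
  have "rmul N x (s * (b *\<^sub>C 1)) = rmul N (rmul N x s) (b *\<^sub>C 1)"
    by (rule mult_rmul [OF N that])
  then show ?thesis
    by (simp add: mult_scaleC_right scalar_lmul [OF N bimodule_rmul [OF N that]])
qed

lemma free_ext_null: "v \<in> tens_null \<Longrightarrow> free_ext N \<nu> v = 0"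
proof (induction rule: tens_null.induct)
  case tens_null_zero
  then show ?case by (simp add: free_ext_def)
next
  case (tens_null_diff v w)
  then show ?case by (simp add: free_ext_diff)
next
  case (tens_null_add xs x y ys c)
  have "xs = [] \<and> (\<exists>b. ys = [b]) \<or> (\<exists>a. xs = [a]) \<and> ys = []" if "length xs + length ys = 1"
    using that by (cases xs; cases ys) auto
  then show ?case
    by (auto simp: free_ext_diff free_ext_single scaleC_add_right add_lmul add_rmul lmul_add
        bimodule_rmul N \<nu>)
next
  case (tens_null_scale xs b x ys c)
  have "xs = [] \<and> (\<exists>b. ys = [b]) \<or> (\<exists>a. xs = [a]) \<and> ys = []" if "length xs + length ys = 1"
    using that by (cases xs; cases ys) auto
  moreover have "lmul N (c *\<^sub>C a) (rmul N \<nu> (b *\<^sub>C x)) = lmul N ((b * c) *\<^sub>C a) (rmul N \<nu> x)" for a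
  proof -
    have "lmul N (c *\<^sub>C a) (lmul N (b *\<^sub>C 1) (rmul N \<nu> x)) = lmul N ((c *\<^sub>C a) * (b *\<^sub>C 1)) (rmul N \<nu> x)"
      by (rule mult_lmul [symmetric]) (simp_all add: N \<nu> bimodule_rmul)
    then show ?thesis
      by (simp add: rmul_scaleC [OF \<nu>] mult_scaleC_right scaleC_scaleC mult.commute)
  qed
  ultimately show ?case
    by (auto simp: free_ext_diff free_ext_single scaleC_scaleC mult.commute)
qed

lemma tens_ext_abs: "tens_ext N \<nu> (abs_tens v) = free_ext N \<nu> v"
proof -
  have "tens_rel (rep_tens (abs_tens v)) v"
    by (simp add: tens.abs_eq_iff [symmetric] Quotient3_abs_rep [OF Quotient3_tens])
  then show ?thesis
    using free_ext_null free_ext_diff unfolding tens_ext_def tens_rel_def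
    by (metis eq_iff_diff_eq_0)
qed

lemma tens_ext_add: "tens_ext N \<nu> (s + t) = tens_ext N \<nu> s + tens_ext N \<nu> t"
proof -
  obtain v w where "s = abs_tens v" "t = abs_tens w"
    by (metis Quotient3_abs_rep Quotient3_tens)
  then show ?thesis
    by (simp add: tens_ext_abs free_ext_add flip: abs_tens_add)
qed

lemma tens_ext_0: "tens_ext N \<nu> 0 = 0"
  using tens_ext_add [of 0 0] by simp

lemma tens_ext_tensor: "tens_ext N \<nu> (c *\<^sub>C tensor [x, y]) = lmul N (c *\<^sub>C x) (rmul N \<nu> y)"
  by (simp add: tens_ext_abs free_ext_single flip: abs_tens_single)

lemma tens_ext_hom: "bimod_hom (tens_bimod 2) N (tens_ext N \<nu>)"
proof -
  have 2: "length xs = 2 \<longleftrightarrow> (\<exists>x y. xs = [x, y])" for xs :: "'s list"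
    by (auto simp: eval_nat_numeral length_Suc_conv)
  have "tens_ext N \<nu> t \<in> bcarrier N
    \<and> (\<forall>s. tens_ext N \<nu> (tens_lmul s t) = lmul N s (tens_ext N \<nu> t)
        \<and> tens_ext N \<nu> (tens_rmul t s) = rmul N (tens_ext N \<nu> t) s)"
    if "t \<in> tens_power 2" for t
    using that
  proof (induction rule: tens_power_induct)
    case zero
    then show ?case
      by (simp add: tens_ext_0 bimodule_zero N lmul_0 rmul_0 complex_linear_0 [OF tens_lmul_linear]
          complex_linear_0 [OF tens_rmul_linear])
  next
    case (add xs c t)
    then obtain x y where xs: "xs = [x, y]" by (auto simp: 2)
    have "tens_rmul (tensor [x, y]) s = tensor [x, y * s]" for s
      using tens_rmul_tensor [of "[x]"] by simp
    moreover have "lmul N (c *\<^sub>C (s * x)) z = lmul N s (lmul N (c *\<^sub>C x) z)" if "z \<in> bcarrier N" for s z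
      using mult_lmul [OF N that, of s "c *\<^sub>C x"] by (simp add: mult_scaleC_right)
    ultimately show ?case
      using add
      by (simp add: xs tens_ext_add tens_ext_tensor tens_mul_add tens_mul_scaleC tens_lmul_tensor
          bimodule_add bimodule_lmul bimodule_rmul N \<nu> lmul_add rmul_add mult_rmul lmul_rmul)
  qed
  then show ?thesis
    by (simp add: bimod_hom_def tens_bimod_def tens_ext_add)
qed

end

lemma lookup_map_0: "f 0 = 0 \<Longrightarrow> Poly_Mapping.lookup (Poly_Mapping.map f v) k = f (Poly_Mapping.lookup v k)"
  by (simp add: map.rep_eq when_def)

lemma tens_bimod_simps [simp]:
  "bcarrier (tens_bimod n) = tens_power n" "lmul (tens_bimod n) = tens_lmul"
  "rmul (tens_bimod n) = tens_rmul"
  by (simp_all add: tens_bimod_def)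

lemma free_bimod_lookup:
  "Poly_Mapping.lookup (lmul free_bimod s v) i = tens_lmul s (Poly_Mapping.lookup v i)"
  "Poly_Mapping.lookup (rmul free_bimod v s) i = tens_rmul (Poly_Mapping.lookup v i) s"
  by (simp_all add: free_bimod_def lookup_map_0 complex_linear_0 [OF tens_lmul_linear]
      complex_linear_0 [OF tens_rmul_linear])

lemma bimodule_free: "bimodule (free_bimod :: ('s::complex_algebra, 'i \<Rightarrow>\<^sub>0 's tens) bimod)"
proof -
  have T: "bimodule (tens_bimod 2 :: ('s, 's tens) bimod)"
    using bimodule_tens [of 1] by (simp add: numeral_2_eq_2)
  have c: "v \<in> bcarrier free_bimod \<longleftrightarrow> (\<forall>i. Poly_Mapping.lookup v i \<in> bcarrier (tens_bimod 2))"
    for v :: "'i \<Rightarrow>\<^sub>0 's tens"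
    by (simp add: free_bimod_def)
  show ?thesis
    using T unfolding bimodule_def
    by (auto simp: c poly_mapping_eq_iff fun_eq_iff free_bimod_lookup lookup_add lookup_minus)
qed

text \<open>Preimages under \<open>g\<close> are chosen for the images of the basis elements of the
  free module. The resulting homomorphism on the free module, composed with \<open>i\<close>, is the
  lift, because r (i x) = x.\<close>

lemma projective_lift:
  fixes M :: "('s::complex_algebra, 'm::ab_group_add) bimod"
    and N :: "('s, 'n::ab_group_add) bimod" and K :: "('s, 'k::ab_group_add) bimod"
  assumes M: "projective_bimod M" and N: "bimodule N" and K: "bimodule K"
    and g: "bimod_hom N K g" and f: "bimod_hom M K f"
    and sub: "f ` bcarrier M \<subseteq> g ` bcarrier N"
  shows "\<exists>h. bimod_hom M N h \<and> (\<forall>x\<in>bcarrier M. g (h x) = f x)"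
proof -
  let ?F = "free_bimod :: ('s, 'm \<Rightarrow>\<^sub>0 's tens) bimod"
  obtain i :: "'m \<Rightarrow> 'm \<Rightarrow>\<^sub>0 's tens" and r where i: "bimod_hom M ?F i" and r: "bimod_hom ?F M r"
    and ri: "\<And>x. x \<in> bcarrier M \<Longrightarrow> r (i x) = x"
    using M by (auto simp: projective_bimod_def)
  have T: "bimodule (tens_bimod 2 :: ('s, 's tens) bimod)"
    using bimodule_tens [of 1] by (simp add: numeral_2_eq_2)
  note fr = bimod_hom_comp [OF r f]
  have F: "v \<in> bcarrier ?F \<longleftrightarrow> (\<forall>j. Poly_Mapping.lookup v j \<in> tens_power 2)" for v
    by (simp add: free_bimod_def)
  have single: "Poly_Mapping.single j t \<in> bcarrier ?F" if "t \<in> tens_power 2" for j t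
    using that by (simp add: F lookup_single when_def tens_power_0)
  define e where "e j = Poly_Mapping.single j (tensor [1, 1 :: 's])" for j :: 'm
  have e: "e j \<in> bcarrier ?F" for j
    by (simp add: e_def single tensor_in_tens_power)
  have "\<forall>j. \<exists>n\<in>bcarrier N. g n = f (r (e j))"
    using sub bimod_hom_mem [OF r e] by (metis (no_types, lifting) image_iff image_subset_iff)
  then obtain \<nu> where \<nu>: "\<And>j. \<nu> j \<in> bcarrier N" "\<And>j. g (\<nu> j) = f (r (e j))"
    by metis
  note E = tens_ext_hom [OF N \<nu>(1)]
  define H where "H v = (\<Sum>j\<in>Poly_Mapping.keys v. tens_ext N (\<nu> j) (Poly_Mapping.lookup v j))" for v
  have H_superset: "H v = (\<Sum>j\<in>J. tens_ext N (\<nu> j) (Poly_Mapping.lookup v j))"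
    if "finite J" "Poly_Mapping.keys v \<subseteq> J" for v J
    unfolding H_def by (rule sum.mono_neutral_left)
      (use that in \<open>auto simp: in_keys_iff tens_ext_0 [OF N \<nu>(1)]\<close>)
  have Hhom: "bimod_hom ?F N H"
  proof -
    have "H v \<in> bcarrier N" if "v \<in> bcarrier ?F" for v
      unfolding H_def using that bimod_hom_mem [OF E] by (intro bimodule_sum [OF N]) (simp add: F)
    moreover have "H (v + w) = H v + H w" for v w
      unfolding H_def
      by (rule setsum_keys_plus_distrib) (simp_all add: tens_ext_0 tens_ext_add N \<nu>)
    moreover have "H (lmul ?F s v) = lmul N s (H v)" "H (rmul ?F v s) = rmul N (H v) s"
      if v: "v \<in> bcarrier ?F" for s v
    proof -
      have "Poly_Mapping.keys (lmul ?F s v) \<subseteq> Poly_Mapping.keys v"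
        "Poly_Mapping.keys (rmul ?F v s) \<subseteq> Poly_Mapping.keys v"
        by (auto simp: in_keys_iff free_bimod_lookup complex_linear_0 [OF tens_lmul_linear]
            complex_linear_0 [OF tens_rmul_linear])
      then show "H (lmul ?F s v) = lmul N s (H v)" "H (rmul ?F v s) = rmul N (H v) s"
        using v bimod_hom_mem [OF E] bimod_hom_lmul [OF E] bimod_hom_rmul [OF E]
        by (simp_all add: H_superset [of "Poly_Mapping.keys v"] free_bimod_lookup lmul_sum rmul_sum N F)
    qed
    ultimately show ?thesis by (simp add: bimod_hom_def)
  qed
  \<comment> \<open>Both sides are additive in \<open>t\<close>, and a pure tensor at index
    \<open>j\<close> is obtained from the basis element \<open>e j\<close> by the two actions; on
    \<open>e j\<close> the values agree by the choice of \<nu>.\<close>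
  have gE: "g (tens_ext N (\<nu> j) t) = f (r (Poly_Mapping.single j t))" if "t \<in> tens_power 2" for j t
    using that
  proof (induction rule: tens_power_induct)
    case zero
    show ?case
      by (simp add: tens_ext_0 [OF N \<nu>(1)] bimod_hom_0 [OF N g] bimod_hom_0 [OF bimodule_free fr])
  next
    case (add xs c t)
    then obtain x y where xs: "xs = [x, y]" by (auto simp: eval_nat_numeral length_Suc_conv)
    have cx: "c *\<^sub>C tensor xs \<in> tens_power 2" by (rule tensor_tens_power) (simp add: xs)
    have "Poly_Mapping.single j (c *\<^sub>C tensor xs) = lmul ?F (c *\<^sub>C x) (rmul ?F (e j) y)"
      using tens_rmul_tensor [of "[1]" "1 :: 's" y]
      by (intro poly_mapping_eqI)
        (simp add: free_bimod_lookup e_def lookup_single when_def xs tens_mul_scaleC tens_lmul_tensor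
          complex_linear_0 [OF tens_lmul_linear] complex_linear_0 [OF tens_rmul_linear])
    then have "f (r (Poly_Mapping.single j (c *\<^sub>C tensor xs))) = lmul K (c *\<^sub>C x) (rmul K (f (r (e j))) y)"
      using bimod_hom_lmul [OF fr] bimod_hom_rmul [OF fr] e bimodule_rmul [OF bimodule_free] by metis
    moreover have "g (tens_ext N (\<nu> j) (c *\<^sub>C tensor xs)) = lmul K (c *\<^sub>C x) (rmul K (f (r (e j))) y)"
      using \<nu> by (simp add: xs tens_ext_tensor [OF N] bimod_hom_lmul [OF g] bimod_hom_rmul [OF g] bimodule_rmul [OF N])
    ultimately show ?case
      using add bimod_hom_mem [OF E] cx single
        bimod_hom_add [OF fr single [OF cx] single [OF add.hyps(2)]]
      by (simp add: tens_ext_add [OF N \<nu>(1)] bimod_hom_add [OF g] single_add)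
  qed
  have gH: "g (H v) = f (r v)" if v: "v \<in> bcarrier ?F" for v
  proof -
    have vs: "v = (\<Sum>j\<in>Poly_Mapping.keys v. Poly_Mapping.single j (Poly_Mapping.lookup v j))"
      by (rule poly_mapping_eqI) (simp add: lookup_sum lookup_single when_def in_keys_iff)
    have "g (H v) = (\<Sum>j\<in>Poly_Mapping.keys v. g (tens_ext N (\<nu> j) (Poly_Mapping.lookup v j)))"
      unfolding H_def using v bimod_hom_mem [OF E] by (intro bimod_hom_sum [OF N g]) (simp add: F)
    also have "\<dots> = (\<Sum>j\<in>Poly_Mapping.keys v. f (r (Poly_Mapping.single j (Poly_Mapping.lookup v j))))"
      using v by (simp add: gE F)
    also have "\<dots> = f (r (\<Sum>j\<in>Poly_Mapping.keys v. Poly_Mapping.single j (Poly_Mapping.lookup v j)))"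
      using v by (intro bimod_hom_sum [OF bimodule_free fr, symmetric] single) (simp add: F)
    finally show ?thesis using vs by simp
  qed
  have "bimod_hom M N (\<lambda>x. H (i x))" by (rule bimod_hom_comp [OF i Hhom])
  moreover have "g (H (i x)) = f x" if "x \<in> bcarrier M" for x
    using gH [OF bimod_hom_mem [OF i that]] ri [OF that] by simp
  ultimately show ?thesis by blast
qed


section \<open>The comparison theorem\<close>

definition bimod_complex :: "('s::complex_algebra, 'm::ab_group_add) aug_complex \<Rightarrow> bool" where
  "bimod_complex X \<longleftrightarrow> (\<forall>n. bimodule (cterm X n)) \<and>
    (\<forall>n. bimod_hom (cterm X (Suc n)) (cterm X n) (cdiff X n)) \<and>
    (\<forall>x\<in>bcarrier (cterm X (Suc 0)). caug X (cdiff X 0 x) = 0) \<and>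
    (\<forall>n. \<forall>x\<in>bcarrier (cterm X (Suc (Suc n))). cdiff X n (cdiff X (Suc n) x) = 0)"

definition is_cycle :: "('s::complex_algebra, 'm::ab_group_add) aug_complex \<Rightarrow> nat \<Rightarrow> 'm \<Rightarrow> bool" where
  "is_cycle X n x \<longleftrightarrow> (case n of 0 \<Rightarrow> caug X x = 0 | Suc k \<Rightarrow> cdiff X k x = 0)"

text \<open>All that the comparison theorem needs: this holds for \<open>X\<close> projective and \<open>Y\<close> exact, but also for
  the bar resolution, where lifts come from the contracting homotopy instead of projectivity.\<close>

definition lifts_cycles ::
    "('s::complex_algebra, 'm::ab_group_add) aug_complex \<Rightarrow> ('s, 'n::ab_group_add) aug_complex \<Rightarrow> bool" where
  "lifts_cycles X Y \<longleftrightarrow> (\<forall>n f. bimod_hom (cterm X n) (cterm Y n) f \<longrightarrow>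
     (\<forall>x\<in>bcarrier (cterm X n). is_cycle Y n (f x)) \<longrightarrow>
     (\<exists>h. bimod_hom (cterm X n) (cterm Y (Suc n)) h \<and> (\<forall>x\<in>bcarrier (cterm X n). cdiff Y n (h x) = f x)))"

text \<open>F - F' - h d is a cycle because both chain maps commute with the differentials, so
  \<open>lifts_cycles\<close> provides the next component of the homotopy.\<close>

lemma chain_homotopy:
  fixes X :: "('s::complex_algebra, 'm::ab_group_add) aug_complex"
    and Y :: "('s, 'n::ab_group_add) aug_complex"
  assumes X: "bimod_complex X" and Y: "bimod_complex Y" and L: "lifts_cycles X Y"
    and F: "chain_map_over_id X Y F" and F': "chain_map_over_id X Y F'"
    and aug: "bimod_hom (cterm Y 0) regular_bimod (caug Y)"
  obtains h where "\<And>n. bimod_hom (cterm X n) (cterm Y (Suc n)) (h n)"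
    and "\<And>x. x \<in> bcarrier (cterm X 0) \<Longrightarrow> cdiff Y 0 (h 0 x) = F 0 x - F' 0 x"
    and "\<And>n x. x \<in> bcarrier (cterm X (Suc n)) \<Longrightarrow>
      cdiff Y (Suc n) (h (Suc n) x) + h n (cdiff X n x) = F (Suc n) x - F' (Suc n) x"
proof -
  have bX: "bimodule (cterm X n)" and dX: "bimod_hom (cterm X (Suc n)) (cterm X n) (cdiff X n)"
    and bY: "bimodule (cterm Y n)" and dY: "bimod_hom (cterm Y (Suc n)) (cterm Y n) (cdiff Y n)" for n
    using X Y by (simp_all add: bimod_complex_def)
  have hF: "bimod_hom (cterm X n) (cterm Y n) (F n)" and hF': "bimod_hom (cterm X n) (cterm Y n) (F' n)" for n
    using F F' by (simp_all add: chain_map_over_id_def)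
  \<comment> \<open>Dependent choice hands over only the last component. The invariant therefore
    keeps the part of the homotopy equation that the next step uses: its value on boundaries, where
    the term with the previous component vanishes.\<close>
  let ?P = "\<lambda>n h. bimod_hom (cterm X n) (cterm Y (Suc n)) h
    \<and> (n = 0 \<longrightarrow> (\<forall>x\<in>bcarrier (cterm X 0). cdiff Y 0 (h x) = F 0 x - F' 0 x))
    \<and> (\<forall>x\<in>bcarrier (cterm X (Suc n)). cdiff Y n (h (cdiff X n x)) = F n (cdiff X n x) - F' n (cdiff X n x))"
  let ?Q = "\<lambda>n h h'. \<forall>x\<in>bcarrier (cterm X (Suc n)).
    cdiff Y (Suc n) (h' x) = F (Suc n) x - F' (Suc n) x - h (cdiff X n x)"
  have "\<exists>h. \<forall>n. ?P n (h n) \<and> ?Q n (h n) (h (Suc n))"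
  proof (rule dependent_nat_choice)
    have "\<forall>x\<in>bcarrier (cterm X 0). is_cycle Y 0 (F 0 x - F' 0 x)"
      using F F' bimod_hom_diff [OF bY aug] bimod_hom_mem [OF hF] bimod_hom_mem [OF hF']
      by (simp add: is_cycle_def chain_map_over_id_def)
    then obtain h where "bimod_hom (cterm X 0) (cterm Y (Suc 0)) h"
        "\<forall>x\<in>bcarrier (cterm X 0). cdiff Y 0 (h x) = F 0 x - F' 0 x"
      using L bimod_hom_minus [OF bY hF hF'] unfolding lifts_cycles_def by blast
    then show "\<exists>h. ?P 0 h"
      using bimod_hom_mem [OF dX] by blast
  next
    fix n h
    assume P: "?P n h"
    let ?f = "\<lambda>x. F (Suc n) x - F' (Suc n) x - h (cdiff X n x)"
    have hom: "bimod_hom (cterm X (Suc n)) (cterm Y (Suc n)) ?f"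
      using P by (intro bimod_hom_minus [OF bY] hF hF' bimod_hom_comp [OF dX]) simp
    have mem: "F (Suc n) x - F' (Suc n) x \<in> bcarrier (cterm Y (Suc n))"
      "h (cdiff X n x) \<in> bcarrier (cterm Y (Suc n))"
      if "x \<in> bcarrier (cterm X (Suc n))" for x
      using that P by (auto intro: bimodule_diff [OF bY] bimod_hom_mem [OF hF] bimod_hom_mem [OF hF']
          bimod_hom_mem [OF dX] bimod_hom_mem)
    have "\<forall>x\<in>bcarrier (cterm X (Suc n)). is_cycle Y (Suc n) (?f x)"
      using F F' P bimod_hom_diff [OF bY dY] mem bimod_hom_mem [OF hF] bimod_hom_mem [OF hF']
      by (simp add: is_cycle_def chain_map_over_id_def)
    then obtain h' where h': "bimod_hom (cterm X (Suc n)) (cterm Y (Suc (Suc n))) h'"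
        "\<forall>x\<in>bcarrier (cterm X (Suc n)). cdiff Y (Suc n) (h' x) = ?f x"
      using L hom unfolding lifts_cycles_def by blast
    have "h 0 = 0"
      by (rule bimod_hom_0 [OF bX]) (use P in blast)
    then have "h (cdiff X n (cdiff X (Suc n) x)) = 0" if "x \<in> bcarrier (cterm X (Suc (Suc n)))" for x
      using that X by (simp add: bimod_complex_def)
    then have "?P (Suc n) h'"
      using h' bimod_hom_mem [OF dX] by simp
    note PQ = conjI [OF this h'(2)]
    show "\<exists>h'. ?P (Suc n) h' \<and> ?Q n h h'"
      by (rule exI [where x = h'], rule PQ)
  qed
  then obtain h where PQ: "\<forall>n. ?P n (h n) \<and> ?Q n (h n) (h (Suc n))" ..
  note h = PQ [THEN spec, THEN conjunct1] PQ [THEN spec, THEN conjunct2]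
  show thesis
  proof (rule that)
    show "bimod_hom (cterm X n) (cterm Y (Suc n)) (h n)" for n
      using h(1) by blast
    show "cdiff Y 0 (h 0 x) = F 0 x - F' 0 x" if "x \<in> bcarrier (cterm X 0)" for x
      using h(1) [of 0] that by blast
    show "cdiff Y (Suc n) (h (Suc n) x) + h n (cdiff X n x) = F (Suc n) x - F' (Suc n) x"
      if "x \<in> bcarrier (cterm X (Suc n))" for n x
      using h(2) [of n] that by fastforce
  qed
qed

lemma resolution_complex:
  assumes X: "projective_resolution X"
  shows "bimod_complex X"
proof -
  have "cdiff X 0 x \<in> {x \<in> bcarrier (cterm X 0). caug X x = 0}" if "x \<in> bcarrier (cterm X 1)" for x
    using X that unfolding projective_resolution_def by blast
  moreover have "cdiff X (Suc n) x \<in> {x \<in> bcarrier (cterm X (Suc n)). cdiff X n x = 0}"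
    if "x \<in> bcarrier (cterm X (Suc (Suc n)))" for x n
    using X that unfolding projective_resolution_def by blast
  ultimately show ?thesis
    using X by (simp add: bimod_complex_def projective_resolution_def projective_bimod_def)
qed

lemma resolution_lifts_cycles:
  assumes X: "projective_resolution X"
  shows "lifts_cycles X X"
  unfolding lifts_cycles_def
proof (intro allI impI)
  fix n f
  assume f: "bimod_hom (cterm X n) (cterm X n) f"
    and cyc: "\<forall>x\<in>bcarrier (cterm X n). is_cycle X n (f x)"
  have b: "bimodule (cterm X k)" and p: "projective_bimod (cterm X k)"
    and d: "bimod_hom (cterm X (Suc k)) (cterm X k) (cdiff X k)" for k
    using X by (simp_all add: projective_resolution_def projective_bimod_def)
  have "y \<in> cdiff X n ` bcarrier (cterm X (Suc n))" if "y \<in> bcarrier (cterm X n)" "is_cycle X n y" for y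
  proof (cases n)
    case 0
    have "{x \<in> bcarrier (cterm X 0). caug X x = 0} = cdiff X 0 ` bcarrier (cterm X 1)"
      using X unfolding projective_resolution_def by blast
    moreover have "y \<in> {x \<in> bcarrier (cterm X 0). caug X x = 0}"
      using that 0 by (simp add: is_cycle_def)
    ultimately show ?thesis using 0 by simp
  next
    case (Suc k)
    have "{x \<in> bcarrier (cterm X (Suc k)). cdiff X k x = 0}
        = cdiff X (Suc k) ` bcarrier (cterm X (Suc (Suc k)))"
      using X unfolding projective_resolution_def by blast
    moreover have "y \<in> {x \<in> bcarrier (cterm X (Suc k)). cdiff X k x = 0}"
      using that Suc by (simp add: is_cycle_def)
    ultimately show ?thesis using Suc by simp
  qed
  then have "f ` bcarrier (cterm X n) \<subseteq> cdiff X n ` bcarrier (cterm X (Suc n))"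
    using cyc bimod_hom_mem [OF f] by blast
  then show "\<exists>h. bimod_hom (cterm X n) (cterm X (Suc n)) h
      \<and> (\<forall>x\<in>bcarrier (cterm X n). cdiff X n (h x) = f x)"
    by (rule projective_lift [OF p b b d f])
qed

section \<open>The bar resolution\<close>

interpretation alg: unital_algebra "(*) :: 's::complex_algebra \<Rightarrow> 's \<Rightarrow> 's" 1
  by unfold_locales (simp_all add: complex_linear_mult_left complex_linear_mult_right mult.assoc)

lemma tensor_decompose:
  assumes "length xs = n + 2"
  obtains a m b where "xs = a # m @ [b]" "length m = n"
proof -
  obtain a k where xs: "xs = a # k" "length k = Suc n" using assms by (cases xs) auto
  then obtain m b where "k = m @ [b]" by (cases k rule: rev_cases) auto
  then show thesis using that xs by simp
qed

text \<open>Bimodules inside a complex vector space, with actions that are complex linear in both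
  arguments. The terms of the bar resolution and the coefficient bimodule A are instances;
  homomorphisms into them from bar terms correspond to multilinear maps.\<close>

locale linear_bimod =
  fixes N :: "('s::complex_algebra, 'n::complex_vector) bimod"
  assumes bimodule: "bimodule N"
    and linear_lmul: "complex_linear (lmul N s)" and lmul_linear: "complex_linear (\<lambda>s. lmul N s x)"
    and linear_rmul: "complex_linear (\<lambda>x. rmul N x s)" and rmul_linear: "complex_linear (rmul N x)"
begin

lemma scaleC_eq_lmul: "y \<in> bcarrier N \<Longrightarrow> c *\<^sub>C y = lmul N (c *\<^sub>C 1) y"
  using lmul_linear [of y] one_lmul [OF bimodule] by (simp add: complex_linear_def)

text \<open>The inverse of evaluation on the tensors 1 \<otimes> m \<otimes> 1. With A as target it
  is \<open>bar_extend\<close>; with a term of the bar resolution as target it builds lifts of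
  cycles.\<close>

definition bimod_ext :: "nat \<Rightarrow> ('s list \<Rightarrow> 'n) \<Rightarrow> 's tens \<Rightarrow> 'n" where
  "bimod_ext n \<kappa> = tens_lift (\<lambda>xs. if length xs = n + 2
     then lmul N (hd xs) (rmul N (\<kappa> (butlast (tl xs))) (last xs)) else 0)"

lemma bimod_ext_multilinear:
  assumes \<kappa>: "multilinear n \<kappa>"
  shows "multilinear k (\<lambda>xs. if length xs = n + 2
     then lmul N (hd xs) (rmul N (\<kappa> (butlast (tl xs))) (last xs)) else 0)"
proof (cases "k = n + 2")
  case True
  have "multilinear (Suc n) (\<lambda>l. lmul N x (rmul N (\<kappa> (butlast l)) (last l)))" for x
    by (rule multilinear_linear [OF multilinear_butlast [OF \<kappa> linear_rmul rmul_linear] linear_lmul])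
  then have "multilinear (Suc (Suc n)) (\<lambda>xs. lmul N (hd xs) (rmul N (\<kappa> (butlast (tl xs))) (last (tl xs))))"
    using lmul_linear by (simp add: multilinear_Suc [of "Suc n"])
  moreover have "last (tl xs) = last xs" if "length xs = Suc (Suc n)" for xs :: "'s list"
    using that by (cases xs) auto
  ultimately show ?thesis
    using True by (subst multilinear_cong [where g = "\<lambda>xs. lmul N (hd xs) (rmul N (\<kappa> (butlast (tl xs))) (last (tl xs)))"]) auto
next
  case False
  then show ?thesis
    by (subst multilinear_cong [where g = "\<lambda>_. 0"]) (simp_all add: multilinear_zero)
qed

lemma bimod_ext_tensor:
  "multilinear n \<kappa> \<Longrightarrow> length m = n
    \<Longrightarrow> bimod_ext n \<kappa> (tensor (a # m @ [b])) = lmul N a (rmul N (\<kappa> m) b)"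
  unfolding bimod_ext_def by (subst tens_lift_tensor [OF bimod_ext_multilinear]) simp_all

lemma bimod_ext_linear: "multilinear n \<kappa> \<Longrightarrow> complex_linear (bimod_ext n \<kappa>)"
  unfolding bimod_ext_def by (rule tens_lift_linear [OF bimod_ext_multilinear])

lemma tensor_eq_mul:
  "c *\<^sub>C tensor (a # m @ [b]) = tens_lmul (c *\<^sub>C a) (tens_rmul (tensor (1 # m @ [1])) b)"
  using tens_rmul_tensor [of "1 # m" 1 b] tensor_scaleC [of "[]" c a "m @ [b]"]
  by (simp add: tens_lmul_tensor)

lemma bimod_ext_hom:
  assumes \<kappa>: "multilinear n \<kappa>" and mem: "\<And>m. length m = n \<Longrightarrow> \<kappa> m \<in> bcarrier N"
  shows "bimod_hom (tens_bimod (n + 2)) N (bimod_ext n \<kappa>)"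
proof -
  note lin = bimod_ext_linear [OF \<kappa>]
  have scale: "bimod_ext n \<kappa> (c *\<^sub>C tensor (a # m @ [b])) = lmul N (c *\<^sub>C a) (rmul N (\<kappa> m) b)"
    if "length m = n" for c a m b
    using lin lmul_linear [of "rmul N (\<kappa> m) b"] bimod_ext_tensor [OF \<kappa> that, of a b]
    by (simp add: complex_linear_def)
  have "bimod_ext n \<kappa> t \<in> bcarrier N
    \<and> (\<forall>s. bimod_ext n \<kappa> (tens_lmul s t) = lmul N s (bimod_ext n \<kappa> t)
        \<and> bimod_ext n \<kappa> (tens_rmul t s) = rmul N (bimod_ext n \<kappa> t) s)"
    if "t \<in> tens_power (n + 2)" for t
    using that
  proof (induction rule: tens_power_induct)
    case zero
    then show ?case
      by (simp add: complex_linear_0 [OF lin] bimodule_zero lmul_0 rmul_0 bimodule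
          complex_linear_0 [OF tens_lmul_linear] complex_linear_0 [OF tens_rmul_linear])
  next
    case (add xs c t)
    then obtain a m b where xs: "xs = a # m @ [b]" "length m = n"
      using tensor_decompose by blast
    note \<kappa>m = mem [OF xs(2)]
    have "tens_rmul (tensor (a # m @ [b])) s = tensor (a # m @ [b * s])" for s
      using tens_rmul_tensor [of "a # m"] by simp
    moreover have "lmul N (c *\<^sub>C (s * a)) z = lmul N s (lmul N (c *\<^sub>C a) z)" if "z \<in> bcarrier N" for s z
      using mult_lmul [OF bimodule that, of s "c *\<^sub>C a"] by (simp add: mult_scaleC_right)
    moreover have "bimod_ext n \<kappa> (x + y) = bimod_ext n \<kappa> x + bimod_ext n \<kappa> y" for x y
      using lin by (simp add: complex_linear_def)
    ultimately show ?case
      using add xs(2) \<kappa>m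
      by (simp add: xs(1) scale tens_mul_add tens_mul_scaleC tens_lmul_tensor
          bimodule_add bimodule_lmul bimodule_rmul bimodule lmul_add rmul_add mult_rmul lmul_rmul)
  qed
  then show ?thesis
    using lin by (simp add: bimod_hom_def complex_linear_def)
qed

lemma bimod_hom_eqI:
  assumes \<phi>: "bimod_hom (tens_bimod (n + 2)) N \<phi>" and \<psi>: "bimod_hom (tens_bimod (n + 2)) N \<psi>"
    and eq: "\<And>m. length m = n \<Longrightarrow> \<phi> (tensor (1 # m @ [1])) = \<psi> (tensor (1 # m @ [1]))"
    and t: "t \<in> tens_power (n + 2)"
  shows "\<phi> t = \<psi> t"
  using t
proof (induction rule: tens_power_induct)
  case zero
  have "bimodule (tens_bimod (n + 2) :: ('s, 's tens) bimod)"
    using bimodule_tens [of "Suc n"] by simp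
  then show ?case using bimod_hom_0 \<phi> \<psi> by metis
next
  case (add xs c t)
  then obtain a m b where xs: "xs = a # m @ [b]" "length m = n"
    using tensor_decompose by blast
  let ?e = "tensor (1 # m @ [1]) :: 's tens"
  have e: "?e \<in> bcarrier (tens_bimod (n + 2))" "tens_rmul ?e b \<in> bcarrier (tens_bimod (n + 2))"
    using xs(2) tens_rmul_power [of ?e "Suc n" b] by (simp_all add: tensor_in_tens_power)
  have "\<phi> (c *\<^sub>C tensor xs) = \<psi> (c *\<^sub>C tensor xs)"
    using bimod_hom_lmul [OF \<phi> e(2)] bimod_hom_lmul [OF \<psi> e(2)] bimod_hom_rmul [OF \<phi> e(1)]
      bimod_hom_rmul [OF \<psi> e(1)] eq [OF xs(2)]
    by (simp add: xs(1) tensor_eq_mul)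
  then show ?case
    using add bimod_hom_add [OF \<phi>, of "c *\<^sub>C tensor xs" t] bimod_hom_add [OF \<psi>, of "c *\<^sub>C tensor xs" t]
    by (simp add: tensor_tens_power)
qed

text \<open>Homomorphisms are only required to be additive; homogeneity follows because
  multiplication by a scalar c is the action of c 1 on source and target.\<close>

lemma bimod_hom_multilinear:
  assumes \<phi>: "bimod_hom (tens_bimod (n + 2)) N \<phi>"
  shows "multilinear n (\<lambda>m. \<phi> (tensor (1 # m @ [1])))"
proof -
  have scale: "\<phi> (c *\<^sub>C t) = c *\<^sub>C \<phi> t" if "t \<in> tens_power (n + 2)" for c t
  proof -
    have "\<phi> (tens_lmul (c *\<^sub>C 1) t) = lmul N (c *\<^sub>C 1) (\<phi> t)"
      using bimod_hom_lmul [OF \<phi>] that by simp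
    moreover have "tens_lmul (c *\<^sub>C 1) t = c *\<^sub>C t"
      using one_lmul [OF bimodule_tens, of t "Suc n"] that by (simp add: tens_mul_scaleC)
    ultimately show ?thesis
      using scaleC_eq_lmul bimod_hom_mem [OF \<phi>] that by simp
  qed
  show ?thesis
    unfolding multilinear_def
  proof (intro conjI allI impI)
    fix xs ys :: "'s list" and x y c
    assume "length xs + length ys + 1 = n"
    then have mem: "tensor (1 # (xs @ z # ys) @ [1]) \<in> tens_power (n + 2)" for z
      by (intro tensor_in_tens_power) simp
    show "\<phi> (tensor (1 # (xs @ (x + y) # ys) @ [1]))
        = \<phi> (tensor (1 # (xs @ x # ys) @ [1])) + \<phi> (tensor (1 # (xs @ y # ys) @ [1]))"
      using tensor_add [of "1 # xs" x y "ys @ [1]"] bimod_hom_add [OF \<phi>] mem [of x] mem [of y] by simp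
    show "\<phi> (tensor (1 # (xs @ (c *\<^sub>C x) # ys) @ [1])) = c *\<^sub>C \<phi> (tensor (1 # (xs @ x # ys) @ [1]))"
      using tensor_scaleC [of "1 # xs" c x "ys @ [1]"] scale mem [of x] by simp
  qed
qed

end

interpretation tens: linear_bimod "tens_bimod (Suc n)"
  by unfold_locales
    (simp_all add: bimodule_tens tens_lmul_linear tens_rmul_linear tens_lmul_linear_left tens_rmul_linear_right)

abbreviation bar_diff :: "'s::complex_algebra tens \<Rightarrow> 's tens" where
  "bar_diff \<equiv> tens_lift (merges (*) tensor)"

abbreviation bar_aug :: "'s::complex_algebra tens \<Rightarrow> 's" where
  "bar_aug \<equiv> tens_lift (mult_list (*))"

lemma bar_cterm [simp]: "cterm bar_resolution n = tens_bimod (n + 2)"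
  by (simp add: bar_resolution_def)

lemma bar_cdiff [simp]: "cdiff bar_resolution n = bar_diff"
proof -
  have "merges (*) tensor = (\<lambda>xs :: 'a list. \<Sum>i<length xs - 1.
       (-1) ^ i *\<^sub>C tensor (take i xs @ (xs ! i * xs ! (i + 1)) # drop (i + 2) xs))"
    by (rule ext) (rule merges_eq_sum)
  then show ?thesis
    by (simp only: bar_resolution_def aug_complex.simps)
qed

lemma bar_caug [simp]: "caug bar_resolution = bar_aug"
  by (simp add: bar_resolution_def mult_list_def [abs_def])

lemma bar_diff_tensor: "bar_diff (tensor xs) = merges (*) tensor xs"
  by (rule tens_lift_tensor [OF alg.merges_multilinear [OF tensor_multilinear]])

lemma bar_diff_linear: "complex_linear bar_diff"
  by (rule tens_lift_linear [OF alg.merges_multilinear [OF tensor_multilinear]])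

lemma linear_bar_diff:
  "complex_linear L \<Longrightarrow> L (bar_diff (tensor xs)) = merges (*) (\<lambda>l. L (tensor l)) xs"
  by (simp add: bar_diff_tensor insertions_linear)

lemma bar_diff_power:
  assumes "t \<in> tens_power (Suc n)"
  shows "bar_diff t \<in> tens_power n"
proof (rule tens_power_mapsto [OF bar_diff_linear _ assms])
  fix xs :: "'a list" assume len: "length xs = Suc n"
  have sum: "(\<Sum>i\<in>I. c i *\<^sub>C tensor (l i)) \<in> tens_power n"
    if "\<And>i. i \<in> I \<Longrightarrow> length (l i) = n" for I :: "nat set" and c and l :: "nat \<Rightarrow> 'a list"
    using that by (induction I rule: infinite_finite_induct)
      (simp_all add: tens_power_0 tens_power_add tensor_tens_power)
  show "bar_diff (tensor xs) \<in> tens_power n"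
    unfolding bar_diff_tensor merges_eq_sum by (rule sum) (use len in auto)
qed

lemma complex_linear_subtract:
  "complex_linear L \<Longrightarrow> complex_linear L' \<Longrightarrow> complex_linear (\<lambda>x. L x - L' x)"
  by (simp add: complex_linear_def scaleC_diff_right add_diff_add)

lemma complex_linear_zero: "complex_linear (\<lambda>_. 0)"
  by (simp add: complex_linear_def)

lemma bar_diff_diff: "bar_diff (bar_diff t) = 0"
proof (rule tens_eqI_all [of "\<lambda>t. bar_diff (bar_diff t)", OF complex_linear_comp [OF bar_diff_linear bar_diff_linear]
      complex_linear_zero])
  fix xs :: "'a list"
  have "bar_diff (bar_diff (tensor xs)) = merges (*) (\<lambda>l. bar_diff (tensor l)) xs"
    by (rule linear_bar_diff [OF bar_diff_linear])
  also have "\<dots> = 0"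
    by (simp only: bar_diff_tensor alg.merges_merges [OF tensor_multilinear])
  finally show "bar_diff (bar_diff (tensor xs)) = 0" .
qed

lemma bar_aug_linear: "complex_linear (bar_aug)"
  by (rule tens_lift_linear [OF alg.mu_multilinear])

lemma bar_aug_tensor: "bar_aug (tensor xs) = mult_list (*) xs"
  by (rule tens_lift_tensor [OF alg.mu_multilinear])

lemma bar_aug_diff: "bar_aug (bar_diff t) = 0"
proof (rule tens_eqI_all [of "\<lambda>t. bar_aug (bar_diff t)",
      OF complex_linear_comp [OF bar_aug_linear bar_diff_linear] complex_linear_zero])
  show "bar_aug (bar_diff (tensor xs)) = 0" for xs :: "'a list"
    by (simp add: linear_bar_diff [OF bar_aug_linear] bar_aug_tensor alg.mu_mu)
qed

lemma merges_last:
  fixes s :: "'s::complex_algebra" and G :: "'s list \<Rightarrow> 'b::complex_vector"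
  shows "merges (*) (\<lambda>l. G (butlast l @ [last l * s])) (xs @ [z]) = merges (*) G (xs @ [z * s])"
proof (induction xs arbitrary: G rule: induct_list012)
  case (3 x y l)
  have "merges (*) (\<lambda>l'. G (butlast (x # l') @ [last (x # l') * s])) (y # l @ [z])
      = merges (*) (\<lambda>l'. G (x # butlast l' @ [last l' * s])) (y # l @ [z])"
    by (rule insertions_cong) simp
  then show ?case
    using "3.IH"(2) [of "\<lambda>l. G (x # l)"] by (simp add: merges_simps butlast_append)
qed (simp_all add: merges_simps mult.assoc)

lemma bar_diff_lmul: "bar_diff (tens_lmul s t) = tens_lmul s (bar_diff t)" if "t \<in> tens_power (Suc (Suc n))"
proof (rule tens_eqI [OF complex_linear_comp [OF bar_diff_linear tens_lmul_linear]
      complex_linear_comp [OF tens_lmul_linear bar_diff_linear] _ that])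
  fix xs :: "'a list" assume "length xs = Suc (Suc n)"
  then obtain x y l where xs: "xs = x # y # l" by (cases xs; cases "tl xs") auto
  have "tens_lmul s (bar_diff (tensor xs)) = merges (*) (\<lambda>l. tens_lmul s (tensor l)) xs"
    by (rule linear_bar_diff [OF tens_lmul_linear])
  then show "bar_diff (tens_lmul s (tensor xs)) = tens_lmul s (bar_diff (tensor xs))"
    by (simp add: xs tens_lmul_tensor bar_diff_tensor merges_simps mult.assoc)
qed

lemma bar_diff_rmul: "bar_diff (tens_rmul t s) = tens_rmul (bar_diff t) s" if "t \<in> tens_power (Suc (Suc n))"
proof (rule tens_eqI [OF complex_linear_comp [OF bar_diff_linear tens_rmul_linear]
      complex_linear_comp [OF tens_rmul_linear bar_diff_linear] _ that])
  fix xs :: "'a list" assume "length xs = Suc (Suc n)"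
  then obtain l z where xs: "xs = l @ [z]" by (cases xs rule: rev_cases) auto
  have "tens_rmul (bar_diff (tensor xs)) s = merges (*) (\<lambda>l. tens_rmul (tensor l) s) xs"
    by (rule linear_bar_diff [OF tens_rmul_linear])
  also have "\<dots> = merges (*) (\<lambda>l. tensor (butlast l @ [last l * s])) xs"
  proof (rule insertions_cong)
    fix l' :: "'a list" assume "l' \<noteq> []"
    then show "tens_rmul (tensor l') s = tensor (butlast l' @ [last l' * s])"
      by (metis append_butlast_last_id tens_rmul_tensor)
  qed
  finally show "bar_diff (tens_rmul (tensor xs) s) = tens_rmul (bar_diff (tensor xs)) s"
    by (simp add: xs tens_rmul_tensor bar_diff_tensor merges_last)
qed

lemma bar_diff_add: "bar_diff (s + t) = bar_diff s + bar_diff t"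
  using bar_diff_linear [unfolded complex_linear_def] by blast

lemma bar_diff_hom: "bimod_hom (tens_bimod (Suc (Suc (Suc n)))) (tens_bimod (Suc (Suc n))) bar_diff"
  by (simp add: bimod_hom_def bar_diff_power bar_diff_lmul bar_diff_rmul bar_diff_add)

lemma bar_complex: "bimod_complex bar_resolution"
  by (simp add: bimod_complex_def bar_aug_diff bar_diff_diff bimodule_tens bar_diff_hom)

lemma bar_aug_hom: "bimod_hom (tens_bimod 2) regular_bimod bar_aug"
proof -
  have l: "bar_aug (tens_lmul s t) = s * bar_aug t" and r: "bar_aug (tens_rmul t s) = bar_aug t * s"
    if t: "t \<in> tens_power 2" for s and t :: "'a tens"
  proof -
    have 2: "\<exists>x y. xs = [x, y]" if "length xs = 2" for xs :: "'a list"
      using that by (auto simp: eval_nat_numeral length_Suc_conv)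
    show "bar_aug (tens_lmul s t) = s * bar_aug t"
    proof (rule tens_eqI [OF complex_linear_comp [OF bar_aug_linear tens_lmul_linear]
          complex_linear_comp [OF complex_linear_mult_left bar_aug_linear] _ t])
      fix xs :: "'a list" assume "length xs = 2"
      then show "bar_aug (tens_lmul s (tensor xs)) = s * bar_aug (tensor xs)"
        by (auto dest!: 2 simp: tens_lmul_tensor bar_aug_tensor mult_list_def mult.assoc)
    qed
    show "bar_aug (tens_rmul t s) = bar_aug t * s"
    proof (rule tens_eqI [OF complex_linear_comp [OF bar_aug_linear tens_rmul_linear]
          complex_linear_comp [OF complex_linear_mult_right bar_aug_linear] _ t])
      fix xs :: "'a list" assume "length xs = 2"
      then obtain x y where "xs = [x] @ [y]" using 2 [of xs] by auto
      then show "bar_aug (tens_rmul (tensor xs) s) = bar_aug (tensor xs) * s"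
        by (simp only: tens_rmul_tensor) (simp add: bar_aug_tensor mult_list_def mult.assoc)
    qed
  qed
  have "bar_aug (s + t) = bar_aug s + bar_aug t" for s t :: "'a tens"
    using bar_aug_linear [unfolded complex_linear_def] by blast
  then show ?thesis
    by (simp add: bimod_hom_def regular_bimod_def l r)
qed

text \<open>The contracting homotopy of the bar resolution. It is not left S-linear in general, so
  it cannot serve as a lift of bimodules itself.\<close>

definition tens_cons :: "'s::complex_algebra tens \<Rightarrow> 's tens" where
  "tens_cons = tens_lift (\<lambda>xs. tensor (1 # xs))"

lemma tens_cons_multilinear: "multilinear n (\<lambda>xs. tensor (1 # xs))"
  by (rule multilinear_Cons [OF tensor_multilinear])

lemma tens_cons_linear: "complex_linear tens_cons"
  unfolding tens_cons_def by (rule tens_lift_linear [OF tens_cons_multilinear])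

lemma tens_cons_tensor: "tens_cons (tensor xs) = tensor (1 # xs)"
  by (simp add: tens_cons_def tens_lift_tensor [OF tens_cons_multilinear])

lemma bar_contraction: "bar_diff (tens_cons t) = t - tens_cons (bar_diff t)" if "t \<in> tens_power (Suc n)"
proof (rule tens_eqI [OF complex_linear_comp [OF bar_diff_linear tens_cons_linear] _ _ that])
  show "complex_linear (\<lambda>t. t - tens_cons (bar_diff t))"
    by (intro complex_linear_subtract complex_linear_comp [OF tens_cons_linear bar_diff_linear])
      (simp add: complex_linear_def)
  fix xs :: "'a list" assume "length xs = Suc n"
  then obtain x l where xs: "xs = x # l" by (cases xs) auto
  have "tens_cons (bar_diff (tensor xs)) = merges (*) (\<lambda>l. tensor (1 # l)) xs"
    by (simp only: linear_bar_diff [OF tens_cons_linear] tens_cons_tensor)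
  then show "bar_diff (tens_cons (tensor xs)) = tensor xs - tens_cons (bar_diff (tensor xs))"
    by (simp add: tens_cons_tensor bar_diff_tensor merges_simps xs)
qed

text \<open>In degree 0 a cycle is defined by the augmentation, whereas
  \<open>bar_contraction\<close> involves \<open>bar_diff\<close>; on S \<otimes> S the latter is
  \<open>tensor [bar_aug t]\<close>, so the two conditions match.\<close>

lemma bar_diff_cons_cycle:
  assumes t: "t \<in> tens_power (n + 2)" and "is_cycle bar_resolution n t"
  shows "bar_diff (tens_cons t) = t"
proof -
  have "bar_diff t = 0"
  proof (cases n)
    case 0
    have single: "complex_linear (\<lambda>x. tensor [x])"
      by (rule complex_linear_tensor_Cons)
    have "bar_diff t = tensor [bar_aug t]"
    proof (rule tens_eqI [OF bar_diff_linear complex_linear_comp [OF single bar_aug_linear] _ t])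
      fix xs :: "'a list" assume "length xs = n + 2"
      then obtain x y where "xs = [x, y]" using 0 by (auto simp: eval_nat_numeral length_Suc_conv)
      then show "bar_diff (tensor xs) = tensor [bar_aug (tensor xs)]"
        by (simp add: bar_diff_tensor bar_aug_tensor merges_simps mult_list_def)
    qed
    then show ?thesis using assms(2) 0 complex_linear_0 [OF single] by (simp add: is_cycle_def)
  qed (use assms(2) in \<open>simp add: is_cycle_def\<close>)
  then show ?thesis
    using bar_contraction [of t "Suc n"] t complex_linear_0 [OF tens_cons_linear] by simp
qed

text \<open>The contracting homotopy is applied to the cycle only for the generators 1 \<otimes> m
  \<otimes> 1, and the result is extended to a homomorphism; the equation with \<open>f\<close> then
  has to be checked on generators only.\<close>

lemma bar_lifts_cycles: "lifts_cycles bar_resolution (bar_resolution :: ('s::complex_algebra, 's tens) aug_complex)"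
  unfolding lifts_cycles_def
proof (intro allI impI)
  fix n and f :: "'s tens \<Rightarrow> 's tens"
  assume "bimod_hom (cterm bar_resolution n) (cterm bar_resolution n) f"
    and "\<forall>x\<in>bcarrier (cterm bar_resolution n). is_cycle bar_resolution n (f x)"
  then have f: "bimod_hom (tens_bimod (n + 2)) (tens_bimod (n + 2)) f"
    and cyc: "\<And>x. x \<in> tens_power (n + 2) \<Longrightarrow> is_cycle bar_resolution n (f x)"
    by simp_all
  define \<kappa> where "\<kappa> m = tens_cons (f (tensor (1 # m @ [1])))" for m
  have e: "tensor (1 # m @ [1]) \<in> tens_power (n + 2)" if "length m = n" for m :: "'s list"
    by (rule tensor_in_tens_power) (simp add: that)
  have fe: "f (tensor (1 # m @ [1])) \<in> tens_power (n + 2)" if "length m = n" for m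
    using bimod_hom_mem [OF f] e [OF that] by simp
  have \<kappa>: "multilinear n \<kappa>"
    unfolding \<kappa>_def
    using tens.bimod_hom_multilinear [of n "Suc n" f] f by (intro multilinear_linear [OF _ tens_cons_linear]) simp
  have \<kappa>m: "\<kappa> m \<in> bcarrier (tens_bimod (Suc (n + 2)))" if "length m = n" for m
  proof -
    have "tens_cons t \<in> tens_power (Suc (n + 2))" if "t \<in> tens_power (n + 2)" for t :: "'s tens"
      by (rule tens_power_mapsto [OF tens_cons_linear _ that])
        (simp add: tens_cons_tensor tensor_in_tens_power)
    then show ?thesis using fe [OF that] by (simp add: \<kappa>_def)
  qed
  let ?h = "tens.bimod_ext (n + 2) n \<kappa>"
  have h: "bimod_hom (tens_bimod (n + 2)) (tens_bimod (Suc (n + 2))) ?h"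
    by (rule tens.bimod_ext_hom [OF \<kappa> \<kappa>m])
  have dh: "bimod_hom (tens_bimod (n + 2)) (tens_bimod (n + 2)) (\<lambda>x. bar_diff (?h x))"
    using bimod_hom_comp [OF h] bar_diff_hom [of n] by simp
  have "bar_diff (?h t) = f t" if "t \<in> tens_power (n + 2)" for t
  proof (rule tens.bimod_hom_eqI [of n "Suc n", simplified, OF _ _ _ that [simplified]])
    show "bimod_hom (tens_bimod (Suc (Suc n))) (tens_bimod (Suc (Suc n))) (\<lambda>x. bar_diff (?h x))"
      using dh by simp
    show "bimod_hom (tens_bimod (Suc (Suc n))) (tens_bimod (Suc (Suc n))) f"
      using f by simp
    fix m :: "'s list" assume m: "length m = n"
    have "?h (tensor (1 # m @ [1])) = \<kappa> m"
      using tens.bimod_ext_tensor [OF \<kappa> m, of "n + 2" 1 1] \<kappa>m [OF m]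
        one_lmul [OF bimodule_tens \<kappa>m [OF m]] one_rmul [OF bimodule_tens \<kappa>m [OF m]] by simp
    then show "bar_diff (?h (tensor (1 # m @ [1]))) = f (tensor (1 # m @ [1]))"
      using bar_diff_cons_cycle [OF fe [OF m] cyc [OF e [OF m]]] by (simp add: \<kappa>_def)
  qed
  then show "\<exists>h. bimod_hom (cterm bar_resolution n) (cterm bar_resolution (Suc n)) h
      \<and> (\<forall>x\<in>bcarrier (cterm bar_resolution n). cdiff bar_resolution n (h x) = f x)"
    using h by auto
qed

section \<open>Pulling cocycles back along homotopic chain maps\<close>

text \<open>Applying \<phi> to d h + h d = F - F' kills d h, and the composite of h with \<phi> is
  the primitive. In degree 0 there is no term h d, so the pullbacks are equal.\<close>

lemma homotopic_pullback:
  fixes X :: "('s::complex_algebra, 'm::ab_group_add) aug_complex"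
    and Y :: "('s, 'n::ab_group_add) aug_complex" and N :: "('s, 'k::ab_group_add) bimod"
  assumes X: "bimod_complex X" and Y: "bimod_complex Y" and L: "lifts_cycles X Y"
    and F: "chain_map_over_id X Y F" and F': "chain_map_over_id X Y F'"
    and aug: "bimod_hom (cterm Y 0) regular_bimod (caug Y)"
    and \<phi>: "bimod_hom (cterm Y n) N \<phi>"
    and cocycle: "\<And>y. y \<in> bcarrier (cterm Y (Suc n)) \<Longrightarrow> \<phi> (cdiff Y n y) = 0"
  shows "case n of 0 \<Rightarrow> \<forall>x\<in>bcarrier (cterm X 0). \<phi> (F 0 x) = \<phi> (F' 0 x)
    | Suc k \<Rightarrow> \<exists>\<psi>. bimod_hom (cterm X k) N \<psi> \<and>
        (\<forall>x\<in>bcarrier (cterm X (Suc k)). \<phi> (F (Suc k) x) - \<phi> (F' (Suc k) x) = \<psi> (cdiff X k x))"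
proof -
  obtain h where h: "\<And>n. bimod_hom (cterm X n) (cterm Y (Suc n)) (h n)"
    and h0: "\<And>x. x \<in> bcarrier (cterm X 0) \<Longrightarrow> cdiff Y 0 (h 0 x) = F 0 x - F' 0 x"
    and hS: "\<And>n x. x \<in> bcarrier (cterm X (Suc n)) \<Longrightarrow>
      cdiff Y (Suc n) (h (Suc n) x) + h n (cdiff X n x) = F (Suc n) x - F' (Suc n) x"
    using chain_homotopy [OF X Y L F F' aug] by blast
  have bY: "bimodule (cterm Y k)" and dX: "bimod_hom (cterm X (Suc k)) (cterm X k) (cdiff X k)"
    and dY: "bimod_hom (cterm Y (Suc k)) (cterm Y k) (cdiff Y k)" for k
    using X Y by (simp_all add: bimod_complex_def)
  have hF: "bimod_hom (cterm X k) (cterm Y k) (F k)" and hF': "bimod_hom (cterm X k) (cterm Y k) (F' k)" for k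
    using F F' by (simp_all add: chain_map_over_id_def)
  have diff: "\<phi> (F n x) - \<phi> (F' n x) = \<phi> (F n x - F' n x)" if "x \<in> bcarrier (cterm X n)" for x
    using bimod_hom_diff [OF bY \<phi>] bimod_hom_mem [OF hF that] bimod_hom_mem [OF hF' that] by simp
  show ?thesis
  proof (cases n)
    case 0
    have "\<phi> (F 0 x) - \<phi> (F' 0 x) = 0" if "x \<in> bcarrier (cterm X 0)" for x
      using diff [of x] h0 [OF that] cocycle [of "h 0 x"] bimod_hom_mem [OF h that] that 0 by simp
    then show ?thesis using 0 by simp
  next
    case (Suc k)
    have "\<phi> (F (Suc k) x) - \<phi> (F' (Suc k) x) = \<phi> (h k (cdiff X k x))"
      if x: "x \<in> bcarrier (cterm X (Suc k))" for x
    proof -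
      have "h (Suc k) x \<in> bcarrier (cterm Y (Suc n))" using bimod_hom_mem [OF h x] Suc by simp
      then show ?thesis
        using diff [of x] hS [OF x, symmetric] cocycle [of "h (Suc k) x"] x Suc
          bimod_hom_add [OF \<phi>, of "cdiff Y n (h (Suc k) x)" "h k (cdiff X k x)"]
          bimod_hom_mem [OF dY, of "h (Suc k) x" n] bimod_hom_mem [OF h bimod_hom_mem [OF dX x]]
        by simp
    qed
    moreover have "bimod_hom (cterm X k) N (\<lambda>x. \<phi> (h k x))"
      by (rule bimod_hom_comp [OF h]) (use \<phi> Suc in simp)
    ultimately show ?thesis using Suc by auto
  qed
qed

text \<open>Linearity of \<open>T\<close> is only available on cochains, so the induction also
  records that the partial sums are cochains.\<close>

lemma linear_on_cochains_avg:
  fixes T :: "('a::complex_vector list \<Rightarrow> 'b::complex_vector) \<Rightarrow> 'c::complex_vector"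
    and f :: "'g::finite \<Rightarrow> 'a list \<Rightarrow> 'b"
  assumes T: "\<And>f g c. f \<in> cochains n \<Longrightarrow> g \<in> cochains n \<Longrightarrow> T (\<lambda>l. f l + c *\<^sub>C g l) = T f + c *\<^sub>C T g"
    and f: "\<And>a. f a \<in> cochains n"
  shows "T (\<lambda>l. avg (\<lambda>a. f a l)) = avg (\<lambda>a. T (f a))"
proof -
  have 0: "T (\<lambda>_. 0) = 0"
    using T [OF cochains_zero cochains_zero, of 1] by (simp add: scaleC_one)
  have sum: "(\<lambda>l. \<Sum>a\<in>I. f a l) \<in> cochains n \<and> T (\<lambda>l. \<Sum>a\<in>I. f a l) = (\<Sum>a\<in>I. T (f a))" if "finite I" for I
    using that
  proof (induction I rule: finite_induct)
    case (insert a I)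
    then show ?case
      using T [OF f [of a], of "\<lambda>l. \<Sum>a\<in>I. f a l" 1] cochains_add [OF f [of a], of "\<lambda>l. \<Sum>a\<in>I. f a l"]
      by (simp add: scaleC_one)
  qed (simp add: 0 cochains_zero)
  show ?thesis
    using T [OF cochains_zero, of "\<lambda>l. \<Sum>a\<in>UNIV. f a l" "1 / of_nat CARD('g)"] sum [of UNIV]
    by (simp add: avg_def 0)
qed


section \<open>The action on the bar resolution\<close>

definition bar_act :: "('g \<Rightarrow> 's \<Rightarrow> 's) \<Rightarrow> 'g \<Rightarrow> 's::complex_algebra tens \<Rightarrow> 's tens" where
  "bar_act act g = tens_lift (\<lambda>xs. tensor (map (act g) xs))"

context smash
begin

lemma bar_act_multilinear: "multilinear n (\<lambda>xs. tensor (map (act g) xs))"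
  by (rule multilinear_map [OF tensor_multilinear complex_linear_act])

lemma bar_act_linear: "complex_linear (bar_act act g)"
  unfolding bar_act_def by (rule tens_lift_linear [OF bar_act_multilinear])

lemma bar_act_tensor: "bar_act act g (tensor xs) = tensor (map (act g) xs)"
  by (simp add: bar_act_def tens_lift_tensor [OF bar_act_multilinear])

lemma bar_act_power: "t \<in> tens_power n \<Longrightarrow> bar_act act g t \<in> tens_power n"
  by (rule tens_power_mapsto [OF bar_act_linear]) (simp_all add: bar_act_tensor tensor_in_tens_power)

lemma bar_act_lmul: "bar_act act g (tens_lmul s t) = tens_lmul (act g s) (bar_act act g t)"
proof (rule tens_eqI_all [OF complex_linear_comp [OF bar_act_linear tens_lmul_linear]
      complex_linear_comp [OF tens_lmul_linear bar_act_linear]])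
  show "bar_act act g (tens_lmul s (tensor xs)) = tens_lmul (act g s) (bar_act act g (tensor xs))" for xs
    by (cases xs) (simp_all add: bar_act_tensor tens_lmul_tensor tens_lmul_nil complex_linear_0 [OF bar_act_linear])
qed

lemma bar_act_rmul: "bar_act act g (tens_rmul t s) = tens_rmul (bar_act act g t) (act g s)"
proof (rule tens_eqI_all [OF complex_linear_comp [OF bar_act_linear tens_rmul_linear]
      complex_linear_comp [OF tens_rmul_linear bar_act_linear]])
  show "bar_act act g (tens_rmul (tensor xs) s) = tens_rmul (bar_act act g (tensor xs)) (act g s)" for xs
    by (cases xs rule: rev_cases)
      (simp_all add: bar_act_tensor tens_rmul_tensor tens_rmul_nil complex_linear_0 [OF bar_act_linear])
qed

lemma bar_act_diff: "bar_act act g (bar_diff t) = bar_diff (bar_act act g t)"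
proof (rule tens_eqI_all [OF complex_linear_comp [OF bar_act_linear bar_diff_linear]
      complex_linear_comp [OF bar_diff_linear bar_act_linear]])
  fix xs
  have "merges (*) (\<lambda>l. tensor (map (act g) l)) xs = merges (*) tensor (map (act g) xs)"
    by (rule merges_map) simp
  moreover have "bar_act act g (bar_diff (tensor xs)) = merges (*) (\<lambda>l. bar_act act g (tensor l)) xs"
    by (rule linear_bar_diff [OF bar_act_linear])
  ultimately show "bar_act act g (bar_diff (tensor xs)) = bar_diff (bar_act act g (tensor xs))"
    by (simp only: bar_act_tensor bar_diff_tensor)
qed

lemma bar_act_aug: "bar_aug (bar_act act g t) = act g (bar_aug t)"
proof (rule tens_eqI_all [OF complex_linear_comp [OF bar_aug_linear bar_act_linear]
      complex_linear_comp [OF complex_linear_act bar_aug_linear]])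
  show "bar_aug (bar_act act g (tensor xs)) = act g (bar_aug (tensor xs))" for xs
    by (simp add: bar_act_tensor bar_aug_tensor mult_list_def)
qed

section \<open>The bimodule A and bar cochains with coefficients in A\<close>

lemma smash_bimod_simps [simp]:
  "bcarrier (smash_bimod act) = UNIV" "lmul (smash_bimod act) s a = \<iota> s \<star> a"
  "rmul (smash_bimod act) a s = a \<star> \<iota> s"
  by (simp_all add: smash_bimod_def)

lemma iota_linear: "\<iota> (s + t) = \<iota> s + \<iota> t" "\<iota> (c *\<^sub>C s) = c *\<^sub>C \<iota> s"
  by (simp_all add: axis_add axis_scale)

lemma mul_scaleC_left: "(c *\<^sub>C x) \<star> y = c *\<^sub>C (x \<star> y)"
  and mul_scaleC_right: "x \<star> (c *\<^sub>C y) = c *\<^sub>C (x \<star> y)"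
  using linear_mul_left [of y] linear_mul_right [of x] by (auto simp: complex_linear_def)

lemma bimodule_smash: "bimodule (smash_bimod act)"
  by (simp add: bimodule_def mul_add_left mul_add_right iota_linear iota_mult mul_assoc
      mul_unit_left mul_unit_right mul_scaleC_left mul_scaleC_right)

sublocale coef: linear_bimod "smash_bimod act"
  by unfold_locales
    (simp_all add: bimodule_smash complex_linear_def mul_add_left mul_add_right iota_linear
      mul_scaleC_left mul_scaleC_right)

lemma bar_extend_eq: "bar_extend act n \<kappa> = coef.bimod_ext n \<kappa>"
  unfolding bar_extend_def coef.bimod_ext_def smash_bimod_simps ..

lemma bar_extend_hom:
  "multilinear n \<kappa> \<Longrightarrow> bimod_hom (tens_bimod (n + 2)) (smash_bimod act) (bar_extend act n \<kappa>)"
  unfolding bar_extend_eq by (rule coef.bimod_ext_hom) simp_all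

lemma bar_extend_one:
  "multilinear n \<kappa> \<Longrightarrow> length m = n \<Longrightarrow> bar_extend act n \<kappa> (tensor (1 # m @ [1])) = \<kappa> m"
  unfolding bar_extend_eq by (simp add: coef.bimod_ext_tensor [of n \<kappa> m 1 1] mul_unit_left mul_unit_right)

lemma bar_extend_linear:
  "bar_extend act n (\<lambda>l. \<kappa> l + c *\<^sub>C \<kappa>' l) t = bar_extend act n \<kappa> t + c *\<^sub>C bar_extend act n \<kappa>' t"
proof -
  let ?F = "\<lambda>\<kappa> xs. if length xs = n + 2 then \<iota> (hd xs) \<star> (\<kappa> (butlast (tl xs)) \<star> \<iota> (last xs)) else 0"
  have F: "?F (\<lambda>l. \<kappa> l + c *\<^sub>C \<kappa>' l) xs = ?F \<kappa> xs + c *\<^sub>C ?F \<kappa>' xs" for xs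
    by (simp add: mul_add_left mul_add_right mul_scaleC_left mul_scaleC_right)
  show ?thesis
    unfolding bar_extend_def tens_lift_def free_lift_def F
    by (simp only: scaleC_add_right sum.distrib cvec.scale_sum_right scaleC_scaleC mult.commute)
qed

lemma bar_extend_act:
  assumes \<kappa>: "multilinear n \<kappa>" and t: "t \<in> tens_power (n + 2)"
  shows "bar_extend act n (cochain_act act g \<kappa>) t = smash_conj act g (bar_extend act n \<kappa> (bar_act act (- g) t))"
proof (rule tens_eqI [OF _ _ _ t])
  have \<kappa>': "multilinear n (cochain_act act g \<kappa>)"
    unfolding cochain_act_def [abs_def]
    by (intro multilinear_linear [OF multilinear_map [OF \<kappa> complex_linear_act] linear_conj])
  show "complex_linear (bar_extend act n (cochain_act act g \<kappa>))"
    unfolding bar_extend_eq by (rule coef.bimod_ext_linear [OF \<kappa>'])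
  have "complex_linear (bar_extend act n \<kappa>)"
    unfolding bar_extend_eq by (rule coef.bimod_ext_linear [OF \<kappa>])
  then show "complex_linear (\<lambda>t. smash_conj act g (bar_extend act n \<kappa> (bar_act act (- g) t)))"
    using complex_linear_comp [OF linear_conj complex_linear_comp [OF _ bar_act_linear]] by blast
  fix xs :: "'s list" assume "length xs = n + 2"
  then obtain a m b where xs: "xs = a # m @ [b]" "length m = n" by (rule tensor_decompose)
  show "bar_extend act n (cochain_act act g \<kappa>) (tensor xs)
      = smash_conj act g (bar_extend act n \<kappa> (bar_act act (- g) (tensor xs)))"
    using coef.bimod_ext_tensor [OF \<kappa>' xs(2), of a b]
      coef.bimod_ext_tensor [OF \<kappa>, of "map (act (- g)) m" "act (- g) a" "act (- g) b"] xs(2)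
    by (simp add: xs(1) bar_extend_eq bar_act_tensor conj_mult conj_iota cochain_act_def)
qed

text \<open>Checked on the generators 1 \<otimes> m \<otimes> 1: the merge with the leading 1 gives
  the left outer term, the merge with the trailing 1 the right outer term, and the others give the
  inner terms.\<close>

lemma bar_extend_diff:
  assumes \<kappa>: "\<kappa> \<in> cochains n" and t: "t \<in> tens_power (n + 3)"
  shows "bar_extend act n \<kappa> (bar_diff t) = bar_extend act (n + 1) (coef_diff n \<kappa>) t"
proof -
  note \<kappa>m = cochains_multilinear [OF \<kappa>] and dm = cochains_multilinear [OF coef_diff_cochains [OF \<kappa>]]
  have lin: "complex_linear (bar_extend act n \<kappa>)"
    unfolding bar_extend_eq by (rule coef.bimod_ext_linear [OF \<kappa>m])
  have t': "t \<in> tens_power (Suc n + 2)" using t by (simp add: eval_nat_numeral)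
  show ?thesis
  proof (rule coef.bimod_hom_eqI [OF _ _ _ t'])
    show "bimod_hom (tens_bimod (Suc n + 2)) (smash_bimod act) (\<lambda>t. bar_extend act n \<kappa> (bar_diff t))"
      using bimod_hom_comp [OF bar_diff_hom [of n]] bar_extend_hom [OF \<kappa>m] by simp
    show "bimod_hom (tens_bimod (Suc n + 2)) (smash_bimod act) (bar_extend act (n + 1) (coef_diff n \<kappa>))"
      using bar_extend_hom [OF dm] by simp
    fix m :: "'s list" assume m: "length m = Suc n"
    then obtain x r where x: "m = x # r" "length r = n" by (cases m) auto
    let ?E = "\<lambda>l. \<iota> (hd l) \<star> (\<kappa> (butlast (tl l)) \<star> \<iota> (last l))"
    have "bar_extend act n \<kappa> (bar_diff (tensor (1 # m @ [1])))
        = merges (*) (\<lambda>l. bar_extend act n \<kappa> (tensor l)) (1 # m @ [1])"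
      by (rule linear_bar_diff [OF lin])
    also have "\<dots> = merges (*) ?E (1 # m @ [1])"
    proof (rule insertions_cong)
      fix l :: "'s list" assume "length l + 2 = length (1 # m @ [1]) + 1"
      then have "length l = n + 2" using m by simp
      then obtain a k b where "l = a # k @ [b]" "length k = n" by (rule tensor_decompose)
      then show "bar_extend act n \<kappa> (tensor l) = ?E l"
        using coef.bimod_ext_tensor [OF \<kappa>m, of k a b] by (simp add: bar_extend_eq)
    qed
    also have "\<dots> = ?E (x # r @ [1]) - merges (*) (\<lambda>l. ?E (1 # l)) (m @ [1])"
      by (simp add: x merges_simps)
    also have "merges (*) (\<lambda>l. ?E (1 # l)) (m @ [1]) = merges (*) (\<lambda>l. \<kappa> (butlast l) \<star> \<iota> (last l)) (m @ [1])"
      by (rule insertions_cong) (simp add: mul_unit_left)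
    also have "\<dots> = merges (*) \<kappa> m - (- 1) ^ length m *\<^sub>C (\<kappa> (butlast m) \<star> \<iota> (last m))"
      using merges_snoc [of "\<lambda>x s. x \<star> \<iota> s" "(*)" \<kappa> m 1, OF linear_mul_left] x
      by (auto simp: mul_unit_right)
    also have "?E (x # r @ [1]) - (merges (*) \<kappa> m - (- 1) ^ length m *\<^sub>C (\<kappa> (butlast m) \<star> \<iota> (last m)))
        = coef_diff n \<kappa> m"
      using m by (simp add: coef_diff_def x mul_unit_right deg_sign_def)
    also have "\<dots> = bar_extend act (n + 1) (coef_diff n \<kappa>) (tensor (1 # m @ [1]))"
      using bar_extend_one [OF dm] m by simp
    finally show "bar_extend act n \<kappa> (bar_diff (tensor (1 # m @ [1])))
        = bar_extend act (n + 1) (coef_diff n \<kappa>) (tensor (1 # m @ [1]))" .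
  qed
qed

end


section \<open>Cochains on a resolution\<close>

locale smash_resolution = smash act
  for act :: "'g::{group_add,finite} \<Rightarrow> 's::complex_algebra \<Rightarrow> 's" +
  fixes P :: "('s, 'p::ab_group_add) aug_complex"
    and gP :: "nat \<Rightarrow> 'g \<Rightarrow> 'p \<Rightarrow> 'p"
    and Psi :: "nat \<Rightarrow> 's tens \<Rightarrow> 'p"
    and Phi :: "nat \<Rightarrow> 'p \<Rightarrow> 's tens"
  assumes resolution: "projective_resolution P"
    and compatible: "G_compatible act P gP"
    and Psi: "chain_map_over_id bar_resolution P Psi"
    and Phi: "chain_map_over_id P bar_resolution Phi"
begin

abbreviation carr :: "nat \<Rightarrow> 'p set" where "carr n \<equiv> bcarrier (cterm P n)"

lemma P_complex: "bimod_complex P"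
  by (rule resolution_complex [OF resolution])

lemma P_bimodule: "bimodule (cterm P n)"
  and P_diff: "bimod_hom (cterm P (Suc n)) (cterm P n) (cdiff P n)"
  and P_aug: "bimod_hom (cterm P 0) regular_bimod (caug P)"
  using P_complex resolution by (simp_all add: bimod_complex_def projective_resolution_def)

lemma P_diff_diff: "x \<in> carr (Suc (Suc n)) \<Longrightarrow> cdiff P n (cdiff P (Suc n) x) = 0"
  using P_complex by (simp add: bimod_complex_def)

lemma Phi_hom: "bimod_hom (cterm P n) (tens_bimod (n + 2)) (Phi n)"
  and Phi_diff: "x \<in> carr (Suc n) \<Longrightarrow> Phi n (cdiff P n x) = bar_diff (Phi (Suc n) x)"
  using Phi by (simp_all add: chain_map_over_id_def)

lemma Phi_mem: "x \<in> carr n \<Longrightarrow> Phi n x \<in> tens_power (n + 2)"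
  using bimod_hom_mem [OF Phi_hom] by simp

lemma Psi_hom: "bimod_hom (tens_bimod (n + 2)) (cterm P n) (Psi n)"
  and Psi_diff: "t \<in> tens_power (n + 3) \<Longrightarrow> Psi n (bar_diff t) = cdiff P n (Psi (Suc n) t)"
  using Psi by (simp_all add: chain_map_over_id_def eval_nat_numeral)

lemma Psi_mem: "t \<in> tens_power (n + 2) \<Longrightarrow> Psi n t \<in> carr n"
  using bimod_hom_mem [OF Psi_hom] by simp

lemma gP_mem: "x \<in> carr n \<Longrightarrow> gP n g x \<in> carr n"
  and gP_zero: "x \<in> carr n \<Longrightarrow> gP n 0 x = x"
  and gP_plus: "x \<in> carr n \<Longrightarrow> gP n (g + h) x = gP n g (gP n h x)"
  and gP_add: "x \<in> carr n \<Longrightarrow> y \<in> carr n \<Longrightarrow> gP n g (x + y) = gP n g x + gP n g y"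
  and gP_lmul: "x \<in> carr n \<Longrightarrow> gP n g (lmul (cterm P n) s x) = lmul (cterm P n) (act g s) (gP n g x)"
  and gP_rmul: "x \<in> carr n \<Longrightarrow> gP n g (rmul (cterm P n) x s) = rmul (cterm P n) (gP n g x) (act g s)"
  and gP_diff: "x \<in> carr (Suc n) \<Longrightarrow> gP n g (cdiff P n x) = cdiff P n (gP (Suc n) g x)"
  and gP_aug: "x \<in> carr 0 \<Longrightarrow> caug P (gP 0 g x) = act g (caug P x)"
  using compatible by (simp_all add: G_compatible_def)

lemma cut_hom_res_cochains:
  assumes \<phi>: "bimod_hom (cterm P n) (smash_bimod act) \<phi>"
  shows "(\<lambda>x. if x \<in> carr n then \<phi> x else 0) \<in> res_cochains act P n"
  using \<phi> P_bimodule [of n]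
  by (simp add: res_cochains_def bimod_hom_def bimodule_add bimodule_lmul bimodule_rmul)

lemma res_cochains_hom: "\<alpha> \<in> res_cochains act P n \<Longrightarrow> bimod_hom (cterm P n) (smash_bimod act) \<alpha>"
  by (simp add: res_cochains_def)

lemma res_cochains_outside: "\<alpha> \<in> res_cochains act P n \<Longrightarrow> x \<notin> carr n \<Longrightarrow> \<alpha> x = 0"
  by (simp add: res_cochains_def)

lemma res_cochains_zero: "(\<lambda>_. 0) \<in> res_cochains act P n"
  by (simp add: res_cochains_def bimod_hom_def)

lemma res_cochains_linear:
  "\<alpha> \<in> res_cochains act P n \<Longrightarrow> \<beta> \<in> res_cochains act P n \<Longrightarrow> (\<lambda>x. \<alpha> x + c *\<^sub>C \<beta> x) \<in> res_cochains act P n"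
  by (simp add: res_cochains_def bimod_hom_def mul_add_left mul_add_right mul_scaleC_left mul_scaleC_right
      scaleC_add_right algebra_simps)

lemma res_diff_linear:
  fixes \<alpha> \<beta> :: "'p \<Rightarrow> ('s, 'g) smash"
  shows "res_diff P n (\<lambda>x. \<alpha> x + c *\<^sub>C \<beta> x) = (\<lambda>x. res_diff P n \<alpha> x + c *\<^sub>C res_diff P n \<beta> x)"
  by (simp add: res_diff_def fun_eq_iff)

lemma res_diff_zero: "res_diff P n (\<lambda>_. 0) = (\<lambda>_. 0 :: ('s, 'g) smash)"
  by (simp add: res_diff_def fun_eq_iff)

lemma res_diff_cochains:
  assumes "\<alpha> \<in> res_cochains act P n"
  shows "res_diff P n \<alpha> \<in> res_cochains act P (Suc n)"
  unfolding res_diff_def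
  by (rule cut_hom_res_cochains) (rule bimod_hom_comp [OF P_diff res_cochains_hom [OF assms]])

lemma res_diff_diff:
  assumes "\<alpha> \<in> res_cochains act P n"
  shows "res_diff P (Suc n) (res_diff P n \<alpha>) = (\<lambda>_. 0)"
  using bimod_hom_0 [OF P_bimodule res_cochains_hom [OF assms]] bimod_hom_mem [OF P_diff]
  by (simp add: res_diff_def fun_eq_iff P_diff_diff)

lemma res_coboundaries_zero: "(\<lambda>_. 0) \<in> res_coboundaries act P n"
  using res_cochains_zero res_diff_zero
  by (cases n) (auto simp: res_coboundaries_def intro!: image_eqI [where x = "\<lambda>_. 0"])

lemma res_coboundaries_linear:
  assumes "\<alpha> \<in> res_coboundaries act P n" "\<beta> \<in> res_coboundaries act P n"
  shows "(\<lambda>x. \<alpha> x + c *\<^sub>C \<beta> x) \<in> res_coboundaries act P n"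
proof (cases n)
  case 0
  then show ?thesis using assms by (simp add: res_coboundaries_def)
next
  case (Suc k)
  then obtain \<alpha>' \<beta>' where "\<alpha>' \<in> res_cochains act P k" "\<alpha> = res_diff P k \<alpha>'"
      "\<beta>' \<in> res_cochains act P k" "\<beta> = res_diff P k \<beta>'"
    using assms by (auto simp: res_coboundaries_def)
  then show ?thesis
    using res_diff_linear [of k \<alpha>' c \<beta>'] res_cochains_linear [of \<alpha>' k \<beta>' c] Suc
    by (simp add: res_coboundaries_def) (metis (no_types, lifting) image_eqI)
qed

lemma res_coboundaries_diff:
  "\<alpha> \<in> res_coboundaries act P n \<Longrightarrow> \<beta> \<in> res_coboundaries act P n \<Longrightarrow> \<alpha> - \<beta> \<in> res_coboundaries act P n"
  using res_coboundaries_linear [of \<alpha> n \<beta> "- 1"] by (simp add: fun_diff_def scaleC_one)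

lemma res_coboundaries_avg:
  fixes \<alpha> :: "'i::finite \<Rightarrow> 'p \<Rightarrow> ('s, 'g) smash"
  assumes "\<And>i. \<alpha> i \<in> res_coboundaries act P n"
  shows "(\<lambda>x. avg (\<lambda>i. \<alpha> i x)) \<in> res_coboundaries act P n"
proof -
  have "(\<lambda>x. \<Sum>i\<in>I. \<alpha> i x) \<in> res_coboundaries act P n" if "finite I" for I
    using that
  proof (induction I rule: finite_induct)
    case (insert i I)
    then show ?case using res_coboundaries_linear [OF assms insert.IH, of i 1] by (simp add: scaleC_one)
  qed (simp add: res_coboundaries_zero)
  from res_coboundaries_linear [OF res_coboundaries_zero this [of UNIV]] show ?thesis
    by (simp add: avg_def)
qed

lemma res_class_eq:
  "res_class act P n \<alpha> = res_class act P n \<beta> \<longleftrightarrow> \<alpha> - \<beta> \<in> res_coboundaries act P n"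
  unfolding res_class_def
  by (rule coh_class_eq [OF res_coboundaries_zero res_coboundaries_diff])

lemma res_cocycles_cochains: "\<alpha> \<in> res_cocycles act P n \<Longrightarrow> \<alpha> \<in> res_cochains act P n"
  by (simp add: res_cocycles_def)

lemma res_cocycles_diff: "\<alpha> \<in> res_cocycles act P n \<Longrightarrow> x \<in> carr (Suc n) \<Longrightarrow> \<alpha> (cdiff P n x) = 0"
  by (simp add: res_cocycles_def res_diff_def fun_eq_iff) metis

lemma res_coboundaries_cocycles: "res_coboundaries act P n \<subseteq> res_cocycles act P n"
  using res_diff_cochains res_diff_diff res_cochains_zero res_diff_zero
  by (cases n) (auto simp: res_coboundaries_def res_cocycles_def)

definition coef_coboundaries :: "nat \<Rightarrow> ('s list \<Rightarrow> ('s, 'g) smash) set" where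
  "coef_coboundaries n = (case n of 0 \<Rightarrow> {\<lambda>_. 0} | Suc k \<Rightarrow> coef_diff k ` cochains k)"

lemma Phi_star_cochains:
  "\<kappa> \<in> cochains n \<Longrightarrow> Phi_star act P Phi n \<kappa> \<in> res_cochains act P n"
  unfolding Phi_star_def [abs_def]
  by (intro cut_hom_res_cochains bimod_hom_comp [OF Phi_hom bar_extend_hom] cochains_multilinear)

lemma Phi_star_linear:
  "Phi_star act P Phi n (\<lambda>l. \<kappa> l + c *\<^sub>C \<kappa>' l)
    = (\<lambda>x. Phi_star act P Phi n \<kappa> x + c *\<^sub>C Phi_star act P Phi n \<kappa>' x)"
  by (simp add: Phi_star_def fun_eq_iff bar_extend_linear)

lemma Phi_star_zero: "Phi_star act P Phi n (\<lambda>_. 0) = (\<lambda>_. 0)"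
  using Phi_star_linear [of n "\<lambda>_. 0" "- 1" "\<lambda>_. 0"] by (simp add: scaleC_one fun_eq_iff)

lemma Phi_star_minus: "Phi_star act P Phi n (\<kappa> - \<kappa>') = Phi_star act P Phi n \<kappa> - Phi_star act P Phi n \<kappa>'"
  using Phi_star_linear [of n \<kappa> "- 1" \<kappa>'] by (simp add: fun_diff_def scaleC_one)

lemma Phi_star_coef_diff:
  assumes \<kappa>: "\<kappa> \<in> cochains n"
  shows "Phi_star act P Phi (Suc n) (coef_diff n \<kappa>) = res_diff P n (Phi_star act P Phi n \<kappa>)"
  using bar_extend_diff [OF \<kappa>] Phi_mem [of _ "Suc n"] bimod_hom_mem [OF P_diff]
  by (simp add: fun_eq_iff Phi_star_def res_diff_def Phi_diff eval_nat_numeral)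

lemma Phi_star_coboundaries:
  "\<kappa> \<in> coef_coboundaries n \<Longrightarrow> Phi_star act P Phi n \<kappa> \<in> res_coboundaries act P n"
  by (cases n) (auto simp: coef_coboundaries_def res_coboundaries_def Phi_star_zero Phi_star_coef_diff
      Phi_star_cochains)

lemma Phi_star_cocycles:
  assumes "\<kappa> \<in> cochains n" "coef_diff n \<kappa> = (\<lambda>_. 0)"
  shows "Phi_star act P Phi n \<kappa> \<in> res_cocycles act P n"
  using Phi_star_cochains [OF assms(1)] Phi_star_coef_diff [OF assms(1)] assms(2)
  by (simp add: res_cocycles_def Phi_star_zero)

lemma Psi_star_cochains:
  assumes "\<alpha> \<in> res_cochains act P n"
  shows "Psi_star Psi n \<alpha> \<in> cochains n"
  unfolding Psi_star_def [abs_def]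
  by (rule cochains_cut)
    (rule coef.bimod_hom_multilinear [OF bimod_hom_comp [OF Psi_hom res_cochains_hom [OF assms]]])

lemma bar_extend_Psi_star:
  assumes \<alpha>: "\<alpha> \<in> res_cochains act P n" and t: "t \<in> tens_power (n + 2)"
  shows "bar_extend act n (Psi_star Psi n \<alpha>) t = \<alpha> (Psi n t)"
proof (rule coef.bimod_hom_eqI [OF _ _ _ t])
  note \<kappa> = cochains_multilinear [OF Psi_star_cochains [OF \<alpha>]]
  show "bimod_hom (tens_bimod (n + 2)) (smash_bimod act) (bar_extend act n (Psi_star Psi n \<alpha>))"
    by (rule bar_extend_hom [OF \<kappa>])
  show "bimod_hom (tens_bimod (n + 2)) (smash_bimod act) (\<lambda>t. \<alpha> (Psi n t))"
    by (rule bimod_hom_comp [OF Psi_hom res_cochains_hom [OF \<alpha>]])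
  show "bar_extend act n (Psi_star Psi n \<alpha>) (tensor (1 # m @ [1])) = \<alpha> (Psi n (tensor (1 # m @ [1])))"
    if "length m = n" for m
    using bar_extend_one [OF \<kappa> that] that by (simp add: Psi_star_def)
qed

text \<open>Both sides are compared through \<open>bar_extend\<close>, which turns
  \<open>coef_diff\<close> into composition with \<open>bar_diff\<close>; that map is intertwined
  with the differential of P by \<open>Psi\<close>.\<close>

lemma coef_diff_Psi_star:
  assumes \<alpha>: "\<alpha> \<in> res_cochains act P n"
  shows "coef_diff n (Psi_star Psi n \<alpha>) = Psi_star Psi (Suc n) (res_diff P n \<alpha>)"
proof
  fix xs :: "'s list"
  note \<kappa> = Psi_star_cochains [OF \<alpha>]
  show "coef_diff n (Psi_star Psi n \<alpha>) xs = Psi_star Psi (Suc n) (res_diff P n \<alpha>) xs"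
  proof (cases "length xs = n + 1")
    case True
    let ?e = "tensor (1 # xs @ [1])"
    have e: "?e \<in> tens_power (n + 3)" using True by (intro tensor_in_tens_power) simp
    have "coef_diff n (Psi_star Psi n \<alpha>) xs = bar_extend act (n + 1) (coef_diff n (Psi_star Psi n \<alpha>)) ?e"
      using bar_extend_one [OF cochains_multilinear [OF coef_diff_cochains [OF \<kappa>]] True] by simp
    also have "\<dots> = bar_extend act n (Psi_star Psi n \<alpha>) (bar_diff ?e)"
      by (rule bar_extend_diff [OF \<kappa> e, symmetric])
    also have "\<dots> = \<alpha> (Psi n (bar_diff ?e))"
      using e bar_diff_power [of ?e "n + 2"] by (intro bar_extend_Psi_star [OF \<alpha>]) (simp add: eval_nat_numeral)
    also have "\<dots> = \<alpha> (cdiff P n (Psi (Suc n) ?e))"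
      by (simp only: Psi_diff [OF e])
    finally show ?thesis
      using True Psi_mem [of ?e "Suc n"] e by (simp add: Psi_star_def res_diff_def eval_nat_numeral)
  next
    case False
    then show ?thesis by (simp add: coef_diff_def Psi_star_def)
  qed
qed

lemma Psi_star_coboundaries:
  "\<alpha> \<in> res_coboundaries act P n \<Longrightarrow> Psi_star Psi n \<alpha> \<in> coef_coboundaries n"
proof (cases n)
  case 0
  assume "\<alpha> \<in> res_coboundaries act P n"
  then show ?thesis using 0 by (simp add: coef_coboundaries_def res_coboundaries_def Psi_star_def [abs_def])
next
  case (Suc k)
  assume "\<alpha> \<in> res_coboundaries act P n"
  then show ?thesis using Suc Psi_star_cochains coef_diff_Psi_star [symmetric]
    by (auto simp: coef_coboundaries_def res_coboundaries_def)
qed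

end

section \<open>Comparison of P with the bar resolution\<close>

context smash_resolution
begin

lemma bar_extend_zero: "bar_extend act n (\<lambda>_. 0) t = 0"
  using bar_extend_linear [of n "\<lambda>_. 0" "- 1" "\<lambda>_. 0" t] by (simp add: scaleC_one)

text \<open>\<open>Psi\<close> followed by \<open>Phi\<close> is a self-map of the bar resolution
  over the identity of S, hence homotopic to the identity. A cocycle over S can thus be recovered,
  up to a coboundary, from its image on P.\<close>

lemma Psi_star_Phi_star:
  assumes \<kappa>: "\<kappa> \<in> cochains n" and d: "coef_diff n \<kappa> = (\<lambda>_. 0)"
  shows "(\<lambda>l. Psi_star Psi n (Phi_star act P Phi n \<kappa>) l - \<kappa> l) \<in> coef_coboundaries n"
proof -
  note \<kappa>m = cochains_multilinear [OF \<kappa>]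
  let ?\<phi> = "bar_extend act n \<kappa>" and ?e = "\<lambda>xs. tensor (1 # xs @ [1]) :: 's tens"
  have F: "chain_map_over_id bar_resolution bar_resolution (\<lambda>k t. Phi k (Psi k t))"
    using bimod_hom_comp [OF Psi_hom Phi_hom] Psi Phi bimod_hom_mem [OF Psi_hom]
    by (simp add: chain_map_over_id_def)
  have id: "chain_map_over_id bar_resolution bar_resolution (\<lambda>k t. t)"
    by (simp add: chain_map_over_id_def bimod_hom_def)
  have pb: "case n of 0 \<Rightarrow> \<forall>t\<in>bcarrier (cterm bar_resolution 0). ?\<phi> (Phi 0 (Psi 0 t)) = ?\<phi> t
    | Suc k \<Rightarrow> \<exists>\<psi>. bimod_hom (cterm bar_resolution k) (smash_bimod act) \<psi> \<and>
        (\<forall>t\<in>bcarrier (cterm bar_resolution (Suc k)). ?\<phi> (Phi (Suc k) (Psi (Suc k) t)) - ?\<phi> t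
          = \<psi> (cdiff bar_resolution k t))"
  proof (rule homotopic_pullback [OF bar_complex bar_complex bar_lifts_cycles F id])
    show "bimod_hom (cterm bar_resolution 0) regular_bimod (caug bar_resolution)"
      using bar_aug_hom by (simp add: numeral_2_eq_2)
    show "bimod_hom (cterm bar_resolution n) (smash_bimod act) ?\<phi>"
      using bar_extend_hom [OF \<kappa>m] by simp
    show "?\<phi> (cdiff bar_resolution n t) = 0" if "t \<in> bcarrier (cterm bar_resolution (Suc n))" for t
      using bar_extend_diff [OF \<kappa>, of t] that d by (simp add: bar_extend_zero eval_nat_numeral)
  qed
  have e: "?e xs \<in> tens_power (n + 2)" if "length xs = n" for xs
    using that by (intro tensor_in_tens_power) simp
  have PP: "Psi_star Psi n (Phi_star act P Phi n \<kappa>) xs - \<kappa> xs = ?\<phi> (Phi n (Psi n (?e xs))) - ?\<phi> (?e xs)"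
    if "length xs = n" for xs
    using that Psi_mem [OF e [OF that]] bar_extend_one [OF \<kappa>m that]
    by (simp add: Psi_star_def Phi_star_def)
  have out: "Psi_star Psi n (Phi_star act P Phi n \<kappa>) xs - \<kappa> xs = 0" if "length xs \<noteq> n" for xs
    using that cochains_length [OF \<kappa> that] by (simp add: Psi_star_def)
  show ?thesis
  proof (cases n)
    case 0
    have "Psi_star Psi n (Phi_star act P Phi n \<kappa>) xs - \<kappa> xs = 0" for xs
      using PP [of xs] out [of xs] pb e [of xs] 0 by (cases "length xs = n") simp_all
    then show ?thesis using 0 by (simp add: coef_coboundaries_def)
  next
    case (Suc k)
    obtain \<psi> where \<psi>: "bimod_hom (tens_bimod (k + 2)) (smash_bimod act) \<psi>"
      and eq: "\<And>t. t \<in> tens_power (Suc k + 2) \<Longrightarrow> ?\<phi> (Phi (Suc k) (Psi (Suc k) t)) - ?\<phi> t = \<psi> (bar_diff t)"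
      using pb Suc by auto
    \<comment> \<open>The homomorphism \<psi> read as a cochain of degree k on S, so that its
      composite with \<open>bar_diff\<close> becomes a \<open>coef_diff\<close>.\<close>
    define \<zeta> where "\<zeta> m = (if length m = k then \<psi> (?e m) else 0)" for m
    have \<zeta>: "\<zeta> \<in> cochains k"
      unfolding \<zeta>_def by (rule cochains_cut) (rule coef.bimod_hom_multilinear [OF \<psi>])
    have \<psi>\<zeta>: "\<psi> t = bar_extend act k \<zeta> t" if "t \<in> tens_power (k + 2)" for t
    proof (rule coef.bimod_hom_eqI [OF \<psi> bar_extend_hom [OF cochains_multilinear [OF \<zeta>]] _ that])
      show "\<psi> (?e m) = bar_extend act k \<zeta> (?e m)" if "length m = k" for m
        using bar_extend_one [OF cochains_multilinear [OF \<zeta>] that] that by (simp add: \<zeta>_def)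
    qed
    have "Psi_star Psi n (Phi_star act P Phi n \<kappa>) xs - \<kappa> xs = coef_diff k \<zeta> xs" for xs
    proof (cases "length xs = n")
      case True
      have e3: "?e xs \<in> tens_power (k + 3)" using e [OF True] Suc by (simp add: eval_nat_numeral)
      have "?\<phi> (Phi n (Psi n (?e xs))) - ?\<phi> (?e xs) = \<psi> (bar_diff (?e xs))"
        using eq [of "?e xs"] e [OF True] Suc by simp
      also have "\<dots> = bar_extend act (k + 1) (coef_diff k \<zeta>) (?e xs)"
        using bar_diff_power [of "?e xs" "k + 2"] e3 bar_extend_diff [OF \<zeta> e3]
        by (simp add: \<psi>\<zeta> eval_nat_numeral)
      also have "\<dots> = coef_diff k \<zeta> xs"
        by (rule bar_extend_one [OF cochains_multilinear [OF coef_diff_cochains [OF \<zeta>]]])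
          (simp add: True Suc)
      finally show ?thesis by (simp only: PP [OF True])
    next
      case False
      then show ?thesis using out [OF False] Suc by (simp add: coef_diff_def)
    qed
    then show ?thesis using \<zeta> Suc by (auto simp: coef_coboundaries_def)
  qed
qed

lemma res_act_cochains:
  assumes \<alpha>: "\<alpha> \<in> res_cochains act P n"
  shows "res_act act P gP n g \<alpha> \<in> res_cochains act P n"
proof -
  note h = res_cochains_hom [OF \<alpha>]
  have "smash_conj act g (x + y) = smash_conj act g x + smash_conj act g y" for x y
    using linear_conj by (simp add: complex_linear_def)
  then have "bimod_hom (cterm P n) (smash_bimod act) (\<lambda>x. smash_conj act g (\<alpha> (gP n (- g) x)))"
    using bimod_hom_add [OF h] bimod_hom_lmul [OF h] bimod_hom_rmul [OF h]
    by (simp add: bimod_hom_def gP_mem gP_add gP_lmul gP_rmul conj_mult conj_iota)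
  then show ?thesis unfolding res_act_def by (rule cut_hom_res_cochains)
qed

lemma res_act_diff:
  "res_act act P gP (Suc n) g (res_diff P n \<alpha>) = res_diff P n (res_act act P gP n g \<alpha>)"
  by (simp add: fun_eq_iff res_act_def res_diff_def gP_mem gP_diff bimod_hom_mem [OF P_diff])

lemma res_act_zero: "res_act act P gP n g (\<lambda>_. 0) = (\<lambda>_. 0)"
  by (simp add: fun_eq_iff res_act_def complex_linear_0 [OF linear_conj])

lemma res_act_minus:
  "res_act act P gP n g (\<alpha> - \<beta>) = res_act act P gP n g \<alpha> - res_act act P gP n g \<beta>"
  by (simp add: fun_eq_iff res_act_def complex_linear_diff [OF linear_conj])

lemma res_act_coboundaries:
  "\<alpha> \<in> res_coboundaries act P n \<Longrightarrow> res_act act P gP n g \<alpha> \<in> res_coboundaries act P n"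
  by (cases n) (auto simp: res_coboundaries_def res_act_zero res_act_diff res_act_cochains)

lemma res_act_res_act:
  assumes "\<alpha> \<in> res_cochains act P n"
  shows "res_act act P gP n g (res_act act P gP n (- g) \<alpha>) = \<alpha>"
proof
  fix x
  show "res_act act P gP n g (res_act act P gP n (- g) \<alpha>) x = \<alpha> x"
    using res_cochains_outside [OF assms]
    by (simp add: res_act_def gP_mem conj_conj conj_0 gP_zero flip: gP_plus)
qed

text \<open>Invariance in \<open>HH_inv\<close> is an equality of sets. One inclusion is the
  condition for \<open>g\<close>; the other comes from the action of \<open>- g\<close>, which is
  inverse to that of \<open>g\<close> on cochains.\<close>

lemma HH_inv_class_iff:
  assumes \<alpha>: "\<alpha> \<in> res_cocycles act P n"
  shows "res_class act P n \<alpha> \<in> HH_inv act P gP n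
    \<longleftrightarrow> (\<forall>g. res_act act P gP n g \<alpha> - \<alpha> \<in> res_coboundaries act P n)"
proof
  assume "res_class act P n \<alpha> \<in> HH_inv act P gP n"
  moreover have "\<alpha> \<in> res_class act P n \<alpha>"
    using res_coboundaries_zero by (simp add: res_class_def coh_class_def fun_diff_def)
  ultimately have "res_act act P gP n g \<alpha> \<in> res_class act P n \<alpha>" for g
    unfolding HH_inv_def by blast
  then show "\<forall>g. res_act act P gP n g \<alpha> - \<alpha> \<in> res_coboundaries act P n"
    by (simp add: res_class_def coh_class_def)
next
  assume inv: "\<forall>g. res_act act P gP n g \<alpha> - \<alpha> \<in> res_coboundaries act P n"
  have "res_act act P gP n g ` res_class act P n \<alpha> \<subseteq> res_class act P n \<alpha>" for g
  proof clarify
    fix \<beta> assume "\<beta> \<in> res_class act P n \<alpha>"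
    then have 1: "res_act act P gP n g (\<beta> - \<alpha>) \<in> res_coboundaries act P n"
      by (simp add: res_act_coboundaries res_class_def coh_class_def)
    have 2: "res_act act P gP n g \<alpha> - \<alpha> \<in> res_coboundaries act P n"
      using inv by blast
    have "res_act act P gP n g \<beta> - \<alpha> = (\<lambda>x. res_act act P gP n g (\<beta> - \<alpha>) x
        + 1 *\<^sub>C (res_act act P gP n g \<alpha> - \<alpha>) x)"
      by (simp add: res_act_minus fun_eq_iff scaleC_one)
    then show "res_act act P gP n g \<beta> \<in> res_class act P n \<alpha>"
      using res_coboundaries_linear [OF 1 2, of 1] by (simp add: res_class_def coh_class_def)
  qed
  note sub = this
  have "res_act act P gP n g ` res_class act P n \<alpha> = res_class act P n \<alpha>" for g
  proof (rule equalityI [OF sub], rule subsetI)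
    fix \<beta> assume \<beta>: "\<beta> \<in> res_class act P n \<alpha>"
    have "\<beta> - \<alpha> \<in> res_cochains act P n"
      using \<beta> res_coboundaries_cocycles res_cocycles_cochains by (auto simp: res_class_def coh_class_def)
    from res_cochains_linear [OF this res_cocycles_cochains [OF \<alpha>], of 1]
    have "\<beta> \<in> res_cochains act P n" by (simp add: scaleC_one)
    from res_act_res_act [OF this, of g]
    show "\<beta> \<in> res_act act P gP n g ` res_class act P n \<alpha>"
      using sub [of "- g"] \<beta> by (metis imageI subsetD)
  qed
  then show "res_class act P n \<alpha> \<in> HH_inv act P gP n"
    using \<alpha> by (simp add: HH_inv_def)
qed

text \<open>Conjugating \<open>\<Phi>\<close> by \<open>g\<close> and composing with \<open>\<Psi>\<close> gives a self-map of \<open>P\<close> over the identity of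
  \<open>S\<close>, which is therefore homotopic to the identity; this compares the two actions of \<open>g\<close>.\<close>

lemma Phi_star_act_Psi_star:
  assumes \<alpha>: "\<alpha> \<in> res_cocycles act P n"
  shows "Phi_star act P Phi n (cochain_act act g (Psi_star Psi n \<alpha>)) - res_act act P gP n g \<alpha>
    \<in> res_coboundaries act P n"
proof -
  note \<alpha>c = res_cocycles_cochains [OF \<alpha>]
  \<comment> \<open>\<open>gP k g\<close> and \<open>bar_act act (- g)\<close> are semilinear with
    opposite twists, so the composite with \<open>Phi\<close> is again a homomorphism of bimodules
    and lies over the identity of S.\<close>
  let ?F = "\<lambda>k x. bar_act act (- g) (Phi k (gP k g x))"
  let ?T = "\<lambda>k x. Psi k (?F k x)"
  have Fm: "?F k x \<in> tens_power (k + 2)" if "x \<in> carr k" for k x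
    using that by (simp add: bar_act_power Phi_mem gP_mem del: add_2_eq_Suc')
  have "bimod_hom (cterm P k) (tens_bimod (k + 2)) (?F k)" for k
  proof -
    have "bar_act act (- g) (s + t) = bar_act act (- g) s + bar_act act (- g) t" for s t
      using bar_act_linear by (simp add: complex_linear_def)
    then show ?thesis
      using Fm bimod_hom_add [OF Phi_hom] bimod_hom_lmul [OF Phi_hom] bimod_hom_rmul [OF Phi_hom]
      by (simp add: bimod_hom_def gP_mem gP_add gP_lmul gP_rmul bar_act_lmul bar_act_rmul)
  qed
  note hT = bimod_hom_comp [OF this Psi_hom]
  have T: "chain_map_over_id P P ?T"
    unfolding chain_map_over_id_def
  proof (intro conjI allI ballI)
    show "bimod_hom (cterm P k) (cterm P k) (?T k)" for k by (rule hT)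
    show "?T k (cdiff P k x) = cdiff P k (?T (Suc k) x)" if "x \<in> carr (Suc k)" for k x
    proof -
      have "?F (Suc k) x \<in> tens_power (k + 3)"
        using Fm [OF that] by (simp add: eval_nat_numeral)
      from Psi_diff [OF this] show ?thesis
        using that by (simp add: gP_diff Phi_diff gP_mem bar_act_diff)
    qed
    show "caug P (?T 0 x) = caug P x" if x: "x \<in> carr 0" for x
    proof -
      have "caug P (?T 0 x) = bar_aug (?F 0 x)"
        using Psi Fm [OF x] by (simp add: chain_map_over_id_def)
      also have "\<dots> = act (- g) (caug P (gP 0 g x))"
        using Phi gP_mem [OF x] by (simp add: chain_map_over_id_def bar_act_aug)
      finally show ?thesis using x by (simp add: gP_aug)
    qed
  qed
  have id: "chain_map_over_id P P (\<lambda>k x. x)"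
    by (simp add: chain_map_over_id_def bimod_hom_def)
  have pb: "case n of 0 \<Rightarrow> \<forall>x\<in>carr 0. \<alpha> (?T 0 x) = \<alpha> x
    | Suc k \<Rightarrow> \<exists>\<psi>. bimod_hom (cterm P k) (smash_bimod act) \<psi> \<and>
        (\<forall>x\<in>carr (Suc k). \<alpha> (?T (Suc k) x) - \<alpha> x = \<psi> (cdiff P k x))"
    by (rule homotopic_pullback [OF P_complex P_complex resolution_lifts_cycles [OF resolution] T id P_aug
          res_cochains_hom [OF \<alpha>c] res_cocycles_diff [OF \<alpha>]])
  let ?D = "Phi_star act P Phi n (cochain_act act g (Psi_star Psi n \<alpha>)) - res_act act P gP n g \<alpha>"
  \<comment> \<open>The difference is rewritten at the point \<open>gP n (- g) y\<close>, where the
    self-map \<open>?T\<close> is compared with the identity.\<close>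
  have D: "?D y = smash_conj act g (\<alpha> (?T n (gP n (- g) y)) - \<alpha> (gP n (- g) y))" if y: "y \<in> carr n" for y
  proof -
    have "gP n g (gP n (- g) y) = y" using y by (simp add: gP_zero flip: gP_plus)
    moreover have "bar_extend act n (cochain_act act g (Psi_star Psi n \<alpha>)) (Phi n y)
        = smash_conj act g (\<alpha> (Psi n (bar_act act (- g) (Phi n y))))"
      using bar_extend_act [OF cochains_multilinear [OF Psi_star_cochains [OF \<alpha>c]] Phi_mem [OF y]]
        bar_extend_Psi_star [OF \<alpha>c bar_act_power [OF Phi_mem [OF y]]] by simp
    ultimately show ?thesis
      using y by (simp add: Phi_star_def res_act_def complex_linear_diff [OF linear_conj])
  qed
  have out: "?D y = 0" if "y \<notin> carr n" for y
    using that by (simp add: Phi_star_def res_act_def)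
  show ?thesis
  proof (cases n)
    case 0
    have "?D y = 0" for y
      using D [of y] out [of y] pb gP_mem [of y 0 "- g"] 0 complex_linear_0 [OF linear_conj]
      by (cases "y \<in> carr n") simp_all
    then have "?D = (\<lambda>_. 0)" by (simp add: fun_eq_iff)
    then show ?thesis by (simp only: res_coboundaries_zero)
  next
    case (Suc k)
    obtain \<psi> where \<psi>: "bimod_hom (cterm P k) (smash_bimod act) \<psi>"
      and eq: "\<And>x. x \<in> carr (Suc k) \<Longrightarrow> \<alpha> (?T (Suc k) x) - \<alpha> x = \<psi> (cdiff P k x)"
      using pb Suc by auto
    let ?\<psi> = "\<lambda>x. if x \<in> carr k then \<psi> x else 0"
    \<comment> \<open>The coboundary found for \<open>?T\<close> is translated by \<open>g\<close>;
      since \<open>res_act\<close> commutes with \<open>res_diff\<close>, the result is again a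
      coboundary.\<close>
    have "?D y = res_act act P gP n g (res_diff P k ?\<psi>) y" for y
    proof (cases "y \<in> carr n")
      case True
      then have y: "y \<in> carr (Suc k)" using Suc by simp
      have "?D y = smash_conj act g (\<psi> (cdiff P k (gP (Suc k) (- g) y)))"
        unfolding D [OF True] unfolding Suc eq [OF gP_mem [OF y]] ..
      then show ?thesis
        using y Suc by (simp add: res_act_def res_diff_def gP_mem bimod_hom_mem [OF P_diff])
    next
      case False
      then show ?thesis using out [OF False] by (simp add: res_act_def)
    qed
    then have "?D = res_diff P k (res_act act P gP k g ?\<psi>)"
      unfolding Suc res_act_diff by (simp add: fun_eq_iff)
    then show ?thesis
      using res_act_cochains [OF cut_hom_res_cochains [OF \<psi>]] Suc
      by (simp add: res_coboundaries_def)
  qed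
qed

section \<open>The isomorphism between HH(A) and the invariants of HH(S, A)\<close>

lemma coef_coboundaries_act:
  assumes "\<kappa> \<in> coef_coboundaries n"
  shows "cochain_act act g \<kappa> \<in> coef_coboundaries n"
proof (cases n)
  case 0
  then show ?thesis
    using assms by (simp add: coef_coboundaries_def cochain_act_def fun_eq_iff complex_linear_0 [OF linear_conj])
next
  case (Suc k)
  then show ?thesis
    using assms by (auto simp: coef_coboundaries_def cochain_act_cochains simp flip: coef_diff_act)
qed

lemma restrict_zero: "restrict_S (\<lambda>_ :: ('s, 'g) smash list. 0) = (\<lambda>_. 0)"
  by (simp add: restrict_S_def fun_eq_iff)

lemma restrict_coboundaries:
  "f \<in> hoch_coboundaries (smash_mult act) n \<Longrightarrow> restrict_S f \<in> coef_coboundaries n"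
  by (cases n) (auto simp: hoch_coboundaries_def coef_coboundaries_def restrict_hoch_diff restrict_cochains
      restrict_zero)

lemma restrict_cocycles:
  assumes "f \<in> hoch_cocycles (smash_mult act) n"
  shows "restrict_S f \<in> cochains n" "coef_diff n (restrict_S f) = (\<lambda>_. 0)"
proof -
  show "coef_diff n (restrict_S f) = (\<lambda>_. 0)"
    using assms by (simp add: hoch_cocycles_def restrict_zero flip: restrict_hoch_diff)
  show "restrict_S f \<in> cochains n" by (rule restrict_cochains [OF cocycles_cochains [OF assms]])
qed

lemma restrict_minus: "restrict_S (f - f') = restrict_S f - restrict_S f'"
  by (simp add: restrict_S_def fun_eq_iff)

abbreviation res_map :: "nat \<Rightarrow> (('s, 'g) smash list \<Rightarrow> ('s, 'g) smash) \<Rightarrow> 'p \<Rightarrow> ('s, 'g) smash" where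
  "res_map n f \<equiv> Phi_star act P Phi n (restrict_S f)"

abbreviation hoch_class ::
    "nat \<Rightarrow> (('s, 'g) smash list \<Rightarrow> ('s, 'g) smash) \<Rightarrow> (('s, 'g) smash list \<Rightarrow> ('s, 'g) smash) set" where
  "hoch_class n \<equiv> coh_class (hoch_coboundaries (smash_mult act) n)"

lemma res_map_cocycles: "f \<in> hoch_cocycles (smash_mult act) n \<Longrightarrow> res_map n f \<in> res_cocycles act P n"
  by (intro Phi_star_cocycles restrict_cocycles)

lemma res_map_class:
  assumes "f - f' \<in> hoch_coboundaries (smash_mult act) n"
  shows "res_class act P n (res_map n f) = res_class act P n (res_map n f')"
  using Phi_star_coboundaries [OF restrict_coboundaries [OF assms]]
  by (simp add: res_class_eq restrict_minus Phi_star_minus)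

lemma HH_iso_class: "HH_iso act P Phi n (hoch_class n f) = res_class act P n (res_map n f)"
proof -
  have "f \<in> hoch_class n f"
    using coboundaries_zero by (simp add: coh_class_def fun_diff_def)
  moreover have "res_class act P n (res_map n f') = res_class act P n (res_map n f)"
    if "f' \<in> hoch_class n f" for f'
    using that by (intro res_map_class) (simp add: coh_class_def)
  ultimately show ?thesis unfolding HH_iso_def by blast
qed

text \<open>\<open>Psi_star\<close> sends the coboundary on P to a coboundary over S, which by
  \<open>Psi_star_Phi_star\<close> is cohomologous to the restriction of f - f';
  \<open>coboundary_of_restrict\<close> then lifts the conclusion to A.\<close>

lemma res_map_injective:
  assumes f: "f \<in> hoch_cocycles (smash_mult act) n" and f': "f' \<in> hoch_cocycles (smash_mult act) n"
    and eq: "res_class act P n (res_map n f) = res_class act P n (res_map n f')"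
  shows "f - f' \<in> hoch_coboundaries (smash_mult act) n"
proof (rule coboundary_of_restrict)
  show h: "f - f' \<in> hoch_cocycles (smash_mult act) n"
    using cocycles_linear [OF f f', of "- 1"] by (simp add: fun_diff_def scaleC_one)
  note \<kappa> = restrict_cocycles [OF h]
  let ?\<kappa> = "restrict_S (f - f')"
  have "res_map n (f - f') \<in> res_coboundaries act P n"
    using eq by (simp add: res_class_eq restrict_minus Phi_star_minus)
  from Psi_star_coboundaries [OF this]
  have 1: "Psi_star Psi n (Phi_star act P Phi n ?\<kappa>) \<in> coef_coboundaries n" .
  note 2 = Psi_star_Phi_star [OF \<kappa>]
  show "case n of 0 \<Rightarrow> ?\<kappa> = (\<lambda>_. 0) | Suc k \<Rightarrow> \<exists>\<zeta>\<in>cochains k. ?\<kappa> = coef_diff k \<zeta>"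
  proof (cases n)
    case 0
    then show ?thesis using 1 2 by (simp add: coef_coboundaries_def fun_eq_iff)
  next
    case (Suc k)
    obtain \<zeta> \<zeta>' where \<zeta>: "\<zeta> \<in> cochains k" "\<zeta>' \<in> cochains k"
      and "Psi_star Psi n (Phi_star act P Phi n ?\<kappa>) = coef_diff k \<zeta>"
      and "(\<lambda>l. Psi_star Psi n (Phi_star act P Phi n ?\<kappa>) l - ?\<kappa> l) = coef_diff k \<zeta>'"
      using 1 2 Suc by (auto simp: coef_coboundaries_def)
    then have "?\<kappa> l = coef_diff k \<zeta> l + (- 1) *\<^sub>C coef_diff k \<zeta>' l" for l
      by (simp add: fun_eq_iff scaleC_one) (metis diff_diff_eq2 add_diff_cancel_left')
    then have "?\<kappa> = coef_diff k (\<lambda>l. \<zeta> l + (- 1) *\<^sub>C \<zeta>' l)"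
      by (simp only: coef_diff_add coef_diff_scale fun_eq_iff) simp
    moreover have "(\<lambda>l. \<zeta> l + (- 1) *\<^sub>C \<zeta>' l) \<in> cochains k"
      by (rule cochains_add [OF \<zeta>(1) cochains_scale [OF \<zeta>(2)]])
    ultimately show ?thesis
      unfolding Suc nat.case by (rule bexI [where x = "\<lambda>l. \<zeta> l + (- 1) *\<^sub>C \<zeta>' l"])
  qed
qed

text \<open>Up to a coboundary, \<open>f\<close> is \<open>Theta_star act n \<kappa>\<close> with
  \<kappa> invariant, so its image is cohomologous to \<open>Phi_star act P Phi n \<kappa>\<close>.
  As \<open>Phi\<close> need not be equivariant, the action on this cocycle is computed through its
  image under \<open>Psi_star\<close>, which differs from \<kappa> by a coboundary.\<close>

lemma res_map_invariant:
  assumes f: "f \<in> hoch_cocycles (smash_mult act) n"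
  shows "res_class act P n (res_map n f) \<in> HH_inv act P gP n"
proof -
  obtain \<kappa> where \<kappa>: "\<kappa> \<in> cochains n" and inv: "\<And>g. cochain_act act g \<kappa> = \<kappa>"
    and b: "f - Theta_star act n \<kappa> \<in> hoch_coboundaries (smash_mult act) n"
    using cocycle_cohomologous_Theta [OF f] by metis
  have "f - Theta_star act n \<kappa> \<in> hoch_cocycles (smash_mult act) n"
    using b coboundaries_cocycles by blast
  from cocycles_linear [OF f this, of "- 1"]
  have "Theta_star act n \<kappa> \<in> hoch_cocycles (smash_mult act) n"
    by (simp add: scaleC_one)
  from restrict_cocycles [OF this] have d: "coef_diff n \<kappa> = (\<lambda>_. 0)"
    by (simp add: restrict_Theta [OF \<kappa>])
  let ?\<alpha> = "Phi_star act P Phi n \<kappa>"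
  have \<alpha>: "?\<alpha> \<in> res_cocycles act P n" by (rule Phi_star_cocycles [OF \<kappa> d])
  have "res_act act P gP n g ?\<alpha> - ?\<alpha> \<in> res_coboundaries act P n" for g
  proof -
    let ?\<delta> = "\<lambda>l. Psi_star Psi n ?\<alpha> l - \<kappa> l"
    let ?\<beta> = "Phi_star act P Phi n (cochain_act act g (Psi_star Psi n ?\<alpha>))"
    have "Phi_star act P Phi n (cochain_act act g ?\<delta>) \<in> res_coboundaries act P n"
      by (intro Phi_star_coboundaries coef_coboundaries_act Psi_star_Phi_star \<kappa> d)
    moreover have "cochain_act act g ?\<delta> = cochain_act act g (Psi_star Psi n ?\<alpha>) - \<kappa>"
      using inv [of g] by (simp add: cochain_act_def fun_eq_iff complex_linear_diff [OF linear_conj])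
    ultimately have 1: "?\<beta> - ?\<alpha> \<in> res_coboundaries act P n"
      by (simp add: Phi_star_minus)
    have "(?\<beta> - ?\<alpha>) - (?\<beta> - res_act act P gP n g ?\<alpha>) \<in> res_coboundaries act P n"
      by (rule res_coboundaries_diff [OF 1 Phi_star_act_Psi_star [OF \<alpha>]])
    then show ?thesis by (simp add: fun_diff_def)
  qed
  then have "res_class act P n ?\<alpha> \<in> HH_inv act P gP n"
    by (simp add: HH_inv_class_iff [OF \<alpha>])
  then show ?thesis
    using res_map_class [OF b] by (simp add: restrict_Theta [OF \<kappa>])
qed

lemma Psi_star_zero: "Psi_star Psi n (\<lambda>_. 0) = (\<lambda>_. 0)"
  by (simp add: Psi_star_def fun_eq_iff)

lemma Theta_zero: "Theta_star act n (\<lambda>_. 0) = (\<lambda>_. 0)"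
  by (simp add: Theta_star_def fun_eq_iff)

text \<open>\<open>Psi\<close> need not be equivariant, so the pullback of \<alpha> along it is made
  invariant by averaging before \<open>Theta_star\<close> is applied.\<close>

definition symmetrized :: "nat \<Rightarrow> ('p \<Rightarrow> ('s, 'g) smash) \<Rightarrow> 's list \<Rightarrow> ('s, 'g) smash" where
  "symmetrized n \<alpha> l = avg (\<lambda>a. cochain_act act a (Psi_star Psi n \<alpha>) l)"

text \<open>By \<open>Phi_star_act_Psi_star\<close> each summand of the average contributes the
  translate of \<alpha> by \<open>a\<close> up to a coboundary, hence the class of \<alpha>, which
  is invariant. This is the explicit inverse of the isomorphism.\<close>

lemma symmetrized_Theta:
  assumes \<alpha>: "\<alpha> \<in> res_cocycles act P n" and inv: "res_class act P n \<alpha> \<in> HH_inv act P gP n"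
  shows "Theta_star act n (symmetrized n \<alpha>) \<in> hoch_cocycles (smash_mult act) n"
    and "res_class act P n (res_map n (Theta_star act n (symmetrized n \<alpha>))) = res_class act P n \<alpha>"
proof -
  note \<alpha>c = res_cocycles_cochains [OF \<alpha>]
  let ?\<kappa> = "\<lambda>a. cochain_act act a (Psi_star Psi n \<alpha>)"
  have \<kappa>a: "?\<kappa> a \<in> cochains n" for a
    by (rule cochain_act_cochains [OF Psi_star_cochains [OF \<alpha>c]])
  have \<kappa>: "symmetrized n \<alpha> \<in> cochains n"
    unfolding symmetrized_def [abs_def] by (rule cochains_avg [OF \<kappa>a])
  have invariant: "cochain_act act g (symmetrized n \<alpha>) = symmetrized n \<alpha>" for g
    unfolding symmetrized_def [abs_def] by (rule avg_invariant)
  have "coef_diff n (Psi_star Psi n \<alpha>) = (\<lambda>_. 0)"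
    using coef_diff_Psi_star [OF \<alpha>c] \<alpha> by (simp add: res_cocycles_def Psi_star_zero)
  then have d: "coef_diff n (symmetrized n \<alpha>) = (\<lambda>_. 0)"
    unfolding symmetrized_def [abs_def] coef_diff_avg coef_diff_act
    by (simp add: cochain_act_def complex_linear_0 [OF linear_conj])
  show "Theta_star act n (symmetrized n \<alpha>) \<in> hoch_cocycles (smash_mult act) n"
    using Theta_coef_diff [OF \<kappa> invariant] Theta_cochains [OF cochains_multilinear [OF \<kappa>]]
    by (simp add: d hoch_cocycles_def Theta_zero)
  have "Phi_star act P Phi n (symmetrized n \<alpha>) x = avg (\<lambda>a. Phi_star act P Phi n (?\<kappa> a) x)" for x
    unfolding symmetrized_def [abs_def]
    by (rule linear_on_cochains_avg [where T = "\<lambda>\<kappa>. Phi_star act P Phi n \<kappa> x", OF _ \<kappa>a])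
      (simp add: Phi_star_linear)
  then have "Phi_star act P Phi n (symmetrized n \<alpha>) - \<alpha>
      = (\<lambda>x. avg (\<lambda>a. Phi_star act P Phi n (?\<kappa> a) x - \<alpha> x))"
    by (simp add: fun_eq_iff avg_diff)
  also have "\<dots> \<in> res_coboundaries act P n"
  proof (rule res_coboundaries_avg)
    fix a
    have 1: "res_act act P gP n a \<alpha> - \<alpha> \<in> res_coboundaries act P n"
      using inv by (simp add: HH_inv_class_iff [OF \<alpha>])
    show "(\<lambda>x. Phi_star act P Phi n (?\<kappa> a) x - \<alpha> x) \<in> res_coboundaries act P n"
      using res_coboundaries_linear [OF Phi_star_act_Psi_star [OF \<alpha>, of a] 1, of 1] by (simp add: scaleC_one)
  qed
  finally show "res_class act P n (res_map n (Theta_star act n (symmetrized n \<alpha>))) = res_class act P n \<alpha>"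
    by (simp add: res_class_eq restrict_Theta [OF \<kappa>])
qed

lemma HH_iso_bij: "bij_betw (HH_iso act P Phi n) (HH (smash_mult act) n) (HH_inv act P gP n)"
  unfolding bij_betw_def
proof
  show "inj_on (HH_iso act P Phi n) (HH (smash_mult act) n)"
  proof (rule inj_onI)
    fix X Y assume "X \<in> HH (smash_mult act) n" "Y \<in> HH (smash_mult act) n"
      and eq: "HH_iso act P Phi n X = HH_iso act P Phi n Y"
    then obtain f f' where f: "f \<in> hoch_cocycles (smash_mult act) n" "X = hoch_class n f"
      and f': "f' \<in> hoch_cocycles (smash_mult act) n" "Y = hoch_class n f'"
      by (auto simp: HH_def)
    then show "X = Y"
      using res_map_injective [OF f(1) f'(1)] eq by (simp add: HH_iso_class hoch_class_eq)
  qed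
  show "HH_iso act P Phi n ` HH (smash_mult act) n = HH_inv act P gP n"
  proof
    show "HH_iso act P Phi n ` HH (smash_mult act) n \<subseteq> HH_inv act P gP n"
      by (auto simp: HH_def HH_iso_class res_map_invariant)
    show "HH_inv act P gP n \<subseteq> HH_iso act P Phi n ` HH (smash_mult act) n"
    proof
      fix c assume c: "c \<in> HH_inv act P gP n"
      then obtain \<alpha> where \<alpha>: "\<alpha> \<in> res_cocycles act P n" "c = res_class act P n \<alpha>"
        by (auto simp: HH_inv_def)
      then have "c = HH_iso act P Phi n (hoch_class n (Theta_star act n (symmetrized n \<alpha>)))"
        using symmetrized_Theta(2) [of \<alpha> n] c by (simp add: HH_iso_class)
      then show "c \<in> HH_iso act P Phi n ` HH (smash_mult act) n"
        using symmetrized_Theta(1) [of \<alpha> n] \<alpha> c by (auto simp: HH_def)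
    qed
  qed
qed

section \<open>The induced bracket\<close>

text \<open>By injectivity of \<open>HH_iso\<close>, \<open>the_inv_into\<close> returns the class
  of the given cocycle, so any cocycles on A with the right images may be used to compute the
  bracket.\<close>

lemma induced_bracket_class:
  assumes f: "f \<in> hoch_cocycles (smash_mult act) p" and g: "g \<in> hoch_cocycles (smash_mult act) q"
  shows "induced_bracket act P Phi p q (res_class act P p (res_map p f)) (res_class act P q (res_map q g))
    = res_class act P (p + q - 1) (res_map (p + q - 1) (gerst_bracket p q f g))"
proof -
  have "the_inv_into (HH (smash_mult act) n) (HH_iso act P Phi n) (res_class act P n (res_map n f))
      = hoch_class n f" if "f \<in> hoch_cocycles (smash_mult act) n" for n f
    unfolding HH_iso_class [symmetric]
    by (rule the_inv_into_f_f) (use HH_iso_bij [of n] that in \<open>auto simp: bij_betw_def HH_def\<close>)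
  then show ?thesis
    using f g by (simp add: induced_bracket_def HH_bracket_class HH_iso_class)
qed

lemma induced_bracket_closed:
  assumes "c \<in> HH_inv act P gP p" "c' \<in> HH_inv act P gP q"
  shows "induced_bracket act P Phi p q c c' \<in> HH_inv act P gP (p + q - 1)"
proof -
  have "\<exists>f \<in> hoch_cocycles (smash_mult act) n. c = res_class act P n (res_map n f)"
    if "c \<in> HH_inv act P gP n" for n c
  proof -
    have "c \<in> HH_iso act P Phi n ` HH (smash_mult act) n"
      using that HH_iso_bij [of n] by (simp add: bij_betw_def)
    then show ?thesis by (auto simp: HH_def HH_iso_class)
  qed
  then obtain f g where "f \<in> hoch_cocycles (smash_mult act) p" "c = res_class act P p (res_map p f)"
      "g \<in> hoch_cocycles (smash_mult act) q" "c' = res_class act P q (res_map q g)"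
    using assms by metis
  then show ?thesis
    by (simp add: induced_bracket_class res_map_invariant gerst_bracket_cocycles del: One_nat_def)
qed

lemma res_map_bracket_avg:
  fixes f g :: "'g \<Rightarrow> ('s, 'g) smash list \<Rightarrow> ('s, 'g) smash"
  assumes f: "\<And>a. f a \<in> cochains p" and g: "\<And>b. g b \<in> cochains q"
  shows "res_map k (gerst_bracket p q (\<lambda>l. avg (\<lambda>a. f a l)) (\<lambda>l. avg (\<lambda>b. g b l))) x
    = avg (\<lambda>a. avg (\<lambda>b. res_map k (gerst_bracket p q (f a) (g b)) x))"
proof -
  let ?D = "\<lambda>f g. res_map k (gerst_bracket p q f g) x"
  have R: "restrict_S (\<lambda>l. h l + c *\<^sub>C h' l) = (\<lambda>l. restrict_S h l + c *\<^sub>C restrict_S h' l)"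
    for h h' :: "('s, 'g) smash list \<Rightarrow> ('s, 'g) smash" and c
    by (simp add: restrict_S_def fun_eq_iff)
  have left: "?D (\<lambda>l. avg (\<lambda>a. f a l)) h = avg (\<lambda>a. ?D (f a) h)" if h: "h \<in> cochains q" for h
    by (rule linear_on_cochains_avg [where T = "\<lambda>f. ?D f h", OF _ f])
      (simp add: gerst_bracket_linear_left h R Phi_star_linear)
  have right: "?D h (\<lambda>l. avg (\<lambda>b. g b l)) = avg (\<lambda>b. ?D h (g b))" if h: "h \<in> cochains p" for h
    by (rule linear_on_cochains_avg [where T = "\<lambda>g. ?D h g", OF _ g])
      (simp add: gerst_bracket_linear_right h R Phi_star_linear)
  show ?thesis
    unfolding left [OF cochains_avg [OF g]] right [OF f] ..
qed

lemma Theta_symmetrized: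
  assumes \<alpha>: "\<alpha> \<in> res_cocycles act P n"
  shows "Theta_star act n (symmetrized n \<alpha>)
    = (\<lambda>l. avg (\<lambda>a. Theta_star act n (cochain_act act a (Psi_star Psi n \<alpha>)) l))"
proof
  fix l
  show "Theta_star act n (symmetrized n \<alpha>) l
      = avg (\<lambda>a. Theta_star act n (cochain_act act a (Psi_star Psi n \<alpha>)) l)"
    unfolding symmetrized_def [abs_def]
    by (rule linear_on_cochains_avg [where n = n and T = "\<lambda>\<kappa>. Theta_star act n \<kappa> l"])
      (simp_all add: Theta_linear cochains_multilinear cochain_act_cochains Psi_star_cochains
        res_cocycles_cochains [OF \<alpha>])
qed

text \<open>By bilinearity \<gamma> is not only cohomologous but equal to the image of the bracket
  of the two symmetrized cocycles. It is therefore a cocycle, and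
  \<open>induced_bracket_class\<close> gives its class.\<close>

lemma induced_bracket_formula:
  assumes \<alpha>: "\<alpha> \<in> res_cocycles act P p" and \<beta>: "\<beta> \<in> res_cocycles act P q"
    and "res_class act P p \<alpha> \<in> HH_inv act P gP p" "res_class act P q \<beta> \<in> HH_inv act P gP q"
  defines "\<gamma> \<equiv> \<lambda>x. (1 / (of_nat CARD('g))\<^sup>2) *\<^sub>C (\<Sum>a\<in>UNIV. \<Sum>b\<in>UNIV.
    res_map (p + q - 1) (gerst_bracket p q
      (Theta_star act p (cochain_act act a (Psi_star Psi p \<alpha>)))
      (Theta_star act q (cochain_act act b (Psi_star Psi q \<beta>)))) x)"
  shows "\<gamma> \<in> res_cocycles act P (p + q - 1) \<and> res_class act P (p + q - 1) \<gamma>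
    = induced_bracket act P Phi p q (res_class act P p \<alpha>) (res_class act P q \<beta>)"
proof -
  let ?f = "Theta_star act p (symmetrized p \<alpha>)" and ?g = "Theta_star act q (symmetrized q \<beta>)"
  have T: "Theta_star act n (cochain_act act a (Psi_star Psi n \<alpha>)) \<in> cochains n"
    if "\<alpha> \<in> res_cocycles act P n" for n a \<alpha>
    by (intro Theta_cochains cochains_multilinear cochain_act_cochains Psi_star_cochains
        res_cocycles_cochains that)
  have "\<gamma> = res_map (p + q - 1) (gerst_bracket p q ?f ?g)"
  proof
    fix x
    have "res_map (p + q - 1) (gerst_bracket p q ?f ?g) x
      = avg (\<lambda>a. avg (\<lambda>b. res_map (p + q - 1) (gerst_bracket p q
          (Theta_star act p (cochain_act act a (Psi_star Psi p \<alpha>)))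
          (Theta_star act q (cochain_act act b (Psi_star Psi q \<beta>)))) x))"
      unfolding Theta_symmetrized [OF \<alpha>] Theta_symmetrized [OF \<beta>]
      by (rule res_map_bracket_avg) (rule T \<alpha> \<beta>)+
    \<comment> \<open>Each of the two averages contributes one factor 1 / |G|.\<close>
    also have "\<dots> = \<gamma> x"
      by (simp add: \<gamma>_def avg_def scaleC_scaleC power2_eq_square flip: cvec.scale_sum_right)
    finally show "\<gamma> x = res_map (p + q - 1) (gerst_bracket p q ?f ?g) x" ..
  qed
  then show ?thesis
    using symmetrized_Theta [OF \<alpha> assms(3)] symmetrized_Theta [OF \<beta> assms(4)]
      induced_bracket_class [of ?f p ?g q] res_map_cocycles gerst_bracket_cocycles
    by simp
qed

end

theorem theorem4p7:
  fixes act :: "'g::{group_add,finite} \<Rightarrow> 's::complex_algebra \<Rightarrow> 's"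
    and P :: "('s, 'p::ab_group_add) aug_complex"
    and gP :: "nat \<Rightarrow> 'g \<Rightarrow> 'p \<Rightarrow> 'p"
    and Psi :: "nat \<Rightarrow> 's tens \<Rightarrow> 'p"
    and Phi :: "nat \<Rightarrow> 'p \<Rightarrow> 's tens"
  assumes "algebra_action act"
    and "projective_resolution P"
    and "G_compatible act P gP"
    and "chain_map_over_id bar_resolution P Psi"
    and "chain_map_over_id P bar_resolution Phi"
  shows
    "(\<forall>n. bij_betw (HH_iso act P Phi n) (HH (smash_mult act) n) (HH_inv act P gP n)) \<and>
     (\<forall>p q. \<forall>c \<in> HH_inv act P gP p. \<forall>c' \<in> HH_inv act P gP q.
        induced_bracket act P Phi p q c c' \<in> HH_inv act P gP (p + q - 1)) \<and>
     (\<forall>p q. \<forall>\<alpha> \<in> res_cocycles act P p. \<forall>\<beta> \<in> res_cocycles act P q.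
        res_class act P p \<alpha> \<in> HH_inv act P gP p \<longrightarrow> res_class act P q \<beta> \<in> HH_inv act P gP q \<longrightarrow>
        (let \<gamma> = (\<lambda>x. (1 / (of_nat CARD('g))\<^sup>2) *\<^sub>C
               (\<Sum>a\<in>UNIV. \<Sum>b\<in>UNIV.
                  Phi_star act P Phi (p + q - 1)
                    (restrict_S
                      (gerst_bracket p q
                        (Theta_star act p (cochain_act act a (Psi_star Psi p \<alpha>)))
                        (Theta_star act q (cochain_act act b (Psi_star Psi q \<beta>))))) x))
         in \<gamma> \<in> res_cocycles act P (p + q - 1) \<and>
            res_class act P (p + q - 1) \<gamma> =
              induced_bracket act P Phi p q (res_class act P p \<alpha>) (res_class act P q \<beta>)))"
proof -
  interpret smash_resolution act P gP Psi Phi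
    by unfold_locales (use assms in simp_all)
  show ?thesis
    unfolding Let_def using HH_iso_bij induced_bracket_closed induced_bracket_formula by blast
qed

end
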